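(* Let $\ell\ge2$ be an integer. For every integer $j$ with $1\le j\le\ell$ and $\gcd(j,\ell)=1$, $$N_3(x;\ell,j):=\#\{n\le x:\ P_3(n)\equiv j\ (\mathrm{mod}\ \ell)\}=\frac{x}{\varphi(\ell)}+O\!\left(\frac{x(\log\log x)^3}{\log x}\right)$$ as $x\to\infty$; that is, the sequence $\{P_3(n)\}$ is uniformly distributed in the reduced residue classes modulo $\ell$.
   Context: For a positive integer $n$ with distinct prime factors $q_1>q_2>\cdots>q_r$, $P_3(n):=q_3$ if $r\ge3$ and $P_3(n):=1$ if $r<3$ (i.e. $P_3(n)$ is the third largest distinct prime factor of $n$). $\varphi$ is Euler's totient function. Implied constants may depend on $\ell$. *)

theory Defs
  imports Complex_Main "HOL-Number_Theory.Number_Theory" "HOL-Library.Landau_Symbols"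
begin

definition P3 :: "nat \<Rightarrow> nat" where
  "P3 n = (if card (prime_factors n) \<ge> 3
           then rev (sorted_list_of_set (prime_factors n)) ! 2 else 1)"

definition res_count :: "(nat \<Rightarrow> nat) \<Rightarrow> nat \<Rightarrow> nat \<Rightarrow> real \<Rightarrow> nat" where
  "res_count a l j x = card {n. 0 < n \<and> real n \<le> x \<and> [a n = j] (mod l)}"

definition N3 :: "real \<Rightarrow> nat \<Rightarrow> nat \<Rightarrow> nat" where
  "N3 x l j = res_count P3 l j x"

(* Uniform distribution of (a n), n >= 1, in the reduced residue classes modulo l:
   each such class has density 1 / totient l relative to all positive integers n,
   not only relative to those n with a n coprime to l. *)
definition unif_dist_reduced :: "(nat \<Rightarrow> nat) \<Rightarrow> nat \<Rightarrow> bool" where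
  "unif_dist_reduced a l \<longleftrightarrow>
     (\<forall>j\<in>{1..l}. coprime j l \<longrightarrow>
        ((\<lambda>x. real (res_count a l j x) / x) \<longlongrightarrow> 1 / real (totient l)) at_top)"

end

theory Submission
  imports Defs "HOL-Computational_Algebra.Squarefree" "HOL-Real_Asymp.Real_Asymp"
begin

text \<open>
  Put \<open>c(p) = [p = j (mod l)] - 1 / \<phi>(l)\<close>. Mertens' theorem for arithmetic progressions says that
  the sums of \<open>c(p) ln p / p\<close> are bounded; this is the only input about the distribution of primes,
  the prime number theorem is not needed. Write \<open>n = r1 r2 m\<close> with \<open>r1\<close>, \<open>r2\<close> the powers of the two
  largest primes, so that \<open>P3 n\<close> is the largest prime factor \<open>p\<close> of \<open>m\<close>, and weight \<open>n\<close> by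
  \<open>ln n = ln m + ln r1 + ln r2\<close>. The term \<open>ln m\<close> leads to sums over \<open>m \<le> y\<close> of \<open>c(p) ln m\<close>; in the
  terms \<open>ln r1\<close>, \<open>ln r2\<close> the weighted prime power is summed together with \<open>m\<close>.

  Moebius inversion over integers \<open>d\<close> free of primes \<open>\<le> p\<close> expresses the counts of \<open>p\<close>-smooth numbers
  that occur through sums of \<open>\<mu>(d) / d\<close>, which are bounded by 2. While \<open>p\<close> runs through \<open>[T, T\<^sup>2]\<close>,
  the condition on \<open>d\<close> can be replaced at bounded cost by one that does not depend on \<open>p\<close>, and the sum
  over \<open>p\<close> is then \<open>O(y)\<close> by Mertens. There are \<open>O(ln ln x)\<close> such intervals, and the summation over
  \<open>r1\<close> and \<open>r2\<close> costs at most \<open>(ln ln x)\<^sup>2\<close>; dividing by \<open>ln x\<close> gives the error term.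
\<close>

section \<open>Chebyshev and Mertens estimates\<close>

text \<open>The obstacle: the main term attached to a prime p is \<open>R0 p (y / p)\<close>, a
  Moebius sum whose set of d changes with p, while the weights c(p) ln p / p have bounded sums but
  no decay, so partial summation in p alone fails. The dependence on p is removed by factoring a
  p-rough d as a b, where the primes of a lie in (p, T^2] and those of b exceed T^2. For fixed a,
  roughness is an upper bound on p and merely shortens the interval of primes; the sum of 1 / a is
  bounded because the sum of 1 / p over [T, T^2] is. For fixed b, the truncation p b <= y is vacuous
  when b <= y / T^2; the remaining b fill O(ln T) dyadic blocks, each of weight O(1 / ln T). The
  weight ln n makes bounded Mertens sums sufficient: the prime power that carries the logarithm is
  counted by \<open>mangoldt\<close>, for which Chebyshev's bound is available. Constants are
  explicit: 60 is the error in the sum of 1 / p and 4 the price of an Euler product, whence the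
  recurring \<open>exp 64\<close> and \<open>exp 67\<close>.\<close>

definition pos_le :: "real \<Rightarrow> nat set" where
  "pos_le z = {n. 0 < n \<and> real n \<le> z}"

lemma mem_pos_le [simp]: "n \<in> pos_le z \<longleftrightarrow> 0 < n \<and> real n \<le> z"
  by (simp add: pos_le_def)

lemma pos_le_altdef: "pos_le z = {1..nat \<lfloor>z\<rfloor>}"
  by (auto simp: le_nat_floor Suc_le_eq) linarith

lemma finite_pos_le [simp, intro]: "finite (pos_le z)"
  by (simp add: pos_le_altdef)

lemma finite_Collect_pos_le [simp, intro]: "finite {n. 0 < n \<and> real n \<le> z \<and> P n}"
  by (rule finite_subset[OF _ finite_pos_le[of z]]) auto

lemma pos_le_empty [simp]: "z < 1 \<Longrightarrow> pos_le z = {}"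
  by (auto simp: pos_le_def)

lemma card_pos_le: "card (pos_le z) = nat \<lfloor>z\<rfloor>"
  by (simp add: pos_le_altdef)

lemma card_pos_le_le: "0 \<le> z \<Longrightarrow> real (card (pos_le z)) \<le> z"
  by (simp add: card_pos_le)

lemma card_pos_le_ge: "z - 1 \<le> real (card (pos_le z))"
  unfolding card_pos_le by linarith

lemma pos_le_mono: "y \<le> z \<Longrightarrow> pos_le y \<subseteq> pos_le z"
  by (auto simp: pos_le_def)

lemma pos_le_of_nat: "pos_le (real n) = {1..n}"
  by (simp add: pos_le_altdef)

lemma le_of_mult_le:
  fixes d k :: nat
  assumes "k > 0" "real d * real k \<le> z"
  shows "real d \<le> z"
proof -
  have "real d * 1 \<le> real d * real k" using assms by (intro mult_left_mono) auto
  with assms show ?thesis by linarith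
qed

lemma pos_le_Sigma_swap:
  "d \<in> pos_le z \<and> k \<in> pos_le (z / real d) \<longleftrightarrow> d > 0 \<and> k > 0 \<and> real d * real k \<le> z"
  using le_of_mult_le[of k d z] by (cases "d = 0") (auto simp: field_simps)

lemma pos_le_Sigma:
  "Sigma (pos_le z) (\<lambda>d. pos_le (z / real d)) = {(d, k). d > 0 \<and> k > 0 \<and> real d * real k \<le> z}"
  using pos_le_Sigma_swap[of _ z] by blast

text \<open>Both sides run over the pairs with d k <= z. A summand depending on n is presented as a
  function of \<open>d\<close> and \<open>n div d\<close>, which is why later proofs first rewrite n
  as \<open>d * (n div d)\<close>. Since the cutoff is real, nested quotients
  \<open>z / d / k\<close> occur without floors.\<close>

lemma sum_divisors_swap:
  "(\<Sum>n\<in>pos_le z. \<Sum>d | d dvd n. f d (n div d)) =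
     (\<Sum>d\<in>pos_le z. \<Sum>k\<in>pos_le (z / real d). f d k)"
proof -
  have fin: "finite {d. d dvd n}" if "n \<in> pos_le z" for n
    using that by (intro finite_divisors_nat) auto
  have "(\<Sum>n\<in>pos_le z. \<Sum>d | d dvd n. f d (n div d)) =
      (\<Sum>(n, d)\<in>Sigma (pos_le z) (\<lambda>n. {d. d dvd n}). f d (n div d))"
    using fin by (subst sum.Sigma) auto
  also have "\<dots> = (\<Sum>(d, k)\<in>Sigma (pos_le z) (\<lambda>d. pos_le (z / real d)). f d k)"
    unfolding pos_le_Sigma
    by (rule sum.reindex_bij_witness[where i = "\<lambda>(d, k). (d * k, d)" and j = "\<lambda>(n, d). (d, n div d)"])
       (auto elim!: dvdE)
  also have "\<dots> = (\<Sum>d\<in>pos_le z. \<Sum>k\<in>pos_le (z / real d). f d k)"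
    by (subst sum.Sigma) auto
  finally show ?thesis .
qed

lemma sum_pos_le_swap:
  "(\<Sum>d\<in>pos_le z. \<Sum>k\<in>pos_le (z / real d). f d k) =
   (\<Sum>k\<in>pos_le z. \<Sum>d\<in>pos_le (z / real k). f d k)"
proof -
  have "(\<Sum>d\<in>pos_le z. \<Sum>k\<in>pos_le (z / real d). f d k) =
      (\<Sum>(d, k)\<in>Sigma (pos_le z) (\<lambda>d. pos_le (z / real d)). f d k)"
    by (subst sum.Sigma) auto
  also have "\<dots> = (\<Sum>(k, d)\<in>Sigma (pos_le z) (\<lambda>k. pos_le (z / real k)). f d k)"
    unfolding pos_le_Sigma
    by (rule sum.reindex_bij_witness[where i = prod.swap and j = prod.swap]) (auto simp: mult.commute)
  also have "\<dots> = (\<Sum>k\<in>pos_le z. \<Sum>d\<in>pos_le (z / real k). f d k)"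
    by (subst sum.Sigma) auto
  finally show ?thesis .
qed

section \<open>Stirling's formula, Chebyshev's bound and Mertens' first theorem\<close>

definition sum_ln :: "real \<Rightarrow> real" where
  "sum_ln z = (\<Sum>n\<in>pos_le z. ln (real n))"

definition psi :: "real \<Rightarrow> real" where
  "psi z = (\<Sum>n\<in>pos_le z. mangoldt n)"

lemma psi_nonneg: "psi z \<ge> 0"
  by (auto simp: psi_def intro!: sum_nonneg mangoldt_nonneg)

lemma ln_Suc_diff_le: "n > 0 \<Longrightarrow> ln (real (Suc n)) - ln (real n) \<le> 1 / real n"
proof -
  assume "n > 0"
  then have "ln (real (Suc n)) - ln (real n) = ln (real (Suc n) / real n)"
    by (subst ln_div) auto
  also have "real (Suc n) / real n = 1 + 1 / real n" using \<open>n > 0\<close> by (simp add: field_simps)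
  also have "ln (1 + 1 / real n) \<le> 1 / real n" by (rule ln_add_one_self_le_self) simp
  finally show ?thesis .
qed

lemma ln_Suc_diff_ge: "n > 0 \<Longrightarrow> ln (real (Suc n)) - ln (real n) \<ge> 1 / real (Suc n)"
proof -
  assume n: "n > 0"
  then have "ln (real n) - ln (real (Suc n)) = ln (real n / real (Suc n))"
    by (subst ln_div) auto
  also have "\<dots> \<le> real n / real (Suc n) - 1" using n by (intro ln_le_minus_one) auto
  also have "\<dots> = - (1 / real (Suc n))" by (simp add: field_simps)
  finally show ?thesis by simp
qed

lemma ln_ge_half: "2 \<le> t \<Longrightarrow> ln (real t) \<ge> 1 / 2"
proof -
  assume "2 \<le> t"
  then have "ln (real t) \<ge> ln 2" by simp
  moreover have "ln (2::real) \<ge> 1 / 2" using ln_le_minus_one[of "1/2"] by (simp add: ln_div)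
  ultimately show ?thesis by linarith
qed

text \<open>Stirling's formula with a logarithmic error. The induction compares
  \<open>ln (n + 1) - ln n\<close> with \<open>1 / n\<close> for the lower and with
  \<open>1 / (n + 1)\<close> for the upper bound.\<close>

lemma sum_ln_nat_bounds:
  assumes "n > 0"
  shows "real n * ln n - n + 1 \<le> sum_ln (real n)" "sum_ln (real n) \<le> real n * ln n - n + 1 + ln n"
  using assms
proof (induction n rule: nat_induct_non_zero)
  case 1
  case 1 show ?case by (simp add: sum_ln_def pos_le_of_nat[of 1, simplified])
next
  case 1
  case 2 show ?case by (simp add: sum_ln_def pos_le_of_nat[of 1, simplified])
next
  case (Suc n)
  have eq: "sum_ln (real (Suc n)) = sum_ln (real n) + ln (real (Suc n))"
    unfolding sum_ln_def pos_le_of_nat by simp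
  case 1
  have "real n * (ln (real (Suc n)) - ln (real n)) \<le> 1"
    using ln_Suc_diff_le[of n] Suc.hyps by (simp add: field_simps)
  with Suc.IH(1) eq show ?case by (simp add: algebra_simps)
next
  case (Suc n)
  have eq: "sum_ln (real (Suc n)) = sum_ln (real n) + ln (real (Suc n))"
    unfolding sum_ln_def pos_le_of_nat by simp
  case 2
  have "real (Suc n) * (ln (real (Suc n)) - ln (real n)) \<ge> 1"
    using ln_Suc_diff_ge[of n] Suc.hyps by (simp add: field_simps)
  with Suc.IH(2) eq show ?case by (simp add: algebra_simps)
qed

lemma sum_ln_bound:
  assumes "z \<ge> 1"
  shows "\<bar>sum_ln z - (z * ln z - z)\<bar> \<le> 1 + ln z"
proof -
  define n where "n = nat \<lfloor>z\<rfloor>"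
  have n: "n > 0" "real n \<le> z" "z \<le> real n + 1" using assms unfolding n_def by linarith+
  have eq: "sum_ln z = sum_ln (real n)"
    unfolding sum_ln_def pos_le_altdef n_def by simp
  have "z - real n \<ge> 0" using n by simp
  have ln0: "ln (real n) \<ge> 0" "ln z \<ge> 0" "ln (real n) \<le> ln z" using n by auto
  have "ln z - ln (real n) = ln (z / real n)" using n by (subst ln_div) auto
  also have "\<dots> \<le> z / real n - 1" using n by (intro ln_le_minus_one) auto
  finally have 1: "real n * (ln z - ln (real n)) \<le> z - real n" using n by (simp add: field_simps)
  have "ln (real n) - ln z = ln (real n / z)" using n by (subst ln_div) auto
  also have "\<dots> \<le> real n / z - 1" using n by (intro ln_le_minus_one) auto
  finally have 2: "z * (ln z - ln (real n)) \<ge> z - real n" using n by (simp add: field_simps)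
  have 3: "(z - real n) * ln z \<le> ln z" "(z - real n) * ln (real n) \<ge> 0"
    using n ln0 by (auto intro!: mult_left_le_one_le)
  show ?thesis
    using sum_ln_nat_bounds[OF n(1)] 1 2 3 ln0 unfolding eq by (simp add: algebra_simps abs_le_iff)
qed

text \<open>This is the price of replacing \<open>ln n\<close> by \<open>ln z\<close> under a sum
  over n. It is O(z) because \<open>card (pos_le z) * ln z\<close> and \<open>sum_ln z\<close> share
  the main term \<open>z * ln z\<close>.\<close>

lemma sum_ln_div_le:
  assumes "z > 0"
  shows "(\<Sum>n\<in>pos_le z. ln (z / real n)) \<le> 2 * z"
proof (cases "z \<ge> 1")
  case True
  have "(\<Sum>n\<in>pos_le z. ln (z / real n)) = (\<Sum>n\<in>pos_le z. ln z - ln (real n))"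
    using assms by (intro sum.cong) (auto simp: ln_div)
  also have "\<dots> = real (card (pos_le z)) * ln z - sum_ln z"
    by (simp add: sum_subtractf sum_ln_def)
  also have "\<dots> \<le> z * ln z - sum_ln z"
    using True card_pos_le_le[of z] by (simp add: mult_right_mono)
  also have "\<dots> \<le> 2 * z"
    using sum_ln_bound[OF True] ln_le_minus_one[of z] True by (simp add: abs_le_iff)
  finally show ?thesis .
qed (use assms in simp)

lemma sum_ln_eq_mangoldt: "sum_ln z = (\<Sum>d\<in>pos_le z. mangoldt d * real (card (pos_le (z / real d))))"
proof -
  have "sum_ln z = (\<Sum>n\<in>pos_le z. \<Sum>d | d dvd n. mangoldt d)"
    unfolding sum_ln_def by (intro sum.cong) (simp_all add: mangoldt_sum)
  also have "\<dots> = (\<Sum>d\<in>pos_le z. \<Sum>k\<in>pos_le (z / real d). mangoldt d)"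
    by (rule sum_divisors_swap[where f = "\<lambda>d k. mangoldt d"])
  finally show ?thesis by (simp add: mult.commute)
qed

lemma sum_ln_eq_psi: "sum_ln z = (\<Sum>k\<in>pos_le z. psi (z / real k))"
proof -
  have "sum_ln z = (\<Sum>d\<in>pos_le z. \<Sum>k\<in>pos_le (z / real d). mangoldt d)"
    by (simp add: sum_ln_eq_mangoldt mult.commute)
  also have "\<dots> = (\<Sum>k\<in>pos_le z. \<Sum>d\<in>pos_le (z / real k). mangoldt d)"
    by (rule sum_pos_le_swap)
  finally show ?thesis by (simp add: psi_def)
qed

text \<open>Chebyshev's argument: the number of multiples of d up to z, minus twice the number up to
  z / 2, is nonnegative and at least 1 for z / 2 < d <= z. Summed against \<open>mangoldt\<close> it
  gives \<open>sum_ln z - 2 * sum_ln (z / 2)\<close>, where the terms \<open>z * ln z\<close>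
  cancel.\<close>

lemma psi_le_psi_half:
  assumes "z \<ge> 2"
  shows "psi z - psi (z / 2) \<le> 5 * z"
proof -
  have "psi z - psi (z / 2) = (\<Sum>d\<in>pos_le z - pos_le (z / 2). mangoldt d)"
    unfolding psi_def using assms by (subst sum_diff) (auto intro: pos_le_mono)
  also have "\<dots> \<le> (\<Sum>d\<in>pos_le z. mangoldt d *
      (real (card (pos_le (z / real d))) - 2 * real (card (pos_le (z / 2 / real d)))))"
  proof (rule order_trans[OF _ sum_mono2])
    have "real (card (pos_le (z / real d))) \<ge> 1" "card (pos_le (z / 2 / real d)) = 0"
      if "d \<in> pos_le z - pos_le (z / 2)" for d
    proof -
      have "1 \<le> \<lfloor>z / real d\<rfloor>" "\<lfloor>z / 2 / real d\<rfloor> < 1"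
        using that by (auto simp: field_simps le_floor_iff floor_less_iff)
      then show "real (card (pos_le (z / real d))) \<ge> 1" "card (pos_le (z / 2 / real d)) = 0"
        unfolding card_pos_le by linarith+
    qed
    then have "mangoldt d * 1 \<le> mangoldt d *
      (real (card (pos_le (z / real d))) - 2 * real (card (pos_le (z / 2 / real d))))"
      if "d \<in> pos_le z - pos_le (z / 2)" for d
      using that by (intro mult_left_mono mangoldt_nonneg) fastforce
    then show "(\<Sum>d\<in>pos_le z - pos_le (z / 2). mangoldt d) \<le>
      (\<Sum>d\<in>pos_le z - pos_le (z / 2). mangoldt d *
      (real (card (pos_le (z / real d))) - 2 * real (card (pos_le (z / 2 / real d)))))"
      by (intro sum_mono) simp
  next
    fix d assume "d \<in> pos_le z - (pos_le z - pos_le (z / 2))"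
    have "real (card (pos_le (z / real d))) - 2 * real (card (pos_le (z / 2 / real d))) \<ge> 0"
    proof -
      have "2 * \<lfloor>w\<rfloor> \<le> \<lfloor>2 * w\<rfloor>" for w :: real by linarith
      from this[of "z / 2 / real d"] show ?thesis
        unfolding card_pos_le using assms by (simp add: nat_mono)
    qed
    then show "0 \<le> mangoldt d *
        (real (card (pos_le (z / real d))) - 2 * real (card (pos_le (z / 2 / real d))))"
      by (intro mult_nonneg_nonneg mangoldt_nonneg) auto
  qed auto
  also have "\<dots> = sum_ln z - 2 * (\<Sum>d\<in>pos_le z. mangoldt d * real (card (pos_le (z / 2 / real d))))"
    by (simp add: sum_ln_eq_mangoldt sum_subtractf sum_distrib_left algebra_simps)
  also have "(\<Sum>d\<in>pos_le z. mangoldt d * real (card (pos_le (z / 2 / real d)))) = sum_ln (z / 2)"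
    unfolding sum_ln_eq_mangoldt
  proof (rule sum.mono_neutral_right)
    show "\<forall>d\<in>pos_le z - pos_le (z / 2). mangoldt d * real (card (pos_le (z / 2 / real d))) = 0"
    proof
      fix d assume "d \<in> pos_le z - pos_le (z / 2)"
      then have "z / 2 / real d < 1" by (auto simp: field_simps)
      then show "mangoldt d * real (card (pos_le (z / 2 / real d))) = 0"
        by (simp only: pos_le_empty card.empty of_nat_0 mult_zero_right)
    qed
  qed (use assms in \<open>auto intro!: pos_le_mono\<close>)
  also have "sum_ln z - 2 * sum_ln (z / 2) \<le> 5 * z"
  proof -
    have 1: "sum_ln z \<le> z * ln z - z + 1 + ln z" using sum_ln_bound[of z] assms by (simp add: abs_le_iff)
    have "sum_ln (z / 2) \<ge> z / 2 * ln (z / 2) - z / 2 - 1 - ln (z / 2)"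
      using sum_ln_bound[of "z / 2"] assms by (simp only: abs_le_iff) linarith
    moreover have "ln (z / 2) = ln z - ln 2" using assms by (simp add: ln_div)
    moreover have "z / 2 * (ln z - ln 2) = z * ln z / 2 - z * ln 2 / 2" by (simp add: field_simps)
    ultimately have 2: "sum_ln (z / 2) \<ge> z * ln z / 2 - z * ln 2 / 2 - z / 2 - 1 - ln z + ln 2"
      by (simp add: diff_divide_distrib)
    have 3: "ln z \<le> z - 1" "ln (2::real) \<ge> 0" using assms ln_le_minus_one[of z] by auto
    have "z * ln 2 \<le> z * 1" using assms ln_le_minus_one[of 2] by (intro mult_left_mono) auto
    with 1 2 3 show ?thesis using assms by linarith
  qed
  finally show ?thesis .
qed

text \<open>Halving: \<open>5 * z + 10 * (z / 2) = 10 * z\<close>. The recursion stops at z < 2,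
  where only n = 1 is left and \<open>mangoldt 1 = 0\<close>.\<close>

lemma psi_le: "z \<ge> 0 \<Longrightarrow> psi z \<le> 10 * z"
proof (induction "nat \<lfloor>z\<rfloor>" arbitrary: z rule: less_induct)
  case less
  show ?case
  proof (cases "z < 2")
    case True
    then have "pos_le z \<subseteq> {1}" by auto
    then have "psi z \<le> (\<Sum>n\<in>{1}. mangoldt n)"
      unfolding psi_def by (intro sum_mono2) (auto intro: mangoldt_nonneg)
    with less.prems show ?thesis by simp
  next
    case False
    then have "psi (z / 2) \<le> 10 * (z / 2)"
      by (intro less.hyps) linarith+
    with psi_le_psi_half[of z] False show ?thesis by simp
  qed
qed

text \<open>Removing the floors from \<open>sum_ln_eq_mangoldt\<close> costs at most
  \<open>psi z \<le> 10 * z\<close>, and Stirling's formula differs from \<open>z * ln z\<close> by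
  at most \<open>3 * z\<close>; after division by z this makes 13.\<close>

lemma sum_mangoldt_div_bound:
  assumes "z \<ge> 1"
  shows "\<bar>(\<Sum>d\<in>pos_le z. mangoldt d / real d) - ln z\<bar> \<le> 13"
proof -
  have ev: "mangoldt d * (z / real d) - mangoldt d * real (card (pos_le (z / real d))) \<in> {0..mangoldt d}" for d
  proof -
    have "0 \<le> z / real d" using assms by simp
    then have "z / real d - real (card (pos_le (z / real d))) \<in> {0..1}"
      using card_pos_le_le[of "z / real d"] card_pos_le_ge[of "z / real d"] by (auto simp: algebra_simps)
    then have "mangoldt d * (z / real d - real (card (pos_le (z / real d)))) \<in> {0..mangoldt d}"
      by (auto intro!: mult_nonneg_nonneg mult_left_le mangoldt_nonneg)
    then show ?thesis by (simp add: algebra_simps)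
  qed
  have "z * (\<Sum>d\<in>pos_le z. mangoldt d / real d) - sum_ln z =
     (\<Sum>d\<in>pos_le z. mangoldt d * (z / real d) - mangoldt d * real (card (pos_le (z / real d))))"
    by (simp add: sum_ln_eq_mangoldt sum_subtractf sum_distrib_left mult_ac)
  moreover have "\<dots> \<ge> 0" using ev by (intro sum_nonneg) auto
  moreover have "\<dots> \<le> psi z" unfolding psi_def using ev by (intro sum_mono) auto
  moreover have "psi z \<le> 10 * z" using assms by (intro psi_le) auto
  moreover have "\<bar>sum_ln z - (z * ln z - z)\<bar> \<le> 1 + ln z" by (rule sum_ln_bound[OF assms])
  moreover have "ln z \<le> z" "0 \<le> ln z" using ln_le_minus_one[of z] assms by auto
  ultimately have "\<bar>z * (\<Sum>d\<in>pos_le z. mangoldt d / real d) - z * ln z\<bar> \<le> 13 * z"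
    using assms by (simp add: abs_le_iff)
  also have "z * (\<Sum>d\<in>pos_le z. mangoldt d / real d) - z * ln z =
      z * ((\<Sum>d\<in>pos_le z. mangoldt d / real d) - ln z)" by (simp add: algebra_simps)
  finally show ?thesis using assms by (simp add: abs_mult mult.commute)
qed

text \<open>Prime powers are kept as pairs because later sums need the prime and the exponent
  separately; the cutoff concerns the value \<open>q ^ a\<close>.\<close>

definition ppow_le :: "real \<Rightarrow> (nat \<times> nat) set" where
  "ppow_le z = {(q, a). prime q \<and> a > 0 \<and> real (q ^ a) \<le> z}"

lemma mem_ppow_le [simp]: "(q, a) \<in> ppow_le z \<longleftrightarrow> prime q \<and> a > 0 \<and> real (q ^ a) \<le> z"
  by (simp add: ppow_le_def)

lemma exponent_less_prime_power: "prime (q::nat) \<Longrightarrow> a < q ^ a"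
  using power_gt_expt[of q a] prime_gt_1_nat by simp

lemma ppow_le_subset: "ppow_le z \<subseteq> pos_le z \<times> pos_le z"
proof safe
  fix q a assume "(q, a) \<in> ppow_le z"
  then have *: "prime q" "a > 0" "real (q ^ a) \<le> z" by auto
  have "q ^ 1 \<le> q ^ a" using * by (intro power_increasing) (auto simp: Suc_le_eq prime_gt_0_nat)
  then have "real q \<le> real (q ^ a)" by (subst of_nat_le_iff) simp
  moreover have "real a \<le> real (q ^ a)"
    using exponent_less_prime_power[OF *(1), of a] by (subst of_nat_le_iff) simp
  ultimately have "real q \<le> z" "real a \<le> z" using * by linarith+
  then show "q \<in> pos_le z" "a \<in> pos_le z" using * prime_gt_0_nat[of q] by auto
qed

lemma finite_ppow_le [simp, intro]: "finite (ppow_le z)"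
  by (rule finite_subset[OF ppow_le_subset]) auto

lemma inj_on_prime_power: "inj_on (\<lambda>(q, a). q ^ a) {(q, a). prime (q::nat) \<and> a > 0}"
proof (rule inj_onI, clarify)
  fix p a q b :: nat assume "prime p" "a > 0" "prime q" "b > 0" "p ^ a = q ^ b"
  then show "p = q \<and> a = b" using prime_power_inj''[of p q a b] by simp
qed

lemma sum_mangoldt_eq_ppow:
  "(\<Sum>n\<in>pos_le z. mangoldt n * f n) = (\<Sum>(q, a)\<in>ppow_le z. ln (real q) * f (q ^ a))"
proof -
  have "(\<Sum>(q, a)\<in>ppow_le z. ln (real q) * f (q ^ a)) =
      (\<Sum>r\<in>ppow_le z. mangoldt (case r of (q, a) \<Rightarrow> q ^ a) * f (case r of (q, a) \<Rightarrow> q ^ a))"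
    by (intro sum.cong) auto
  also have "\<dots> = (\<Sum>n\<in>(\<lambda>(q, a). q ^ a) ` ppow_le z. mangoldt n * f n)"
    by (subst sum.reindex) (auto intro: inj_on_subset[OF inj_on_prime_power] simp: o_def)
  also have "\<dots> = (\<Sum>n\<in>pos_le z. mangoldt n * f n)"
  proof (intro sum.mono_neutral_left ballI)
    fix n assume n: "n \<in> pos_le z - (\<lambda>(q, a). q ^ a) ` ppow_le z"
    show "mangoldt n * f n = 0"
    proof (rule ccontr)
      assume "mangoldt n * f n \<noteq> 0"
      then have "primepow n" by (auto simp: mangoldt_def split: if_splits)
      then obtain q a where "prime q" "a > 0" "n = q ^ a" by (auto simp: primepow_def)
      then have "n = (\<lambda>(q, a). q ^ a) (q, a)" "(q, a) \<in> ppow_le z" using n by auto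
      with n show False by blast
    qed
  qed (auto simp: prime_gt_0_nat)
  finally show ?thesis ..
qed

lemma ln_of_nat_nonneg [simp]: "ln (real n) \<ge> 0"
  by (cases "n = 0") auto

text \<open>Enlarging the index set to a rectangle lets the exponent run freely, so that the inner
  sum becomes a geometric series.\<close>

lemma sum_ppow_le_le:
  assumes "\<And>q a. prime q \<Longrightarrow> a > 0 \<Longrightarrow> f q a \<ge> (0::real)"
  shows "(\<Sum>(q, a)\<in>ppow_le z. f q a) \<le> (\<Sum>q | q \<in> pos_le z \<and> prime q. \<Sum>a=1..nat \<lfloor>z\<rfloor>. f q a)"
proof -
  have "(\<Sum>(q, a)\<in>ppow_le z. f q a) \<le> (\<Sum>(q, a)\<in>{q\<in>pos_le z. prime q} \<times> {1..nat \<lfloor>z\<rfloor>}. f q a)"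
    using ppow_le_subset[of z] assms unfolding pos_le_altdef[symmetric]
    by (intro sum_mono2 finite_cartesian_product) (auto intro: finite_subset[OF _ finite_pos_le[of z]])
  then show ?thesis by (subst (asm) sum.Sigma [symmetric]) (simp_all del: mem_pos_le)
qed

section \<open>Convergent series over primes and prime powers\<close>

lemma sum_inverse_power_le:
  assumes "x > (1::real)"
  shows "(\<Sum>a=1..N. 1 / x ^ a) \<le> 1 / (x - 1)"
proof -
  have "(\<Sum>a=1..N. 1 / x ^ a) * (x - 1) = 1 - 1 / x ^ N"
  proof (induction N)
    case (Suc N)
    have "(\<Sum>a=1..Suc N. 1 / x ^ a) * (x - 1) = (\<Sum>a=1..N. 1 / x ^ a) * (x - 1) + (x - 1) / x ^ Suc N"
      by (simp add: distrib_right)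
    also have "\<dots> = 1 - 1 / x ^ Suc N" unfolding Suc.IH using assms by (simp add: field_simps)
    finally show ?case .
  qed auto
  also have "\<dots> \<le> 1" using assms by simp
  finally show ?thesis using assms by (simp add: field_simps)
qed

text \<open>The differentiated geometric series. The exact remainder in the first step is what makes
  the induction close.\<close>

lemma sum_mult_inverse_power_le:
  assumes "x > (1::real)"
  shows "(\<Sum>a=1..N. real a / x ^ Suc a) \<le> 1 / (x - 1)\<^sup>2"
proof -
  have "(\<Sum>a=1..N. real a / x ^ Suc a) * (x - 1)\<^sup>2 = 1 - (x + real N * (x - 1)) / x ^ Suc N"
  proof (induction N)
    case (Suc N)
    have "(\<Sum>a=1..Suc N. real a / x ^ Suc a) * (x - 1)\<^sup>2 =
        (\<Sum>a=1..N. real a / x ^ Suc a) * (x - 1)\<^sup>2 + real (Suc N) * (x - 1)\<^sup>2 / x ^ Suc (Suc N)"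
      by (simp add: distrib_right)
    also have "\<dots> = 1 - (x * (x + real N * (x - 1)) - real (Suc N) * (x - 1)\<^sup>2) / x ^ Suc (Suc N)"
      unfolding Suc.IH using assms by (simp add: diff_divide_distrib)
    also have "x * (x + real N * (x - 1)) - real (Suc N) * (x - 1)\<^sup>2 = x + real (Suc N) * (x - 1)"
      by (simp add: algebra_simps power2_eq_square)
    finally show ?case .
  qed (use assms in auto)
  also have "\<dots> \<le> 1" using assms by simp
  finally show ?thesis using assms by (simp add: field_simps)
qed

lemma sum_ln_div_mult_le: "(\<Sum>n=2..N. ln (real n) / (real n * (real n - 1))) \<le> 2"
proof (cases "N > 0")
  case True
  \<comment> \<open>The subtracted term bounds the tail, which behaves like the integral of
    \<open>ln t / t^2\<close>. The 2 gives equality at N = 1 and absorbs the difference between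
    neighbouring integers.\<close>
  then have "(\<Sum>n=2..N. ln (real n) / (real n * (real n - 1))) \<le> 2 - (ln (real N) + 2) / real N"
  proof (induction N rule: nat_induct_non_zero)
    case (Suc n)
    have "real n * real (Suc n) * (ln (real (Suc n)) / (real (Suc n) * (real (Suc n) - 1))) = ln (real (Suc n))"
      using Suc.hyps by simp
    also have "\<dots> \<le> (ln (real n) + 2) * real (Suc n) - (ln (real (Suc n)) + 2) * real n"
    proof -
      have "real (Suc n) * (ln (real (Suc n)) - ln (real n)) \<le> real (Suc n) * (1 / real n)"
        by (intro mult_left_mono ln_Suc_diff_le Suc.hyps) auto
      also have "\<dots> \<le> 2" using Suc.hyps by (simp add: field_simps)
      finally show ?thesis by (simp add: algebra_simps)
    qed
    also have "\<dots> = real n * real (Suc n) * ((ln (real n) + 2) / real n - (ln (real (Suc n)) + 2) / real (Suc n))"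
      using Suc.hyps by (simp add: right_diff_distrib del: of_nat_Suc)
    finally have "ln (real (Suc n)) / (real (Suc n) * (real (Suc n) - 1)) \<le>
        (ln (real n) + 2) / real n - (ln (real (Suc n)) + 2) / real (Suc n)"
      using Suc.hyps by (subst (asm) mult_le_cancel_left_pos) auto
    with Suc show ?case by simp
  qed auto
  moreover have "(ln (real N) + 2) / real N \<ge> 0" using True by simp
  ultimately show ?thesis by linarith
qed auto

lemma sum_primes_ln_div_mult_le: "(\<Sum>p | p \<in> pos_le z \<and> prime p. ln (real p) / (real p * (real p - 1))) \<le> 2"
proof -
  have "(\<Sum>p | p \<in> pos_le z \<and> prime p. ln (real p) / (real p * (real p - 1))) \<le>
      (\<Sum>p=2..nat \<lfloor>z\<rfloor>. ln (real p) / (real p * (real p - 1)))"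
    unfolding pos_le_altdef by (rule sum_mono2) (auto simp: prime_ge_2_nat intro!: divide_nonneg_nonneg)
  with sum_ln_div_mult_le show ?thesis using order_trans by blast
qed

lemma sum_inverse_power_ge2_le:
  assumes "x > (1::real)"
  shows "(\<Sum>a=1..N. if a = 1 then 0 else 1 / x ^ a) \<le> 1 / (x * (x - 1))"
proof (cases N)
  case (Suc M)
  have "(\<Sum>a=1..Suc M. if a = 1 then 0 else 1 / x ^ a) = (\<Sum>a=Suc 1..Suc M. 1 / x ^ a)"
    by (subst sum.atLeast_Suc_atMost) (auto intro!: sum.cong)
  also have "\<dots> = (\<Sum>a=1..M. 1 / x ^ Suc a)"
    by (rule sum.shift_bounds_cl_Suc_ivl)
  also have "\<dots> = (\<Sum>a=1..M. 1 / x ^ a) / x"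
    by (simp add: sum_divide_distrib mult.commute)
  also have "\<dots> \<le> 1 / (x - 1) / x"
    using assms by (intro divide_right_mono sum_inverse_power_le) auto
  finally show ?thesis using Suc by (simp add: mult.commute)
qed (use assms in auto)

lemma sum_ppow_split_primes:
  "(\<Sum>(q, a)\<in>ppow_le z. f q a) =
     (\<Sum>p | p \<in> pos_le z \<and> prime p. f p 1) + (\<Sum>(q, a)\<in>ppow_le z. if a = 1 then 0 else f q a :: real)"
proof -
  have "(\<Sum>p | p \<in> pos_le z \<and> prime p. f p 1) = (\<Sum>(q, a)\<in>ppow_le z. if a = 1 then f q a else 0)"
    by (rule sum.reindex_bij_witness_not_neutral[where i = fst and j = "\<lambda>p. (p, 1)"
          and S' = "{}" and T' = "{(q, a)\<in>ppow_le z. a \<noteq> 1}"])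
       (auto intro: finite_subset[OF _ finite_ppow_le] dest: prime_gt_0_nat)
  moreover have "(\<Sum>(q, a)\<in>ppow_le z. f q a) = (\<Sum>(q, a)\<in>ppow_le z. if a = 1 then f q a else 0) +
      (\<Sum>(q, a)\<in>ppow_le z. if a = 1 then 0 else f q a)"
    unfolding sum.distrib [symmetric] by (intro sum.cong) auto
  ultimately show ?thesis by simp
qed

lemma sum_ppow_higher_ln_le:
  "(\<Sum>(q, a)\<in>ppow_le z. if a = 1 then 0 else ln (real q) / real q ^ a) \<le> 2"
proof -
  have "(\<Sum>(q, a)\<in>ppow_le z. if a = 1 then 0 else ln (real q) / real q ^ a) \<le>
      (\<Sum>q | q \<in> pos_le z \<and> prime q. \<Sum>a=1..nat \<lfloor>z\<rfloor>. if a = 1 then 0 else ln (real q) / real q ^ a)"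
    by (rule sum_ppow_le_le) auto
  also have "\<dots> \<le> (\<Sum>q | q \<in> pos_le z \<and> prime q. ln (real q) / (real q * (real q - 1)))"
  proof (intro sum_mono)
    fix q assume "q \<in> {q. q \<in> pos_le z \<and> prime q}"
    then have q: "real q > 1" using prime_gt_1_nat by auto
    have "(\<Sum>a=1..nat \<lfloor>z\<rfloor>. if a = 1 then 0 else ln (real q) / real q ^ a) =
        ln (real q) * (\<Sum>a=1..nat \<lfloor>z\<rfloor>. if a = 1 then 0 else 1 / real q ^ a)"
      unfolding sum_distrib_left by (intro sum.cong) auto
    also have "\<dots> \<le> ln (real q) * (1 / (real q * (real q - 1)))"
      using q by (intro mult_left_mono sum_inverse_power_ge2_le) auto
    finally show "(\<Sum>a=1..nat \<lfloor>z\<rfloor>. if a = 1 then 0 else ln (real q) / real q ^ a) \<le>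
        ln (real q) / (real q * (real q - 1))" by simp
  qed
  also have "\<dots> \<le> 2" by (rule sum_primes_ln_div_mult_le)
  finally show ?thesis .
qed

text \<open>The constant is 13 from the sum with \<open>mangoldt\<close> plus 2 for the proper prime
  powers.\<close>

lemma sum_primes_ln_div_bound:
  assumes "z \<ge> 1"
  shows "\<bar>(\<Sum>p | p \<in> pos_le z \<and> prime p. ln (real p) / real p) - ln z\<bar> \<le> 15"
proof -
  define R where "R = (\<Sum>(q, a)\<in>ppow_le z. if a = 1 then 0 else ln (real q) / real q ^ a)"
  have "(\<Sum>d\<in>pos_le z. mangoldt d / real d) = (\<Sum>(q, a)\<in>ppow_le z. ln (real q) / real q ^ a)"
    using sum_mangoldt_eq_ppow[of "\<lambda>d. 1 / real d" z] by simp
  then have eq: "(\<Sum>d\<in>pos_le z. mangoldt d / real d) =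
      (\<Sum>p | p \<in> pos_le z \<and> prime p. ln (real p) / real p) + R"
    unfolding R_def by (subst (asm) sum_ppow_split_primes) simp
  have nonneg: "R \<ge> 0"
    unfolding R_def by (intro sum_nonneg) auto
  have "R \<le> 2" unfolding R_def by (rule sum_ppow_higher_ln_le)
  then show ?thesis using eq nonneg sum_mangoldt_div_bound[OF assms] by (simp add: abs_le_iff)
qed

section \<open>Partial summation: the sum of reciprocals of primes\<close>

lemma inverse_diff_le_ln:
  fixes u v :: real
  assumes "u > 0" "v > 0"
  shows "u * (1 / u - 1 / v) \<le> ln v - ln u"
proof -
  have "u * (1 / u - 1 / v) = 1 - u / v" using assms by (simp add: field_simps)
  with ln_le_minus_one[of "u / v"] assms show ?thesis by (simp add: ln_div)
qed

lemma sum_primes_inverse_le: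
  fixes t n :: nat
  assumes "2 \<le> t" "t \<le> n"
  shows "(\<Sum>p | p \<in> {t<..n} \<and> prime p. 1 / real p) \<le> ln (ln (real n)) - ln (ln (real t)) + 60"
proof -
  define A where "A = (\<lambda>n::nat. \<Sum>p | p \<in> {1..n} \<and> prime p. ln (real p) / real p)"
  have A: "\<bar>A n - ln (real n)\<bar> \<le> 15" if "n \<ge> 1" for n
    using sum_primes_ln_div_bound[of "real n"] that unfolding A_def pos_le_of_nat by simp
  \<comment> \<open>Partial summation of \<open>A n\<close> against \<open>1 / ln n\<close>, written
    as an invariant for induction on n. The main part \<open>ln n\<close> of \<open>A n\<close>
    produces the double logarithms, its error 15 the last term.\<close>
  have "(\<Sum>p | p \<in> {t<..n} \<and> prime p. 1 / real p) \<le>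
      A n / ln n - A t / ln t + ln (ln n) - ln (ln t) + 15 * (1 / ln t - 1 / ln n)"
    using assms(2)
  proof (induction n rule: dec_induct)
    case base
    show ?case by simp
  next
    case (step n)
    let ?l = "ln (real n)" and ?l' = "ln (real (Suc n))"
    have l: "?l > 0" "?l' > 0" "?l \<le> ?l'" using step.hyps assms by auto
    have eqs: "{p. p \<in> {t<..Suc n} \<and> prime p} =
        (if prime (Suc n) then insert (Suc n) {p. p \<in> {t<..n} \<and> prime p} else {p. p \<in> {t<..n} \<and> prime p})"
      "{p. p \<in> {1..Suc n} \<and> prime p} =
        (if prime (Suc n) then insert (Suc n) {p. p \<in> {1..n} \<and> prime p} else {p. p \<in> {1..n} \<and> prime p})"
      using step.hyps by (auto simp: le_Suc_eq)
    have "A (Suc n) - A n = (if prime (Suc n) then ?l' / real (Suc n) else 0)"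
      unfolding A_def eqs by simp
    then have 1: "(\<Sum>p | p \<in> {t<..Suc n} \<and> prime p. 1 / real p) =
        (\<Sum>p | p \<in> {t<..n} \<and> prime p. 1 / real p) + (A (Suc n) - A n) / ?l'"
      using l unfolding eqs by simp
    have 2: "A n / ?l + (A (Suc n) - A n) / ?l' =
        A (Suc n) / ?l' + 15 * (1 / ?l - 1 / ?l') + (A n - 15) * (1 / ?l - 1 / ?l')"
      by (simp add: algebra_simps diff_divide_distrib)
    have "(A n - 15) * (1 / ?l - 1 / ?l') \<le> ?l * (1 / ?l - 1 / ?l')"
    proof (rule mult_right_mono)
      show "A n - 15 \<le> ?l" using A[of n] step.hyps assms by (simp add: abs_le_iff)
      show "0 \<le> 1 / ?l - 1 / ?l'" using frac_le[of 1 1 ?l ?l'] l by simp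
    qed
    with inverse_diff_le_ln[of ?l ?l'] l
    have "(A n - 15) * (1 / ?l - 1 / ?l') \<le> ln ?l' - ln ?l" by linarith
    with 1 2 step.IH show ?case by (simp only: right_diff_distrib)
  qed
  moreover have "A n / ln n \<le> 1 + 15 / ln n"
  proof -
    have "A n / ln n \<le> (ln n + 15) / ln n"
      using A[of n] assms by (intro divide_right_mono) (auto simp: abs_le_iff)
    then show ?thesis using assms by (simp add: add_divide_distrib)
  qed
  moreover have "A t / ln t \<ge> 1 - 15 / ln t"
  proof -
    have "(ln t - 15) / ln t \<le> A t / ln t"
      using A[of t] assms by (intro divide_right_mono) (auto simp: abs_le_iff)
    then show ?thesis using assms by (simp add: diff_divide_distrib)
  qed
  \<comment> \<open>The two boundary terms and the error term add up to \<open>30 / ln t\<close>,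
    and \<open>ln t \<ge> ln 2 \<ge> 1 / 2\<close>. This is the origin of 60.\<close>
  moreover have "30 / ln t \<le> 60"
  proof -
    have "ln t \<ge> ln 2" using assms by simp
    moreover have "ln (2::real) \<ge> 1 / 2" using ln_ge_half[of 2] by simp
    ultimately have "ln t \<ge> 1 / 2" by linarith
    then show ?thesis by (simp add: field_simps)
  qed
  ultimately show ?thesis by (simp add: algebra_simps)
qed

section \<open>Smooth and rough numbers\<close>

text \<open>Positivity is part of both predicates because \<open>prime_factors 0\<close> is empty. A
  prime equal to the threshold is smooth, so that every prime power is exactly one of smooth and
  rough.\<close>

definition smooth :: "nat \<Rightarrow> nat \<Rightarrow> bool" where
  "smooth t n \<longleftrightarrow> n > 0 \<and> (\<forall>p\<in>prime_factors n. p \<le> t)"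

definition rough :: "nat \<Rightarrow> nat \<Rightarrow> bool" where
  "rough t n \<longleftrightarrow> n > 0 \<and> (\<forall>p\<in>prime_factors n. t < p)"

lemma smooth_pos: "smooth t n \<Longrightarrow> n > 0"
  and rough_pos: "rough t n \<Longrightarrow> n > 0"
  by (simp_all add: smooth_def rough_def)

lemma smooth_1 [simp]: "smooth t (Suc 0)"
  and rough_1 [simp]: "rough t (Suc 0)"
  by (simp_all add: smooth_def rough_def)

lemma smooth_mult_iff: "smooth t (m * n) \<longleftrightarrow> smooth t m \<and> smooth t n"
  by (cases "m = 0 \<or> n = 0") (auto simp: smooth_def prime_factors_product)

lemma rough_mult_iff: "rough t (m * n) \<longleftrightarrow> rough t m \<and> rough t n"
  by (cases "m = 0 \<or> n = 0") (auto simp: rough_def prime_factors_product)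

lemma smooth_dvd: "smooth t n \<Longrightarrow> d dvd n \<Longrightarrow> smooth t d"
  by (auto simp: smooth_mult_iff elim!: dvdE)

lemma smooth_mono: "smooth s n \<Longrightarrow> s \<le> t \<Longrightarrow> smooth t n"
  by (fastforce simp: smooth_def)

lemma rough_mono: "rough t n \<Longrightarrow> s \<le> t \<Longrightarrow> rough s n"
  by (fastforce simp: rough_def)

lemma smooth_prime_power: "prime q \<Longrightarrow> a > 0 \<Longrightarrow> smooth t (q ^ a) \<longleftrightarrow> q \<le> t"
  by (auto simp: smooth_def prime_factors_power prime_prime_factors prime_gt_0_nat)

lemma rough_prime_power: "prime q \<Longrightarrow> a > 0 \<Longrightarrow> rough t (q ^ a) \<longleftrightarrow> t < q"
  by (auto simp: rough_def prime_factors_power prime_prime_factors prime_gt_0_nat)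

lemma rough_gt:
  assumes "rough t n" "n > 1"
  shows "t < n"
proof -
  obtain p where "prime p" "p dvd n" using assms(2) prime_factor_nat[of n] by auto
  then have "p \<in> prime_factors n" using assms(2) by (auto simp: in_prime_factors_iff)
  then have "t < p" using assms(1) by (auto simp: rough_def)
  moreover have "p \<le> n" using \<open>p dvd n\<close> assms(2) by (intro dvd_imp_le) auto
  ultimately show ?thesis by simp
qed

lemma coprime_smooth_rough:
  assumes "smooth t a" "rough t b"
  shows "coprime a b"
proof (rule ccontr)
  assume "\<not> coprime a b"
  then have "gcd a b \<noteq> 1" using coprime_iff_gcd_eq_1 by blast
  then obtain p where "prime p" "p dvd gcd a b" using prime_factor_nat by blast
  then have "p \<in> prime_factors a" "p \<in> prime_factors b"
    using assms smooth_pos rough_pos by (auto simp: in_prime_factors_iff)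
  with assms show False by (fastforce simp: smooth_def rough_def)
qed

text \<open>A truncated Euler product. Each n splits off its full power of p, which embeds the index
  set into a product set; the factor \<open>1 + 1 / (p - 1)\<close> is the complete geometric
  series.\<close>

lemma sum_inverse_prime_factors_subset_le:
  assumes "finite P" "\<forall>p\<in>P. prime p"
  shows "(\<Sum>n | n \<in> pos_le z \<and> prime_factors n \<subseteq> P. 1 / real n) \<le> (\<Prod>p\<in>P. 1 + 1 / (real p - 1))"
  using assms
proof (induction P rule: finite_induct)
  case empty
  have "{n. n \<in> pos_le z \<and> prime_factors n \<subseteq> {}} \<subseteq> {1}"
    by (auto simp: prime_factorization_empty_iff)
  then have "(\<Sum>n | n \<in> pos_le z \<and> prime_factors n \<subseteq> {}. 1 / real n) \<le> (\<Sum>n\<in>{1}. 1 / real n)"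
    by (intro sum_mono2) auto
  then show ?case by simp
next
  case (insert p P)
  let ?S = "\<lambda>P. {n. n \<in> pos_le z \<and> prime_factors n \<subseteq> P}"
  define N where "N = nat \<lfloor>z\<rfloor>"
  have p: "prime p" using insert.prems by simp
  have fin: "finite (?S P)" for P by (rule finite_subset[OF _ finite_pos_le[of z]]) auto
  have sub: "?S (insert p P) \<subseteq> (\<lambda>(a, m). p ^ a * m) ` ({0..N} \<times> ?S P)"
  proof
    fix n assume n: "n \<in> ?S (insert p P)"
    then have "n \<noteq> 0" "\<not> is_unit p" using p not_prime_unit by auto
    then obtain m where m: "n = p ^ multiplicity p n * m" "\<not> p dvd m"
      by (rule multiplicity_decompose')
    define a where "a = multiplicity p n"
    have n': "n > 0" "real n \<le> z" using n by auto
    have "m > 0" using m(2) by (cases m) auto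
    have "m dvd n" "p ^ a dvd n" using m(1) unfolding a_def by (metis dvd_triv_right, metis dvd_triv_left)
    then have "m \<le> n" "p ^ a \<le> n" using n' by (auto intro: dvd_imp_le)
    moreover have "a < p ^ a" using p by (rule exponent_less_prime_power)
    ultimately have "a \<le> N" using n' unfolding N_def by (intro le_nat_floor) linarith
    moreover have "prime_factors m \<subseteq> P"
    proof
      fix q assume q: "q \<in> prime_factors m"
      with m have "q \<noteq> p" by (auto simp: in_prime_factors_iff)
      moreover have "q \<in> prime_factors n" using q \<open>m dvd n\<close> n' by (auto simp: in_prime_factors_iff)
      ultimately show "q \<in> P" using n by auto
    qed
    ultimately have "(a, m) \<in> {0..N} \<times> ?S P" using \<open>m \<le> n\<close> \<open>m > 0\<close> n' by auto
    then show "n \<in> (\<lambda>(a, m). p ^ a * m) ` ({0..N} \<times> ?S P)"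
      using m(1) unfolding a_def by (intro image_eqI) auto
  qed
  have "(\<Sum>n\<in>?S (insert p P). 1 / real n) \<le> (\<Sum>n\<in>(\<lambda>(a, m). p ^ a * m) ` ({0..N} \<times> ?S P). 1 / real n)"
    by (rule sum_mono2[OF _ sub]) (intro finite_imageI finite_cartesian_product finite_atLeastAtMost fin, simp)
  also have "\<dots> \<le> sum ((\<lambda>n. 1 / real n) \<circ> (\<lambda>(a, m). p ^ a * m)) ({0..N} \<times> ?S P)"
    by (rule sum_image_le) (intro finite_cartesian_product finite_atLeastAtMost fin, simp)
  also have "\<dots> = (\<Sum>(a, m)\<in>{0..N} \<times> ?S P. (1 / real p ^ a) * (1 / real m))"
    by (intro sum.cong) auto
  also have "\<dots> = (\<Sum>a\<in>{0..N}. 1 / real p ^ a) * (\<Sum>m\<in>?S P. 1 / real m)"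
    by (simp only: sum_product sum.cartesian_product)
  also have "\<dots> \<le> (1 + 1 / (real p - 1)) * (\<Prod>p\<in>P. 1 + 1 / (real p - 1))"
  proof (rule mult_mono)
    have "(\<Sum>a\<in>{0..N}. 1 / real p ^ a) = 1 + (\<Sum>a=1..N. 1 / real p ^ a)"
      by (subst sum.atLeast_Suc_atMost) auto
    also have "(\<Sum>a=1..N. 1 / real p ^ a) \<le> 1 / (real p - 1)"
      using p prime_gt_1_nat by (intro sum_inverse_power_le) auto
    finally show "(\<Sum>a\<in>{0..N}. 1 / real p ^ a) \<le> 1 + 1 / (real p - 1)" by simp
  next
    show "(\<Sum>m\<in>?S P. 1 / real m) \<le> (\<Prod>p\<in>P. 1 + 1 / (real p - 1))"
      using insert by auto
    show "0 \<le> 1 + 1 / (real p - 1)" using p prime_gt_1_nat[of p] by simp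
  qed (auto intro: sum_nonneg)
  finally show ?case using insert by simp
qed

text \<open>\<open>1 / (p - 1)\<close> exceeds \<open>1 / p\<close> by
  \<open>1 / (p * (p - 1))\<close>. Since \<open>2 * ln p \<ge> 1\<close>, these excesses sum to at
  most twice the bound 2 of \<open>sum_ln_div_mult_le\<close>, which gives the 4.\<close>

lemma prod_primes_le_exp:
  assumes "finite P" "\<forall>p\<in>P. prime p"
  shows "(\<Prod>p\<in>P. 1 + 1 / (real p - 1)) \<le> exp ((\<Sum>p\<in>P. 1 / real p) + 4)"
proof -
  have gt: "real p > 1" if "p \<in> P" for p using assms that prime_gt_1_nat by auto
  have "(\<Prod>p\<in>P. 1 + 1 / (real p - 1)) \<le> (\<Prod>p\<in>P. exp (1 / (real p - 1)))"
  proof (intro prod_mono conjI)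
    fix p assume "p \<in> P"
    then have "1 / (real p - 1) \<ge> 0" using gt[of p] by simp
    then show "0 \<le> 1 + 1 / (real p - 1)" by linarith
    show "1 + 1 / (real p - 1) \<le> exp (1 / (real p - 1))" by (rule exp_ge_add_one_self)
  qed
  also have "\<dots> = exp (\<Sum>p\<in>P. 1 / (real p - 1))" using assms by (simp add: exp_sum)
  also have "(\<Sum>p\<in>P. 1 / (real p - 1)) = (\<Sum>p\<in>P. 1 / real p) + (\<Sum>p\<in>P. 1 / (real p * (real p - 1)))"
    unfolding sum.distrib[symmetric] using gt by (intro sum.cong) (force simp: field_simps)+
  also have "(\<Sum>p\<in>P. 1 / (real p * (real p - 1))) \<le> 4"
  proof -
    have ln2: "ln (2::real) \<ge> 1 / 2" using ln_ge_half[of 2] by simp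
    have "(\<Sum>p\<in>P. 1 / (real p * (real p - 1))) \<le> (\<Sum>p\<in>P. 2 * (ln (real p) / (real p * (real p - 1))))"
    proof (intro sum_mono)
      fix p assume p: "p \<in> P"
      then have "ln (real p) \<ge> ln 2" using assms prime_ge_2_nat[of p] by simp
      then have "1 \<le> 2 * ln (real p)" using ln2 by linarith
      then show "1 / (real p * (real p - 1)) \<le> 2 * (ln (real p) / (real p * (real p - 1)))"
        using gt[OF p] by (simp add: divide_right_mono)
    qed
    also have "\<dots> = 2 * (\<Sum>p\<in>P. ln (real p) / (real p * (real p - 1)))" by (simp add: sum_distrib_left)
    also have "(\<Sum>p\<in>P. ln (real p) / (real p * (real p - 1))) \<le> (\<Sum>p=2..Max P. ln (real p) / (real p * (real p - 1)))"
      using assms by (intro sum_mono2) (auto simp: prime_ge_2_nat)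
    also have "\<dots> \<le> 2" by (rule sum_ln_div_mult_le)
    finally show ?thesis by simp
  qed
  finally show ?thesis by simp
qed

lemma sum_inverse_prime_factors_subset_le_exp:
  assumes "finite P" "\<forall>p\<in>P. prime p"
  shows "(\<Sum>n | n \<in> pos_le z \<and> prime_factors n \<subseteq> P. 1 / real n) \<le> exp ((\<Sum>p\<in>P. 1 / real p) + 4)"
  using sum_inverse_prime_factors_subset_le[OF assms, of z] prod_primes_le_exp[OF assms] by linarith

text \<open>A t-rough n <= z has all its primes in (t, z], so the Euler product over these primes
  applies; 64 is 60 from the sum of 1 / p plus 4.\<close>

lemma sum_inverse_rough_le:
  assumes "2 \<le> t" "real t \<le> z"
  shows "(\<Sum>n | n \<in> pos_le z \<and> rough t n. 1 / real n) \<le> exp 64 * ln z / ln t"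
proof -
  define N where "N = nat \<lfloor>z\<rfloor>"
  have N: "real N \<le> z" "t \<le> N" using assms unfolding N_def by (auto simp: le_nat_floor)
  have "{n. n \<in> pos_le z \<and> rough t n} \<subseteq>
      {n. n \<in> pos_le z \<and> prime_factors n \<subseteq> {p. p \<in> {t<..N} \<and> prime p}}"
  proof safe
    fix n p assume *: "n \<in> pos_le z" "rough t n" "p \<in> prime_factors n"
    then show "prime p" by (simp add: in_prime_factors_iff)
    have "p \<le> n" using * by (auto simp: in_prime_factors_iff dvd_imp_le)
    moreover have "n \<le> N" using * unfolding N_def by (auto simp: le_nat_floor)
    ultimately show "p \<in> {t<..N}" using * by (auto simp: rough_def)
  qed
  then have "(\<Sum>n | n \<in> pos_le z \<and> rough t n. 1 / real n) \<le>
      (\<Sum>n | n \<in> pos_le z \<and> prime_factors n \<subseteq> {p. p \<in> {t<..N} \<and> prime p}. 1 / real n)"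
    by (intro sum_mono2 finite_subset[OF _ finite_pos_le[of z]]) auto
  also have "\<dots> \<le> exp ((\<Sum>p | p \<in> {t<..N} \<and> prime p. 1 / real p) + 4)"
    by (rule sum_inverse_prime_factors_subset_le_exp) auto
  also have "\<dots> \<le> exp (ln (ln (real N)) - ln (ln (real t)) + 64)"
    using sum_primes_inverse_le[of t N] assms N by simp
  also have "\<dots> \<le> exp (ln (ln z) - ln (ln (real t)) + 64)"
    using assms N by simp
  also have "\<dots> = exp 64 * ln z / ln t"
    using assms by (simp add: exp_add exp_diff)
  finally show ?thesis .
qed

text \<open>The exponent 67 covers 60 from the sum of 1 / p, 4 from the Euler product, 1 / 2 for the
  prime 2 and at most 2 for \<open>- ln (ln 2)\<close>.\<close>

lemma sum_inverse_smooth_le: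
  assumes "2 \<le> t"
  shows "(\<Sum>n | n \<in> pos_le z \<and> smooth t n. 1 / real n) \<le> exp 67 * ln t"
proof -
  have ln2: "ln (2::real) \<ge> exp (- 2)"
  proof -
    have "ln (2::real) \<ge> 1 / 2" using ln_ge_half[of 2] by simp
    moreover have "exp (2::real) \<ge> 2" using exp_ge_add_one_self[of 2] by simp
    then have "exp (-2::real) \<le> 1 / 2" by (simp add: exp_minus field_simps)
    ultimately show ?thesis by linarith
  qed
  let ?P = "{p. p \<in> {..t} \<and> prime p}"
  have "{n. n \<in> pos_le z \<and> smooth t n} \<subseteq> {n. n \<in> pos_le z \<and> prime_factors n \<subseteq> ?P}"
    by (auto simp: smooth_def in_prime_factors_iff)
  then have "(\<Sum>n | n \<in> pos_le z \<and> smooth t n. 1 / real n) \<le>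
      (\<Sum>n | n \<in> pos_le z \<and> prime_factors n \<subseteq> ?P. 1 / real n)"
    by (intro sum_mono2 finite_subset[OF _ finite_pos_le[of z]]) auto
  also have "\<dots> \<le> exp ((\<Sum>p\<in>?P. 1 / real p) + 4)"
    by (rule sum_inverse_prime_factors_subset_le_exp) auto
  finally have 1: "(\<Sum>n | n \<in> pos_le z \<and> smooth t n. 1 / real n) \<le> exp ((\<Sum>p\<in>?P. 1 / real p) + 4)" .
  have "(\<Sum>p\<in>?P. 1 / real p) \<le> (\<Sum>p\<in>insert 2 {p. p \<in> {2<..t} \<and> prime p}. 1 / real p)"
    by (intro sum_mono2) (auto dest: prime_ge_2_nat)
  also have "\<dots> = 1 / 2 + (\<Sum>p | p \<in> {2<..t} \<and> prime p. 1 / real p)" by simp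
  finally have 2: "(\<Sum>p\<in>?P. 1 / real p) \<le> 1 / 2 + (ln (ln (real t)) - ln (ln 2) + 60)"
    using sum_primes_inverse_le[of 2 t] assms by simp
  have 3: "- ln (ln 2) \<le> (2::real)"
    using ln2 ln_mono[of "exp (-2)" "ln 2"] by simp
  note 1
  also have "exp ((\<Sum>p\<in>?P. 1 / real p) + 4) \<le> exp (ln (ln (real t)) + 67)"
    using 2 3 by simp
  also have "\<dots> = exp 67 * ln t" using assms by (simp add: exp_add)
  finally show ?thesis .
qed

section \<open>Counting smooth and rough numbers\<close>

definition smooth_le :: "nat \<Rightarrow> real \<Rightarrow> nat set" where
  "smooth_le t z = {n \<in> pos_le z. smooth t n}"

definition rough_le :: "nat \<Rightarrow> real \<Rightarrow> nat set" where
  "rough_le t z = {n \<in> pos_le z. rough t n}"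

lemma mem_smooth_le [simp]: "n \<in> smooth_le t z \<longleftrightarrow> real n \<le> z \<and> smooth t n"
  and mem_rough_le [simp]: "n \<in> rough_le t z \<longleftrightarrow> real n \<le> z \<and> rough t n"
  by (auto simp: smooth_le_def rough_le_def smooth_pos rough_pos)

lemma finite_smooth_le [simp, intro]: "finite (smooth_le t z)"
  and finite_rough_le [simp, intro]: "finite (rough_le t z)"
  by (simp_all add: smooth_le_def rough_le_def)

lemma smooth_le_empty [simp]: "z < 1 \<Longrightarrow> smooth_le t z = {}"
  and rough_le_empty [simp]: "z < 1 \<Longrightarrow> rough_le t z = {}"
  by (simp_all add: smooth_le_def rough_le_def)

lemma card_smooth_le_le: "z \<ge> 0 \<Longrightarrow> real (card (smooth_le t z)) \<le> z"
  and card_rough_le_le: "z \<ge> 0 \<Longrightarrow> real (card (rough_le t z)) \<le> z"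
proof -
  have "card (smooth_le t z) \<le> card (pos_le z)" "card (rough_le t z) \<le> card (pos_le z)"
    unfolding smooth_le_def rough_le_def by (intro card_mono; auto)+
  then show "z \<ge> 0 \<Longrightarrow> real (card (smooth_le t z)) \<le> z" "z \<ge> 0 \<Longrightarrow> real (card (rough_le t z)) \<le> z"
    using card_pos_le_le[of z] by linarith+
qed

lemma sum_rough_le_conv: "(\<Sum>n\<in>rough_le t z. f n) = (\<Sum>n\<in>pos_le z. if rough t n then f n else 0)"
  and sum_smooth_le_conv: "(\<Sum>n\<in>smooth_le t z. f n) = (\<Sum>n\<in>pos_le z. if smooth t n then f n else 0)"
  unfolding rough_le_def smooth_le_def by (intro sum.inter_filter; simp)+

text \<open>\<open>ln m\<close> is the sum of \<open>mangoldt d\<close> over the divisors d of m.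
  Keeping Q only for the cofactor k = m / d frees d, whose sum is \<open>psi (z / k)\<close> and
  hence O(z / k).\<close>

lemma sum_ln_divisor_closed_le:
  assumes "\<And>m n. Q (m * n) \<Longrightarrow> m > 0 \<Longrightarrow> n > 0 \<Longrightarrow> Q n"
  shows "(\<Sum>m | m \<in> pos_le z \<and> Q m. ln (real m)) \<le> (\<Sum>k | k \<in> pos_le z \<and> Q k. psi (z / real k))"
proof -
  have "(\<Sum>m | m \<in> pos_le z \<and> Q m. ln (real m)) =
      (\<Sum>n\<in>pos_le z. \<Sum>d | d dvd n. if Q (d * (n div d)) then mangoldt d else 0)"
    unfolding sum.inter_filter[OF finite_pos_le]
  proof (intro sum.cong refl)
    fix n assume "n \<in> pos_le z"
    have "(\<Sum>d | d dvd n. if Q (d * (n div d)) then mangoldt d else 0) =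
        (\<Sum>d | d dvd n. if Q n then mangoldt d else (0 :: real))"
      by (intro sum.cong) auto
    then show "(if Q n then ln (real n) else 0) = (\<Sum>d | d dvd n. if Q (d * (n div d)) then mangoldt d else 0)"
      using \<open>n \<in> pos_le z\<close> by (simp add: mangoldt_sum)
  qed
  also have "\<dots> = (\<Sum>d\<in>pos_le z. \<Sum>k\<in>pos_le (z / real d). if Q (d * k) then mangoldt d else 0)"
    by (rule sum_divisors_swap)
  also have "\<dots> \<le> (\<Sum>d\<in>pos_le z. \<Sum>k\<in>pos_le (z / real d). if Q k then mangoldt d else 0)"
  proof (intro sum_mono)
    fix d k assume "d \<in> pos_le z" "k \<in> pos_le (z / real d)"
    then show "(if Q (d * k) then mangoldt d else 0) \<le> (if Q k then mangoldt d else (0 :: real))"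
      using assms[of d k] by (auto simp: mangoldt_nonneg)
  qed
  also have "\<dots> = (\<Sum>k\<in>pos_le z. \<Sum>d\<in>pos_le (z / real k). if Q k then mangoldt d else 0)"
    by (rule sum_pos_le_swap)
  also have "\<dots> = (\<Sum>k | k \<in> pos_le z \<and> Q k. psi (z / real k))"
    unfolding sum.inter_filter[OF finite_pos_le] psi_def by (intro sum.cong) auto
  finally show ?thesis .
qed

text \<open>The factor \<open>ln z\<close> is inserted into the count as \<open>ln m + ln (z / m)\<close>; this replaces a sieve.\<close>

lemma card_rough_le_bound:
  assumes "2 \<le> t" "real t \<le> z"
  shows "real (card (rough_le t z)) \<le> (10 * exp 64 + 2) * z / ln t"
proof -
  have z: "z \<ge> 2" and pos: "ln (real t) > 0" "ln z > 0" and le: "ln (real t) \<le> ln z" using assms by auto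
  have "real (card (rough_le t z)) * ln z = (\<Sum>m\<in>rough_le t z. ln (real m) + ln (z / real m))"
    using z by (subst sum.cong[OF refl, of _ _ "\<lambda>_. ln z"]) (auto simp: ln_div rough_pos)
  also have "\<dots> = (\<Sum>m\<in>rough_le t z. ln (real m)) + (\<Sum>m\<in>rough_le t z. ln (z / real m))"
    by (rule sum.distrib)
  also have "(\<Sum>m\<in>rough_le t z. ln (z / real m)) \<le> (\<Sum>m\<in>pos_le z. ln (z / real m))"
    unfolding rough_le_def by (rule sum_mono2) (auto simp: field_simps)
  also have "\<dots> \<le> 2 * z" using z by (intro sum_ln_div_le) auto
  also have "(\<Sum>m\<in>rough_le t z. ln (real m)) \<le> (\<Sum>k\<in>rough_le t z. psi (z / real k))"
    unfolding rough_le_def by (rule sum_ln_divisor_closed_le) (simp add: rough_mult_iff)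
  also have "\<dots> \<le> (\<Sum>k\<in>rough_le t z. 10 * (z / real k))"
    using z by (intro sum_mono psi_le) auto
  also have "\<dots> = 10 * z * (\<Sum>k | k \<in> pos_le z \<and> rough t k. 1 / real k)"
    by (simp add: sum_distrib_left rough_le_def)
  also have "\<dots> \<le> 10 * z * (exp 64 * ln z / ln t)"
    using z assms by (intro mult_left_mono sum_inverse_rough_le) auto
  also have "2 * z \<le> 2 * z * (ln z / ln t)"
    using z pos le by (simp add: field_simps)
  finally have "real (card (rough_le t z)) * ln z \<le> ((10 * exp 64 + 2) * z / ln t) * ln z"
    by (simp add: algebra_simps add_divide_distrib)
  then show ?thesis by (simp only: mult_le_cancel_right_pos[OF pos(2)])
qed

text \<open>Without the integer 1 the set is empty for z < t. So the bound holds for every z, and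
  the dyadic blocks below carry no additive constant.\<close>

lemma card_rough_le_gt1_bound:
  assumes "2 \<le> t" "z \<ge> 0"
  shows "real (card (rough_le t z - {1})) \<le> (10 * exp 64 + 2) * z / ln t"
proof (cases "real t \<le> z")
  case True
  have "card (rough_le t z - {1}) \<le> card (rough_le t z)" by (intro card_mono) auto
  with card_rough_le_bound[OF assms(1) True] show ?thesis by linarith
next
  case False
  have "rough_le t z - {1} = {}"
  proof (rule ccontr)
    assume "rough_le t z - {1} \<noteq> {}"
    then obtain n where "n \<in> rough_le t z - {1}" by blast
    then have n: "rough t n" "real n \<le> z" "n \<noteq> 1" by auto
    then have "n > 1" using rough_pos[of t n] by simp
    with n rough_gt[of t n] False show False by auto
  qed
  then have "card (rough_le t z - {1}) = 0" by (simp only: card.empty)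
  with assms show ?thesis by (simp only:) simp
qed

lemma card_rough_le_bound':
  assumes "2 \<le> t" "z \<ge> 0"
  shows "real (card (rough_le t z)) \<le> (10 * exp 64 + 2) * z / ln t + 1"
proof -
  have "card (rough_le t z) \<le> card (insert 1 (rough_le t z - {1}))" by (intro card_mono) auto
  also have "\<dots> = Suc (card (rough_le t z - {1}))" by (subst card_insert_disjoint) auto
  finally show ?thesis using card_rough_le_gt1_bound[OF assms] by simp
qed

text \<open>Each dyadic block from \<open>Y * 2 ^ k\<close> to \<open>Y * 2 ^ (k + 1)\<close>
  contributes at most \<open>2 * C / ln t\<close>; the integer 1 is set aside and accounts for the
  summand 1.\<close>

lemma sum_inverse_rough_range_le:
  assumes "2 \<le> t" "Y > 0"
  shows "(\<Sum>d | d \<in> rough_le t (Y * 2 ^ K) \<and> real d > Y. 1 / real d) \<le> 1 + 2 * (10 * exp 64 + 2) * real K / ln t"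
proof -
  define C where "C = (10 * exp 64 + 2 :: real)"
  have "(\<Sum>d | d \<in> rough_le t (Y * 2 ^ K) - {1} \<and> real d > Y. 1 / real d) \<le> 2 * C * real K / ln t"
  proof (induction K)
    case 0
    then have "{d. d \<in> rough_le t (Y * 2 ^ 0) - {1} \<and> real d > Y} = {}" by auto
    then show ?case by (simp only: sum.empty)
  next
    case (Suc K)
    let ?A = "{d. d \<in> rough_le t (Y * 2 ^ K) - {1} \<and> real d > Y}"
    let ?B = "{d. d \<in> rough_le t (Y * 2 ^ Suc K) - {1} \<and> real d > Y * 2 ^ K}"
    have pos: "Y * 2 ^ K > 0" "Y \<le> Y * 2 ^ K" using assms by auto
    have fin: "finite ?A" "finite ?B"
      by (rule finite_subset[OF _ finite_rough_le[of t "Y * 2 ^ Suc K"]], use pos in auto)+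
    have "{d. d \<in> rough_le t (Y * 2 ^ Suc K) - {1} \<and> real d > Y} = ?A \<union> ?B" using pos by auto
    then have "(\<Sum>d | d \<in> rough_le t (Y * 2 ^ Suc K) - {1} \<and> real d > Y. 1 / real d) \<le>
        (\<Sum>d\<in>?A. 1 / real d) + (\<Sum>d\<in>?B. 1 / real d)"
      using fin by (simp only:) (intro sum.union_inter_neutral[THEN eq_refl] ; auto)
    also have "(\<Sum>d\<in>?B. 1 / real d) \<le> (\<Sum>d\<in>?B. 1 / (Y * 2 ^ K))"
      using pos by (intro sum_mono divide_left_mono) (auto intro!: mult_pos_pos)
    also have "\<dots> = real (card ?B) / (Y * 2 ^ K)" by simp
    also have "\<dots> \<le> real (card (rough_le t (Y * 2 ^ Suc K) - {1})) / (Y * 2 ^ K)"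
      using pos by (intro divide_right_mono of_nat_mono card_mono) auto
    also have "\<dots> \<le> (C * (Y * 2 ^ Suc K) / ln t) / (Y * 2 ^ K)"
      unfolding C_def using pos assms by (intro divide_right_mono card_rough_le_gt1_bound) auto
    also have "\<dots> = 2 * C / ln t" using assms by simp
    finally show ?case using Suc.IH by (simp add: algebra_simps add_divide_distrib)
  qed
  moreover have "(\<Sum>d | d \<in> rough_le t (Y * 2 ^ K) \<and> real d > Y. 1 / real d) \<le>
      (\<Sum>d\<in>insert 1 {d. d \<in> rough_le t (Y * 2 ^ K) - {1} \<and> real d > Y}. 1 / real d)"
    by (intro sum_mono2 finite.insertI finite_subset[OF _ finite_rough_le[of t "Y * 2 ^ K"]]) auto
  moreover have "\<dots> = 1 + (\<Sum>d | d \<in> rough_le t (Y * 2 ^ K) - {1} \<and> real d > Y. 1 / real d)"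
    by (subst sum.insert) (auto intro: finite_subset[OF _ finite_rough_le[of t "Y * 2 ^ K"]])
  ultimately show ?thesis unfolding C_def by linarith
qed

lemma ex_power_two_ge:
  assumes "T \<ge> (2::nat)"
  shows "\<exists>K. real T \<le> 2 ^ K \<and> real K \<le> 4 * ln (real T)"
proof -
  define K where "K = nat \<lceil>log 2 (real T)\<rceil>"
  have ln2: "ln (2::real) \<ge> 1 / 2" using ln_ge_half[of 2] by simp
  have l: "log 2 (real T) \<ge> 1" using assms by (simp add: le_log_iff)
  have K: "log 2 (real T) \<le> real K" "real K \<le> log 2 (real T) + 1" unfolding K_def using l by linarith+
  have "real T = 2 powr log 2 (real T)" using assms by simp
  also have "\<dots> \<le> 2 powr real K" using K by (intro powr_mono) auto
  finally have "real T \<le> 2 ^ K" by (simp add: powr_realpow)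
  moreover have "real K \<le> 2 * log 2 (real T)" using K l by linarith
  moreover have "log 2 (real T) \<le> 2 * ln (real T)"
  proof -
    have "ln (real T) * 1 \<le> ln (real T) * (2 * ln 2)" using ln2 by (intro mult_left_mono) auto
    then show ?thesis unfolding log_def using ln2 by (simp add: field_simps)
  qed
  ultimately show ?thesis by (intro exI[of _ K]) linarith
qed

lemma two_le_square: "2 \<le> T \<Longrightarrow> 2 \<le> (T::nat)\<^sup>2"
  using mult_le_mono[of 2 T 1 T] by (simp add: power2_eq_square)

text \<open>The range from Y to Y T is covered by O(ln T) dyadic blocks, and roughness saves a
  factor ln (T^2) in each, so the bound depends neither on T nor on Y.\<close>

lemma sum_inverse_rough_square_range_le:
  assumes "2 \<le> T" "Y > 0"
  shows "(\<Sum>d | d \<in> rough_le (T\<^sup>2) (Y * real T) \<and> real d > Y. 1 / real d) \<le> 1 + 4 * (10 * exp 64 + 2)"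
proof -
  obtain K where K: "real T \<le> 2 ^ K" "real K \<le> 4 * ln (real T)" using ex_power_two_ge[OF assms(1)] by blast
  have "T\<^sup>2 \<ge> 2" using assms(1) by (rule two_le_square)
  have "Y * real T \<le> Y * 2 ^ K" using K assms by simp
  then have "(\<Sum>d | d \<in> rough_le (T\<^sup>2) (Y * real T) \<and> real d > Y. 1 / real d) \<le>
      (\<Sum>d | d \<in> rough_le (T\<^sup>2) (Y * 2 ^ K) \<and> real d > Y. 1 / real d)"
    by (intro sum_mono2 finite_subset[OF _ finite_rough_le[of "T\<^sup>2" "Y * 2 ^ K"]]) auto
  also have "\<dots> \<le> 1 + 2 * (10 * exp 64 + 2) * real K / ln (real (T\<^sup>2))"
    by (intro sum_inverse_rough_range_le assms \<open>T\<^sup>2 \<ge> 2\<close>)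
  also have "\<dots> \<le> 1 + 2 * (10 * exp 64 + 2) * (4 * ln (real T)) / ln (real (T\<^sup>2))"
    using K assms \<open>T\<^sup>2 \<ge> 2\<close> by (intro add_left_mono divide_right_mono mult_left_mono) auto
  also have "\<dots> = 1 + 4 * (10 * exp 64 + 2)" using assms by (simp add: ln_realpow)
  finally show ?thesis .
qed

section \<open>Moebius sums over rough numbers\<close>

definition moebius :: "nat \<Rightarrow> real" where
  "moebius n = (if squarefree n then (- 1) ^ card (prime_factors n) else 0)"

lemma abs_moebius_le: "\<bar>moebius n\<bar> \<le> 1"
  by (simp add: moebius_def)

lemma moebius_mult_coprime:
  assumes "coprime m n"
  shows "moebius (m * n) = moebius m * moebius n"
proof (cases "squarefree m \<and> squarefree n")
  case True
  then have nz: "m \<noteq> 0" "n \<noteq> 0" by (auto intro!: Nat.gr0I)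
  have "prime_factors m \<inter> prime_factors n = {}"
  proof (rule ccontr)
    assume "prime_factors m \<inter> prime_factors n \<noteq> {}"
    then obtain p where "prime p" "p dvd m" "p dvd n" by (auto simp: in_prime_factors_iff)
    with assms show False using coprime_common_divisor_nat not_prime_1 by blast
  qed
  then have "card (prime_factors (m * n)) = card (prime_factors m) + card (prime_factors n)"
    using nz by (simp add: prime_factors_product card_Un_disjoint)
  moreover have "squarefree (m * n)" using True assms squarefree_mult_coprime by blast
  ultimately show ?thesis using True by (simp add: moebius_def power_add)
next
  case False
  then have "\<not> squarefree (m * n)" using squarefree_multD by blast
  with False show ?thesis by (auto simp: moebius_def)
qed

text \<open>For a fixed x in A, pairing B with \<open>insert x B\<close> cancels everything.\<close>

lemma sum_Pow_minus_one:
  assumes "finite A"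
  shows "(\<Sum>B\<in>Pow A. (- 1) ^ card B) = (if A = {} then 1 else 0 :: real)"
proof (cases "A = {}")
  case False
  then obtain x where x: "x \<in> A" by blast
  define A' where "A' = A - {x}"
  have A': "A = insert x A'" "x \<notin> A'" "finite A'" using x assms by (auto simp: A'_def)
  have inj: "inj_on (insert x) (Pow A')" using A' by (auto simp: inj_on_def)
  have "(\<Sum>B\<in>Pow A. (- 1) ^ card B) = (\<Sum>B\<in>Pow A'. (- 1) ^ card B) + (\<Sum>B\<in>insert x ` Pow A'. (- 1) ^ card B :: real)"
    unfolding A'(1) Pow_insert using A' by (intro sum.union_disjoint) auto
  also have "(\<Sum>B\<in>insert x ` Pow A'. (- 1) ^ card B :: real) = (\<Sum>B\<in>Pow A'. (- 1) ^ card (insert x B))"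
    using inj by (simp add: sum.reindex)
  also have "\<dots> = (\<Sum>B\<in>Pow A'. - ((- 1) ^ card B))"
  proof (intro sum.cong refl)
    fix B assume "B \<in> Pow A'"
    then have "finite B" "x \<notin> B" using A' finite_subset by auto
    then show "(- 1) ^ card (insert x B) = - ((- 1) ^ card B :: real)" by simp
  qed
  finally show ?thesis using False by (simp add: sum_negf)
qed simp

lemma prime_factors_prod_primes:
  assumes "finite A" "\<forall>p\<in>A. prime (p::nat)"
  shows "prime_factors (\<Prod>A) = A"
proof -
  have "\<Prod>A \<noteq> 0" using assms by (auto dest: prime_gt_0_nat)
  moreover have "prime p \<Longrightarrow> p dvd \<Prod>A \<longleftrightarrow> p \<in> A" for p
    using assms by (auto simp: prime_dvd_prod_iff dest: primes_dvd_imp_eq intro!: bexI[of _ p])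
  ultimately show ?thesis using assms by (auto simp: in_prime_factors_iff)
qed

lemma squarefree_prod_primes:
  assumes "finite A" "\<forall>p\<in>A. prime (p::nat)"
  shows "squarefree (\<Prod>A)"
  using assms by (intro squarefree_prod_coprime) (auto simp: primes_coprime squarefree_prime)

lemma prod_prime_factors_squarefree:
  assumes "squarefree (n::nat)"
  shows "\<Prod>(prime_factors n) = n"
proof -
  have "n \<noteq> 0" using assms by (auto intro!: Nat.gr0I)
  then have "n = (\<Prod>p\<in>prime_factors n. p ^ multiplicity p n)"
    using prime_factorization_nat by blast
  also have "\<dots> = \<Prod>(prime_factors n)"
    using assms \<open>n \<noteq> 0\<close> by (intro prod.cong) (auto simp: squarefree_factorial_semiring')
  finally show ?thesis by simp
qed

lemma prod_primes_dvd:
  assumes "A \<subseteq> prime_factors (n::nat)" "n > 0"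
  shows "\<Prod>A dvd n"
proof -
  have "\<Prod>A dvd \<Prod>(prime_factors n)" using assms by (intro prod_dvd_prod_subset) auto
  also have "\<dots> dvd (\<Prod>p\<in>prime_factors n. p ^ multiplicity p n)"
    by (intro prod_dvd_prod dvd_power) (auto simp: prime_factors_multiplicity)
  also have "\<dots> = n" using assms prime_factorization_nat by simp
  finally show ?thesis .
qed

text \<open>The squarefree rough divisors of n are the products of sets of prime factors above t, so
  the alternating sum over subsets vanishes unless n has no such prime.\<close>

lemma sum_moebius_rough_divisors:
  assumes "n > 0"
  shows "(\<Sum>d | d dvd n. if rough t d then moebius d else 0) = (if smooth t n then 1 else 0)"
proof -
  define Q where "Q = {p \<in> prime_factors n. t < p}"
  have Q: "finite Q" "\<forall>p\<in>Q. prime p" by (auto simp: Q_def)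
  have fin: "finite {d. d dvd n}" using assms by (simp add: finite_divisors_nat)
  let ?D = "{d. d dvd n \<and> rough t d \<and> squarefree d}"
  have "(\<Sum>B\<in>Pow Q. (- 1) ^ card B) = (\<Sum>d\<in>?D. moebius d)"
  proof (rule sum.reindex_bij_witness[where i = "\<lambda>d. prime_factors d" and j = "\<lambda>B. \<Prod>B"])
    fix B assume "B \<in> Pow Q"
    then have B: "B \<subseteq> Q" "finite B" "\<forall>p\<in>B. prime p" using Q by (auto intro: finite_subset)
    show "prime_factors (\<Prod>B) = B" using B by (intro prime_factors_prod_primes)
    have sf: "squarefree (\<Prod>B)" using B by (intro squarefree_prod_primes)
    have "\<Prod>B dvd n" using B assms by (intro prod_primes_dvd) (auto simp: Q_def)
    moreover have r: "rough t (\<Prod>B)"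
      using B prime_factors_prod_primes[of B] by (auto simp: rough_def Q_def dest: prime_gt_0_nat intro: prod_pos)
    ultimately show "\<Prod>B \<in> ?D" using sf by auto
    show "moebius (\<Prod>B) = (- 1) ^ card B"
      using sf B by (simp add: moebius_def prime_factors_prod_primes)
  next
    fix d assume d: "d \<in> ?D"
    then show "\<Prod>(prime_factors d) = d" by (intro prod_prime_factors_squarefree) auto
    have "prime_factors d \<subseteq> prime_factors n" using d assms by (intro dvd_prime_factors) auto
    then show "prime_factors d \<in> Pow Q" using d by (auto simp: Q_def rough_def)
  qed
  also have "\<dots> = (\<Sum>d | d dvd n. if rough t d then moebius d else 0)"
    using fin by (intro sum.mono_neutral_cong_left) (auto simp: moebius_def)
  finally have "(\<Sum>d | d dvd n. if rough t d then moebius d else 0) = (\<Sum>B\<in>Pow Q. (- 1) ^ card B)" ..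
  moreover have "Q = {} \<longleftrightarrow> smooth t n" using assms by (auto simp: Q_def smooth_def)
  ultimately show ?thesis using sum_Pow_minus_one[OF Q(1)] by simp
qed

text \<open>Inclusion-exclusion over the primes above t: smoothness of b is traded for a rough
  divisor d of an unrestricted integer d k.\<close>

lemma sum_smooth_le_eq:
  "(\<Sum>b\<in>smooth_le t z. g b) =
     (\<Sum>d\<in>rough_le t z. moebius d * (\<Sum>k\<in>pos_le (z / real d). g (d * k) :: real))"
proof -
  have "(\<Sum>b\<in>smooth_le t z. g b) =
      (\<Sum>n\<in>pos_le z. (\<Sum>d | d dvd n. if rough t d then moebius d else 0) * g n)"
    unfolding sum_smooth_le_conv by (intro sum.cong) (auto simp: sum_moebius_rough_divisors)
  also have "\<dots> = (\<Sum>n\<in>pos_le z. \<Sum>d | d dvd n. if rough t d then moebius d * g (d * (n div d)) else 0)"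
    by (intro sum.cong refl) (auto simp: sum_distrib_right intro!: sum.cong)
  also have "\<dots> = (\<Sum>d\<in>pos_le z. \<Sum>k\<in>pos_le (z / real d). if rough t d then moebius d * g (d * k) else 0)"
    by (rule sum_divisors_swap)
  also have "\<dots> = (\<Sum>d\<in>rough_le t z. moebius d * (\<Sum>k\<in>pos_le (z / real d). g (d * k)))"
    unfolding sum_rough_le_conv by (intro sum.cong refl) (auto simp: sum_distrib_left)
  finally show ?thesis .
qed

section \<open>Truncated Moebius sums and their relation to smooth numbers\<close>

definition R0 :: "nat \<Rightarrow> real \<Rightarrow> real" where
  "R0 t z = (\<Sum>d\<in>rough_le t z. moebius d / real d)"

text \<open>\<open>z * R0 t z\<close> approximates the number of t-smooth integers up to z, and
  \<open>z * (R1 t z - R0 t z)\<close> approximates \<open>U t z\<close>.\<close>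

definition R1 :: "nat \<Rightarrow> real \<Rightarrow> real" where
  "R1 t z = (\<Sum>d\<in>rough_le t z. moebius d / real d * ln (z / real d))"

text \<open>This counts the pairs b s <= z with b smooth and s unrestricted, weighted by
  \<open>mangoldt s\<close>.\<close>

definition U :: "nat \<Rightarrow> real \<Rightarrow> real" where
  "U t z = (\<Sum>b\<in>smooth_le t z. psi (z / real b))"

lemma card_smooth_le_eq: "real (card (smooth_le t z)) = (\<Sum>d\<in>rough_le t z. moebius d * real (card (pos_le (z / real d))))"
  using sum_smooth_le_eq[of "\<lambda>_. 1" t z] by simp

lemma U_eq: "U t z = (\<Sum>d\<in>rough_le t z. moebius d * sum_ln (z / real d))"
  unfolding U_def by (subst sum_smooth_le_eq) (simp add: sum_ln_eq_psi)

lemma card_smooth_le_approx: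
  assumes "z \<ge> 0"
  shows "\<bar>real (card (smooth_le t z)) - z * R0 t z\<bar> \<le> real (card (rough_le t z))"
proof -
  have "real (card (smooth_le t z)) - z * R0 t z =
      (\<Sum>d\<in>rough_le t z. moebius d * (real (card (pos_le (z / real d))) - z / real d))"
    unfolding card_smooth_le_eq R0_def by (simp add: sum_distrib_left sum_subtractf right_diff_distrib mult_ac)
  also have "\<bar>\<dots>\<bar> \<le> (\<Sum>d\<in>rough_le t z. 1)"
  proof (rule order_trans[OF sum_abs sum_mono])
    fix d assume "d \<in> rough_le t z"
    have "0 \<le> z / real d" using assms by simp
    then have "\<bar>real (card (pos_le (z / real d))) - z / real d\<bar> \<le> 1"
      using card_pos_le_le[of "z / real d"] card_pos_le_ge[of "z / real d"] by linarith
    then show "\<bar>moebius d * (real (card (pos_le (z / real d))) - z / real d)\<bar> \<le> 1"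
      using abs_moebius_le[of d] by (simp add: abs_mult mult_le_one)
  qed
  finally show ?thesis by simp
qed

lemma R0_eq_0 [simp]: "z < 1 \<Longrightarrow> R0 t z = 0"
  and R1_eq_0 [simp]: "z < 1 \<Longrightarrow> R1 t z = 0"
  by (simp_all add: R0_def R1_def)

text \<open>Both counts in \<open>card_smooth_le_approx\<close> are at most z, so
  \<open>z * R0 t z\<close> is at most \<open>2 * z\<close> in absolute value.\<close>

lemma abs_R0_le: "\<bar>R0 t z\<bar> \<le> 2"
proof (cases "z < 1")
  case False
  have "z * \<bar>R0 t z\<bar> = \<bar>z * R0 t z\<bar>" using False by (simp add: abs_mult)
  also have "\<dots> \<le> real (card (smooth_le t z)) + real (card (rough_le t z))"
    using card_smooth_le_approx[of z t] False by linarith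
  also have "\<dots> \<le> z * 2"
    using card_smooth_le_le[of z t] card_rough_le_le[of z t] False by linarith
  finally show ?thesis using False by simp
qed simp

lemma sum_one_plus_ln_le:
  assumes "z \<ge> 0" "A \<subseteq> pos_le z"
  shows "(\<Sum>d\<in>A. 1 + ln (z / real d)) \<le> 3 * z"
proof -
  have "(\<Sum>d\<in>A. 1 + ln (z / real d)) \<le> (\<Sum>d\<in>pos_le z. 1 + ln (z / real d))"
    using assms by (intro sum_mono2) (auto simp: field_simps intro!: add_nonneg_nonneg)
  also have "\<dots> = real (card (pos_le z)) + (\<Sum>d\<in>pos_le z. ln (z / real d))"
    by (simp add: sum.distrib)
  also have "\<dots> \<le> 3 * z"
    using card_pos_le_le[of z] sum_ln_div_le[of z] assms by (cases "z = 0") auto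
  finally show ?thesis .
qed

text \<open>Stirling's formula applied to each \<open>sum_ln (z / d)\<close>. The error is kept as a
  sum over d because later it is added up over many p at once.\<close>

lemma U_approx:
  assumes "z \<ge> 0"
  shows "\<bar>U t z - z * (R1 t z - R0 t z)\<bar> \<le> (\<Sum>d\<in>rough_le t z. 1 + ln (z / real d))"
proof -
  have "U t z - z * (R1 t z - R0 t z) =
      (\<Sum>d\<in>rough_le t z. moebius d * (sum_ln (z / real d) - (z / real d * ln (z / real d) - z / real d)))"
    unfolding U_eq R0_def R1_def
    by (simp add: sum_distrib_left sum_subtractf sum.distrib[symmetric] algebra_simps)
  also have "\<bar>\<dots>\<bar> \<le> (\<Sum>d\<in>rough_le t z. 1 + ln (z / real d))"
  proof (rule order_trans[OF sum_abs sum_mono])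
    fix d assume d: "d \<in> rough_le t z"
    then have "1 \<le> z / real d" using rough_pos[of t d] by (simp add: field_simps)
    from sum_ln_bound[OF this]
    have "1 * \<bar>sum_ln (z / real d) - (z / real d * ln (z / real d) - z / real d)\<bar> \<le> 1 + ln (z / real d)" by simp
    then show "\<bar>moebius d * (sum_ln (z / real d) - (z / real d * ln (z / real d) - z / real d))\<bar> \<le> 1 + ln (z / real d)"
      unfolding abs_mult using abs_moebius_le[of d] by (meson abs_ge_zero mult_right_mono order_trans)
  qed
  finally show ?thesis .
qed

lemma U_nonneg: "U t z \<ge> 0"
  unfolding U_def by (intro sum_nonneg psi_nonneg)

lemma U_le:
  assumes "2 \<le> t" "z \<ge> 0"
  shows "U t z \<le> 10 * exp 67 * ln t * z"
proof -
  have "U t z \<le> (\<Sum>b\<in>smooth_le t z. 10 * (z / real b))"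
    unfolding U_def using assms by (intro sum_mono psi_le) auto
  also have "\<dots> = 10 * z * (\<Sum>b | b \<in> pos_le z \<and> smooth t b. 1 / real b)"
    by (simp add: sum_distrib_left smooth_le_def)
  also have "\<dots> \<le> 10 * z * (exp 67 * ln t)"
    using assms by (intro mult_left_mono sum_inverse_smooth_le) auto
  finally show ?thesis by (simp add: mult_ac)
qed

text \<open>\<open>z * R1 t z\<close> is recovered from \<open>U t z\<close>, which is nonnegative
  and O(z ln t); the remaining 5 is absorbed through \<open>ln t \<ge> 1 / 2\<close>.\<close>

lemma abs_R1_le:
  assumes "2 \<le> t"
  shows "\<bar>R1 t z\<bar> \<le> (10 + 10 * exp 67) * ln t"
proof (cases "z < 1")
  case False
  have "z * \<bar>R1 t z\<bar> = \<bar>z * R1 t z\<bar>" using False by (simp add: abs_mult)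
  also have "z * R1 t z = z * (R1 t z - R0 t z) - U t z + U t z + z * R0 t z" by (simp add: algebra_simps)
  also have "\<bar>\<dots>\<bar> \<le> 3 * z + U t z + z * 2"
  proof -
    have "\<bar>z * R0 t z\<bar> \<le> z * 2" using abs_R0_le[of t z] False by (simp add: abs_mult)
    moreover have "(\<Sum>d\<in>rough_le t z. 1 + ln (z / real d)) \<le> 3 * z"
      using False by (intro sum_one_plus_ln_le) (auto simp: rough_pos)
    ultimately show ?thesis using U_approx[of z t] U_nonneg[of t z] False by linarith
  qed
  also have "\<dots> \<le> z * (5 + 10 * exp 67 * ln t)"
    using U_le[OF assms, of z] False by (simp add: algebra_simps)
  finally have "\<bar>R1 t z\<bar> \<le> 5 + 10 * exp 67 * ln t" using False by simp
  moreover have "ln t \<ge> 1 / 2"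
  proof -
    have "ln (2::real) \<ge> 1 / 2" using ln_ge_half[of 2] by simp
    moreover have "ln t \<ge> ln 2" using assms by simp
    ultimately show ?thesis by linarith
  qed
  ultimately show ?thesis by (simp add: algebra_simps)
qed (use assms in simp)

section \<open>Cancellation on an interval of primes\<close>

lemma ex_smooth_rough_decomp: "n > 0 \<Longrightarrow> \<exists>a b. smooth \<tau> a \<and> rough \<tau> b \<and> n = a * b"
proof (induction n rule: less_induct)
  case (less n)
  show ?case
  proof (cases "n = 1")
    case True
    then show ?thesis by (intro exI[of _ 1]) simp
  next
    case False
    then obtain p m where p: "prime p" and n: "n = p * m" using prime_factor_nat[of n] by auto
    then have m: "m > 0" "m < n" using less.prems prime_gt_1_nat[of p] by (auto intro: Nat.gr0I)
    then obtain a b where ab: "smooth \<tau> a" "rough \<tau> b" "m = a * b" using less.IH by blast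
    show ?thesis
    proof (cases "p \<le> \<tau>")
      case True
      then have "smooth \<tau> (p * a)" using ab p smooth_prime_power[of p 1 \<tau>] by (simp add: smooth_mult_iff)
      with ab n show ?thesis by (intro exI[of _ "p * a"] exI[of _ b]) simp
    next
      case False
      then have "rough \<tau> (p * b)" using ab p rough_prime_power[of p 1 \<tau>] by (simp add: rough_mult_iff)
      with ab n show ?thesis by (intro exI[of _ a] exI[of _ "p * b"]) simp
    qed
  qed
qed

lemma smooth_rough_decomp_unique:
  assumes "smooth \<tau> a" "rough \<tau> b" "smooth \<tau> a'" "rough \<tau> b'" "a * b = a' * b'"
  shows "a = a'" "b = b'"
proof -
  have "a dvd a' * b'" "a' dvd a * b" using assms(5) by (metis dvd_triv_left)+
  moreover have "coprime a b'" "coprime a' b" using assms by (auto intro: coprime_smooth_rough)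
  ultimately have "a dvd a'" "a' dvd a" by (simp_all add: coprime_dvd_mult_left_iff)
  then show "a = a'" by (rule dvd_antisym)
  with assms show "b = b'" using smooth_pos[of \<tau> a] by simp
qed

text \<open>A t-rough d factors uniquely as a b, where the primes of a lie between t and \<tau> and
  those of b exceed \<tau>. The aim is to replace a threshold t = p that varies by a fixed
  \<tau>.\<close>

lemma sum_rough_le_split:
  assumes "t \<le> \<tau>"
  shows "(\<Sum>d\<in>rough_le t z. g d) =
    (\<Sum>a | a \<in> rough_le t z \<and> smooth \<tau> a. \<Sum>b\<in>rough_le \<tau> (z / real a). g (a * b))"
proof -
  let ?A = "{a. a \<in> rough_le t z \<and> smooth \<tau> a}"
  have "bij_betw (\<lambda>(a, b). a * b) (Sigma ?A (\<lambda>a. rough_le \<tau> (z / real a))) (rough_le t z)"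
    unfolding bij_betw_def
  proof (intro conjI subset_antisym subsetI)
    show "inj_on (\<lambda>(a, b). a * b) (Sigma ?A (\<lambda>a. rough_le \<tau> (z / real a)))"
      by (rule inj_onI) (auto dest: smooth_rough_decomp_unique)
  next
    fix d assume "d \<in> (\<lambda>(a, b). a * b) ` Sigma ?A (\<lambda>a. rough_le \<tau> (z / real a))"
    then obtain a b where ab: "d = a * b" "rough t a" "rough \<tau> b" "real b \<le> z / real a" by auto
    then have "real d \<le> z" using rough_pos[of t a] by (simp add: field_simps)
    with ab show "d \<in> rough_le t z" using rough_mono[of \<tau> b t] assms by (simp add: rough_mult_iff)
  next
    fix d assume d: "d \<in> rough_le t z"
    then obtain a b where ab: "smooth \<tau> a" "rough \<tau> b" "d = a * b"
      using ex_smooth_rough_decomp[of d \<tau>] rough_pos by auto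
    have "a > 0" "b > 0" using ab smooth_pos rough_pos by auto
    then have "real a \<le> z" "real b \<le> z / real a"
      using d ab le_of_mult_le[of b a z] by (auto simp: field_simps)
    moreover have "rough t a" using d ab by (simp add: rough_mult_iff)
    ultimately have "(a, b) \<in> Sigma ?A (\<lambda>a. rough_le \<tau> (z / real a))" using ab by simp
    then show "d \<in> (\<lambda>(a, b). a * b) ` Sigma ?A (\<lambda>a. rough_le \<tau> (z / real a))"
      using ab by (intro image_eqI) auto
  qed
  then have "(\<Sum>d\<in>rough_le t z. g d) = (\<Sum>x\<in>Sigma ?A (\<lambda>a. rough_le \<tau> (z / real a)). g (case x of (a, b) \<Rightarrow> a * b))"
    by (rule sum.reindex_bij_betw[symmetric])
  also have "\<dots> = (\<Sum>(a, b)\<in>Sigma ?A (\<lambda>a. rough_le \<tau> (z / real a)). g (a * b))"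
    by (intro sum.cong) auto
  also have "\<dots> = (\<Sum>a\<in>?A. \<Sum>b\<in>rough_le \<tau> (z / real a). g (a * b))"
    by (subst sum.Sigma) (auto intro: finite_subset[OF _ finite_rough_le[of t z]])
  finally show ?thesis .
qed

lemma R0_split:
  assumes "t \<le> \<tau>"
  shows "R0 t z = (\<Sum>a | a \<in> rough_le t z \<and> smooth \<tau> a. moebius a / real a * R0 \<tau> (z / real a))"
  unfolding R0_def sum_rough_le_split[OF assms]
  by (intro sum.cong refl)
     (auto simp: sum_distrib_left moebius_mult_coprime[OF coprime_smooth_rough] intro!: sum.cong)

lemma R1_split:
  assumes "t \<le> \<tau>"
  shows "R1 t z = (\<Sum>a | a \<in> rough_le t z \<and> smooth \<tau> a. moebius a / real a * R1 \<tau> (z / real a))"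
  unfolding R1_def sum_rough_le_split[OF assms]
  by (intro sum.cong refl)
     (auto simp: sum_distrib_left moebius_mult_coprime[OF coprime_smooth_rough] mult_ac intro!: sum.cong)

text \<open>For \<open>d \<le> Y\<close> the weights are essentially constant, so the cancellation in \<open>R0\<close> and
  \<open>R1\<close> applies; on the short range \<open>Y < d \<le> Y T\<close> the rough numbers are so sparse that
  absolute values suffice.\<close>

lemma sum_moebius_rough_weight_bound:
  assumes T: "2 \<le> T" and Y: "Y > 0"
    and small: "\<And>d. rough (T\<^sup>2) d \<Longrightarrow> real d \<le> Y \<Longrightarrow> E d = \<alpha> + \<beta> * ln (Y / real d)"
    and large: "\<And>d. rough (T\<^sup>2) d \<Longrightarrow> real d > Y \<Longrightarrow> real d \<le> Y * real T \<Longrightarrow> \<bar>E d\<bar> \<le> B"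
  shows "\<bar>\<Sum>d\<in>rough_le (T\<^sup>2) (Y * real T). moebius d / real d * E d\<bar> \<le>
    2 * \<bar>\<alpha>\<bar> + (20 + 20 * exp 67) * ln T * \<bar>\<beta>\<bar> + (41 + 40 * exp 64) * \<bar>B\<bar>"
proof -
  let ?\<tau> = "T\<^sup>2"
  let ?L = "{d. d \<in> rough_le ?\<tau> (Y * real T) \<and> real d > Y}"
  have "Y * 1 \<le> Y * real T" using T Y by (intro mult_left_mono) auto
  then have un: "rough_le ?\<tau> (Y * real T) = rough_le ?\<tau> Y \<union> ?L" by auto
  have fin: "finite ?L" by (rule finite_subset[OF _ finite_rough_le[of "?\<tau>" "Y * real T"]]) auto
  have "(\<Sum>d\<in>rough_le ?\<tau> (Y * real T). moebius d / real d * E d) =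
      (\<Sum>d\<in>rough_le ?\<tau> Y. moebius d / real d * E d) + (\<Sum>d\<in>?L. moebius d / real d * E d)"
  proof -
    have "(\<Sum>d\<in>rough_le ?\<tau> Y \<union> ?L. moebius d / real d * E d) =
        (\<Sum>d\<in>rough_le ?\<tau> Y. moebius d / real d * E d) + (\<Sum>d\<in>?L. moebius d / real d * E d)"
      using fin by (intro sum.union_disjoint) auto
    then show ?thesis by (simp only: un[symmetric])
  qed
  also have "(\<Sum>d\<in>rough_le ?\<tau> Y. moebius d / real d * E d) =
      (\<Sum>d\<in>rough_le ?\<tau> Y. moebius d / real d * (\<alpha> + \<beta> * ln (Y / real d)))"
    by (intro sum.cong refl) (simp add: small)
  also have "\<dots> = \<alpha> * R0 ?\<tau> Y + \<beta> * R1 ?\<tau> Y"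
    unfolding R0_def R1_def by (simp add: sum_distrib_left sum.distrib algebra_simps)
  finally have eq: "(\<Sum>d\<in>rough_le ?\<tau> (Y * real T). moebius d / real d * E d) =
      \<alpha> * R0 ?\<tau> Y + \<beta> * R1 ?\<tau> Y + (\<Sum>d\<in>?L. moebius d / real d * E d)" .
  have "\<bar>\<Sum>d\<in>?L. moebius d / real d * E d\<bar> \<le> (\<Sum>d\<in>?L. \<bar>B\<bar> * (1 / real d))"
  proof (rule order_trans[OF sum_abs sum_mono])
    fix d assume d: "d \<in> ?L"
    have "\<bar>moebius d / real d * E d\<bar> = \<bar>moebius d\<bar> * \<bar>E d\<bar> / real d" by (simp add: abs_mult)
    also have "\<dots> \<le> 1 * \<bar>B\<bar> / real d"
      using d abs_moebius_le[of d] large[of d] by (intro divide_right_mono mult_mono) auto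
    finally show "\<bar>moebius d / real d * E d\<bar> \<le> \<bar>B\<bar> * (1 / real d)" by simp
  qed
  also have "\<dots> = \<bar>B\<bar> * (\<Sum>d\<in>?L. 1 / real d)" by (simp add: sum_distrib_left)
  also have "\<dots> \<le> \<bar>B\<bar> * (1 + 4 * (10 * exp 64 + 2))"
    using Y by (intro mult_left_mono sum_inverse_rough_square_range_le[OF T]) auto
  also have "\<dots> \<le> (41 + 40 * exp 64) * \<bar>B\<bar>" by (simp add: algebra_simps)
  finally have 1: "\<bar>\<Sum>d\<in>?L. moebius d / real d * E d\<bar> \<le> (41 + 40 * exp 64) * \<bar>B\<bar>" .
  have 2: "\<bar>\<alpha> * R0 ?\<tau> Y\<bar> \<le> \<bar>\<alpha>\<bar> * 2" unfolding abs_mult by (intro mult_left_mono abs_R0_le) auto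
  have "\<bar>\<beta> * R1 ?\<tau> Y\<bar> \<le> \<bar>\<beta>\<bar> * ((10 + 10 * exp 67) * ln ?\<tau>)"
    unfolding abs_mult using two_le_square[OF T] by (intro mult_left_mono abs_R1_le) auto
  also have "ln (real ?\<tau>) = 2 * ln T" using T by (simp add: ln_realpow)
  finally have 3: "\<bar>\<beta> * R1 ?\<tau> Y\<bar> \<le> (20 + 20 * exp 67) * ln T * \<bar>\<beta>\<bar>" by (simp add: algebra_simps)
  show ?thesis unfolding eq using 1 2 3 by linarith
qed

section \<open>From roughness p to a fixed roughness\<close>

definition primes_in :: "nat \<Rightarrow> nat \<Rightarrow> nat set" where
  "primes_in u v = {p \<in> {u..v}. prime p}"

lemma mem_primes_in [simp]: "p \<in> primes_in u v \<longleftrightarrow> u \<le> p \<and> p \<le> v \<and> prime p"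
  by (auto simp: primes_in_def)

lemma finite_primes_in [simp, intro]: "finite (primes_in u v)"
  by (simp add: primes_in_def)

lemma primes_in_le_real: "{p \<in> primes_in u v. real p \<le> x} = primes_in u (min v (nat \<lfloor>x\<rfloor>))"
proof -
  have "p \<le> nat \<lfloor>x\<rfloor> \<longleftrightarrow> real p \<le> x" if "prime p" for p
    using prime_gt_0_nat[OF that] by linarith
  then show ?thesis by auto
qed

text \<open>For a > 1, roughness means that p is below the least prime factor of a, so the condition
  only lowers the upper end of the interval; for a = 1 it always holds.\<close>

lemma primes_in_rough:
  "\<exists>v'\<le>v. {p \<in> primes_in u v. rough p a} = primes_in u v'" if "a > 0"
proof (cases "a = 1")
  case False
  define q where "q = Min (prime_factors a)"
  have ne: "prime_factors a \<noteq> {}" using False that by (auto simp: prime_factorization_empty_iff)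
  then have q: "q \<in> prime_factors a" "\<And>p. p \<in> prime_factors a \<Longrightarrow> q \<le> p"
    unfolding q_def by (auto intro: Min_in)
  have "rough p a \<longleftrightarrow> p < q" for p using q that by (fastforce simp: rough_def)
  moreover have "q > 0" using q(1) by (auto simp: in_prime_factors_iff dest: prime_gt_0_nat)
  then have "p < q \<longleftrightarrow> p \<le> q - 1" for p by linarith
  ultimately have "{p \<in> primes_in u v. rough p a} = primes_in u (min v (q - 1))"
    by (simp only: set_eq_iff mem_Collect_eq mem_primes_in min.bounded_iff) blast
  then show ?thesis by (intro exI[of _ "min v (q - 1)"]) simp
qed auto

text \<open>For fixed d the condition p d <= y shortens the interval of primes. The lower bound T
  for p gives d a range that does not depend on p.\<close>

lemma sum_primes_rough_swap:
  assumes T: "0 < T" "T \<le> u" and y: "y > 0"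
  shows "(\<Sum>p\<in>primes_in u v. \<Sum>d\<in>rough_le \<tau> (y / real p). f d p) =
    (\<Sum>d\<in>rough_le \<tau> (y / real T). \<Sum>p\<in>primes_in u (min v (nat \<lfloor>y / real d\<rfloor>)). f d p)"
proof -
  have "(\<Sum>p\<in>primes_in u v. \<Sum>d\<in>rough_le \<tau> (y / real p). f d p) =
      (\<Sum>p\<in>primes_in u v. \<Sum>d | d \<in> rough_le \<tau> (y / real T) \<and> real d * real p \<le> y. f d p)"
  proof (intro sum.cong refl)
    fix p assume "p \<in> primes_in u v"
    then have p: "real p > 0" "real T \<le> real p" using T prime_gt_0_nat[of p] by auto
    have "y / real p \<le> y / real T" using p y T by (intro divide_left_mono) auto
    then have "real d \<le> y / real T" if "real d \<le> y / real p" for d using that by linarith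
    moreover have "real d \<le> y / real p \<longleftrightarrow> real d * real p \<le> y" for d using p by (simp add: pos_le_divide_eq)
    ultimately show "rough_le \<tau> (y / real p) = {d. d \<in> rough_le \<tau> (y / real T) \<and> real d * real p \<le> y}" by auto
  qed
  also have "\<dots> = (\<Sum>d\<in>rough_le \<tau> (y / real T). \<Sum>p | p \<in> primes_in u v \<and> real d * real p \<le> y. f d p)"
    by (rule sum.swap_restrict) auto
  also have "\<dots> = (\<Sum>d\<in>rough_le \<tau> (y / real T). \<Sum>p\<in>primes_in u (min v (nat \<lfloor>y / real d\<rfloor>)). f d p)"
  proof (intro sum.cong refl)
    fix d assume "d \<in> rough_le \<tau> (y / real T)"
    then have "d > 0" using rough_pos by auto
    then show "{p. p \<in> primes_in u v \<and> real d * real p \<le> y} = primes_in u (min v (nat \<lfloor>y / real d\<rfloor>))"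
      unfolding primes_in_le_real[symmetric] by (auto simp: field_simps)
  qed
  finally show ?thesis .
qed

lemma square_le_nat_floor:
  assumes "0 < T" "real d \<le> y / real (T\<^sup>2)" "d > 0"
  shows "T\<^sup>2 \<le> nat \<lfloor>y / real d\<rfloor>"
  using assms by (intro le_nat_floor) (simp add: field_simps)

text \<open>With \<open>Y = y / T^2\<close>: for d <= Y the sum over p is complete and so
  independent of d, which allows \<beta> = 0; for larger d the hypothesis on \<open>e\<close> bounds
  it. The weight \<open>e\<close> is left open because it will be both \<open>c p\<close> and
  \<open>c p * ln p\<close>.\<close>

lemma sum_interval_R0_bound:
  assumes T: "2 \<le> T" "T \<le> u" "v \<le> T\<^sup>2" and y: "y > 0"
    and e: "\<And>v'. v' \<le> T\<^sup>2 \<Longrightarrow> \<bar>\<Sum>p\<in>primes_in u v'. e p / real p\<bar> \<le> B"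
  shows "\<bar>\<Sum>p\<in>primes_in u v. e p / real p * R0 (T\<^sup>2) (y / real p)\<bar> \<le> (43 + 40 * exp 64) * B"
proof -
  let ?\<tau> = "T\<^sup>2"
  define Y where "Y = y / real (T\<^sup>2)"
  have Y: "Y > 0" "Y * real T = y / real T" using y T by (auto simp: Y_def power2_eq_square)
  define E where "E = (\<lambda>d. \<Sum>p\<in>primes_in u (min v (nat \<lfloor>y / real d\<rfloor>)). e p / real p)"
  have "(\<Sum>p\<in>primes_in u v. e p / real p * R0 ?\<tau> (y / real p)) =
      (\<Sum>p\<in>primes_in u v. \<Sum>d\<in>rough_le ?\<tau> (y / real p). moebius d / real d * (e p / real p))"
    unfolding R0_def by (simp add: sum_distrib_left mult_ac)
  also have "\<dots> = (\<Sum>d\<in>rough_le ?\<tau> (Y * real T). moebius d / real d * E d)"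
    unfolding Y E_def using T y by (subst sum_primes_rough_swap[where T = T]) (auto simp: sum_distrib_left)
  finally have eq: "(\<Sum>p\<in>primes_in u v. e p / real p * R0 ?\<tau> (y / real p)) =
      (\<Sum>d\<in>rough_le ?\<tau> (Y * real T). moebius d / real d * E d)" .
  have "\<bar>\<Sum>d\<in>rough_le ?\<tau> (Y * real T). moebius d / real d * E d\<bar> \<le>
      2 * \<bar>\<Sum>p\<in>primes_in u v. e p / real p\<bar> + (20 + 20 * exp 67) * ln T * \<bar>0\<bar> + (41 + 40 * exp 64) * \<bar>B\<bar>"
  proof (rule sum_moebius_rough_weight_bound[OF T(1) Y(1)])
    fix d assume d: "rough ?\<tau> d" "real d \<le> Y"
    then have "v \<le> nat \<lfloor>y / real d\<rfloor>"
      using T(3) square_le_nat_floor[of T d y] T rough_pos[of ?\<tau> d] unfolding Y_def by linarith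
    then show "E d = (\<Sum>p\<in>primes_in u v. e p / real p) + 0 * ln (Y / real d)"
      unfolding E_def by (simp add: min_absorb1)
  next
    fix d show "\<bar>E d\<bar> \<le> B" unfolding E_def using T by (intro e) auto
  qed
  moreover have "\<bar>\<Sum>p\<in>primes_in u v. e p / real p\<bar> \<le> B" using e T by blast
  moreover from this have "\<bar>B\<bar> = B" by linarith
  ultimately show ?thesis unfolding eq by (simp add: algebra_simps)
qed

text \<open>\<open>F p\<close> involves p-rough integers; splitting off the factor a with primes in
  (p, T^2] leaves \<open>G\<close>, which belongs to the fixed threshold. After exchanging the sums,
  a restricts p to an initial part of the interval, where the bound \<open>D\<close> applies. As
  \<open>G\<close> vanishes below 1, a may range up to y for every p.\<close>

lemma sum_interval_transfer:
  assumes T: "2 \<le> T" "T \<le> u" "v \<le> T\<^sup>2" and y: "y > 0"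
    and F: "\<And>t z. t \<le> T\<^sup>2 \<Longrightarrow>
      F t z = (\<Sum>a | a \<in> rough_le t z \<and> smooth (T\<^sup>2) a. moebius a / real a * G (z / real a))"
    and G: "\<And>z. z < 1 \<Longrightarrow> G z = 0"
    and D: "\<And>v' y'. v' \<le> T\<^sup>2 \<Longrightarrow> y' > 0 \<Longrightarrow> \<bar>\<Sum>p\<in>primes_in u v'. w p * G (y' / real p)\<bar> \<le> D"
  shows "\<bar>\<Sum>p\<in>primes_in u v. w p * F p (y / real p)\<bar> \<le> 2 * exp 64 * D"
proof -
  let ?A = "{a \<in> pos_le y. rough T a \<and> smooth (T\<^sup>2) a}"
  have finA: "finite ?A" by (rule finite_subset[OF _ finite_pos_le[of y]]) auto
  have "(\<Sum>p\<in>primes_in u v. w p * F p (y / real p)) =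
      (\<Sum>p\<in>primes_in u v. \<Sum>a | a \<in> ?A \<and> rough p a. moebius a / real a * (w p * G (y / real a / real p)))"
  proof (intro sum.cong refl)
    fix p assume "p \<in> primes_in u v"
    then have p: "p \<ge> 1" "T \<le> p" "p \<le> T\<^sup>2" using T prime_gt_0_nat[of p] by auto
    have fin: "finite {a. a \<in> ?A \<and> rough p a}" using finA by (rule rev_finite_subset) auto
    have "F p (y / real p) =
        (\<Sum>a | a \<in> rough_le p (y / real p) \<and> smooth (T\<^sup>2) a. moebius a / real a * G (y / real p / real a))"
      by (rule F[OF p(3)])
    also have "\<dots> = (\<Sum>a | a \<in> ?A \<and> rough p a. moebius a / real a * G (y / real p / real a))"
    proof (rule sum.mono_neutral_left[OF fin])
      have "y / real p \<le> y / 1" using p y by (intro divide_left_mono) auto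
      then show "{a. a \<in> rough_le p (y / real p) \<and> smooth (T\<^sup>2) a} \<subseteq> {a. a \<in> ?A \<and> rough p a}"
        using rough_mono[OF _ p(2)] rough_pos by auto
      have "G (y / real p / real a) = 0" if "a \<in> ?A" "\<not> real a \<le> y / real p" for a
        using that p by (intro G) (auto simp: field_simps)
      then show "\<forall>a\<in>{a. a \<in> ?A \<and> rough p a} - {a. a \<in> rough_le p (y / real p) \<and> smooth (T\<^sup>2) a}.
          moebius a / real a * G (y / real p / real a) = 0" by auto
    qed
    finally show "w p * F p (y / real p) =
        (\<Sum>a | a \<in> ?A \<and> rough p a. moebius a / real a * (w p * G (y / real a / real p)))"
      by (simp add: sum_distrib_left mult_ac)
  qed
  also have "\<dots> = (\<Sum>a\<in>?A. \<Sum>p | p \<in> primes_in u v \<and> rough p a. moebius a / real a * (w p * G (y / real a / real p)))"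
    using finA by (intro sum.swap_restrict) auto
  also have "\<dots> = (\<Sum>a\<in>?A. moebius a / real a * (\<Sum>p | p \<in> primes_in u v \<and> rough p a. w p * G (y / real a / real p)))"
    by (simp add: sum_distrib_left)
  finally have eq: "(\<Sum>p\<in>primes_in u v. w p * F p (y / real p)) =
      (\<Sum>a\<in>?A. moebius a / real a * (\<Sum>p | p \<in> primes_in u v \<and> rough p a. w p * G (y / real a / real p)))" .
  have "\<bar>\<Sum>p\<in>primes_in u v. w p * F p (y / real p)\<bar> \<le> (\<Sum>a\<in>?A. D * (1 / real a))"
    unfolding eq
  proof (rule order_trans[OF sum_abs sum_mono])
    fix a assume a: "a \<in> ?A"
    obtain v' where v': "v' \<le> v" "{p \<in> primes_in u v. rough p a} = primes_in u v'"
      using primes_in_rough[of a v u] a by auto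
    have "\<bar>\<Sum>p\<in>primes_in u v'. w p * G (y / real a / real p)\<bar> \<le> D"
      using v' T a y by (intro D) auto
    then have "\<bar>moebius a\<bar> * \<bar>\<Sum>p\<in>primes_in u v'. w p * G (y / real a / real p)\<bar> \<le> 1 * D"
      using abs_moebius_le[of a] by (intro mult_mono) auto
    then show "\<bar>moebius a / real a * (\<Sum>p | p \<in> primes_in u v \<and> rough p a. w p * G (y / real a / real p))\<bar>
        \<le> D * (1 / real a)"
      unfolding v' using a by (simp add: abs_mult divide_right_mono)
  qed
  also have "\<dots> = D * (\<Sum>a\<in>?A. 1 / real a)" by (simp only: sum_distrib_left)
  also have "\<dots> \<le> D * (2 * exp 64)"
  proof (rule mult_left_mono)
    have lt: "2 \<le> T" "T \<le> T\<^sup>2" using T by (simp_all add: power2_eq_square)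
    have "(\<Sum>a\<in>?A. 1 / real a) \<le>
        (\<Sum>n | n \<in> pos_le y \<and> prime_factors n \<subseteq> {p. p \<in> {T<..T\<^sup>2} \<and> prime p}. 1 / real n)"
      by (intro sum_mono2 finite_subset[OF _ finite_pos_le[of y]])
         (auto simp: rough_def smooth_def in_prime_factors_iff)
    also have "\<dots> \<le> exp ((\<Sum>p | p \<in> {T<..T\<^sup>2} \<and> prime p. 1 / real p) + 4)"
      by (rule sum_inverse_prime_factors_subset_le_exp) auto
    \<comment> \<open>\<open>ln (ln (T^2)) - ln (ln T) = ln 2\<close>: the primes from T to T^2 have
      bounded total reciprocal, which is the reason for intervals of this shape.\<close>
    also have "\<dots> \<le> exp (ln 2 + 64)"
    proof -
      have "ln (ln (real (T\<^sup>2))) = ln 2 + ln (ln (real T))"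
        using T by (simp add: ln_realpow ln_mult)
      then show ?thesis using sum_primes_inverse_le[OF lt] by simp
    qed
    finally show "(\<Sum>a\<in>?A. 1 / real a) \<le> 2 * exp 64" by (simp add: exp_add)
    show "0 \<le> D" using D[of 0 1] by simp
  qed
  finally show ?thesis by (simp add: mult_ac)
qed

definition C_int :: real where
  "C_int = 2 * exp 64 * (43 + 40 * exp 64)"

lemma sum_interval_rough_R0_bound:
  assumes T: "2 \<le> T" "T \<le> u" "v \<le> T\<^sup>2" and y: "y > 0"
    and e: "\<And>v'. v' \<le> T\<^sup>2 \<Longrightarrow> \<bar>\<Sum>p\<in>primes_in u v'. e p / real p\<bar> \<le> B"
  shows "\<bar>\<Sum>p\<in>primes_in u v. e p / real p * R0 p (y / real p)\<bar> \<le> C_int * B"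
  using sum_interval_transfer[OF T y R0_split, where w = "\<lambda>p. e p / real p" and D = "(43 + 40 * exp 64) * B"]
    sum_interval_R0_bound[OF T(1,2) _ _ e] by (simp add: C_int_def mult_ac)

text \<open>The 62 consists of 1 for the endpoint T, at most 1 for \<open>ln 2\<close>, and the
  error 60.\<close>

lemma sum_primes_in_inverse_le:
  assumes "2 \<le> T" "T \<le> u" "v \<le> T\<^sup>2"
  shows "(\<Sum>p\<in>primes_in u v. 1 / real p) \<le> 62"
proof -
  have "(\<Sum>p\<in>primes_in u v. 1 / real p) \<le> (\<Sum>p\<in>insert T {p. p \<in> {T<..T\<^sup>2} \<and> prime p}. 1 / real p)"
    using assms by (intro sum_mono2) auto
  also have "\<dots> = 1 / real T + (\<Sum>p | p \<in> {T<..T\<^sup>2} \<and> prime p. 1 / real p)" by simp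
  finally have 1: "(\<Sum>p\<in>primes_in u v. 1 / real p) \<le> 1 / real T + (\<Sum>p | p \<in> {T<..T\<^sup>2} \<and> prime p. 1 / real p)" .
  have "T \<le> T\<^sup>2" using assms by (simp add: power2_eq_square)
  moreover have "ln (ln (real (T\<^sup>2))) = ln 2 + ln (ln (real T))"
    using assms by (simp add: ln_realpow ln_mult)
  moreover have "1 / real T \<le> 1" "ln (2::real) \<le> 1" using assms ln_le_minus_one[of 2] by auto
  ultimately show ?thesis using 1 sum_primes_inverse_le[of T "T\<^sup>2"] assms by linarith
qed

lemma sum_primes_in_ln_le: "(\<Sum>p | p \<in> primes_in u v \<and> real p \<le> y. ln (real p)) \<le> psi y"
proof -
  have "(\<Sum>p | p \<in> primes_in u v \<and> real p \<le> y. ln (real p)) = (\<Sum>p | p \<in> primes_in u v \<and> real p \<le> y. mangoldt p)"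
    by (intro sum.cong) auto
  also have "\<dots> \<le> psi y"
    unfolding psi_def by (intro sum_mono2) (auto simp: prime_gt_0_nat mangoldt_nonneg)
  finally show ?thesis .
qed

text \<open>Summing over exponents leaves \<open>ln q / (q - 1)\<close>, and Mertens up to t gives
  \<open>ln t + 17\<close>, which is below \<open>50 * ln t\<close> because
  \<open>ln t \<ge> 1 / 2\<close>.\<close>

lemma sum_smooth_le_mangoldt_le:
  assumes "2 \<le> t"
  shows "(\<Sum>r\<in>smooth_le t z. mangoldt r / real r) \<le> 50 * ln (real t)"
proof -
  have "(\<Sum>r\<in>smooth_le t z. mangoldt r / real r) =
      (\<Sum>r\<in>pos_le z. mangoldt r * (if smooth t r then 1 / real r else 0))"
    unfolding sum_smooth_le_conv by (intro sum.cong) auto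
  also have "\<dots> = (\<Sum>(q, a)\<in>ppow_le z. ln (real q) * (if smooth t (q ^ a) then 1 / real (q ^ a) else 0))"
    by (rule sum_mangoldt_eq_ppow)
  also have "\<dots> = (\<Sum>(q, a)\<in>ppow_le z. if q \<le> t then ln (real q) / real q ^ a else 0)"
    by (intro sum.cong) (auto simp: smooth_prime_power)
  also have "\<dots> \<le> (\<Sum>q | q \<in> pos_le z \<and> prime q. \<Sum>a=1..nat \<lfloor>z\<rfloor>. if q \<le> t then ln (real q) / real q ^ a else 0)"
    by (rule sum_ppow_le_le) auto
  also have "\<dots> \<le> (\<Sum>q | q \<in> pos_le z \<and> prime q. if q \<le> t then ln (real q) * (1 / (real q - 1)) else 0)"
  proof (intro sum_mono)
    fix q assume "q \<in> {q. q \<in> pos_le z \<and> prime q}"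
    then have q: "real q > 1" using prime_gt_1_nat by auto
    have "(\<Sum>a=1..nat \<lfloor>z\<rfloor>. ln (real q) / real q ^ a) = ln (real q) * (\<Sum>a=1..nat \<lfloor>z\<rfloor>. 1 / real q ^ a)"
      by (simp add: sum_distrib_left)
    also have "\<dots> \<le> ln (real q) * (1 / (real q - 1))" using q by (intro mult_left_mono sum_inverse_power_le) auto
    finally show "(\<Sum>a=1..nat \<lfloor>z\<rfloor>. if q \<le> t then ln (real q) / real q ^ a else 0) \<le>
        (if q \<le> t then ln (real q) * (1 / (real q - 1)) else 0)" by simp
  qed
  also have "\<dots> \<le> (\<Sum>q | q \<in> pos_le (real t) \<and> prime q. ln (real q) * (1 / (real q - 1)))"
    by (subst sum.inter_filter[symmetric]) (auto intro!: sum_mono2 mult_nonneg_nonneg dest: prime_ge_2_nat)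
  also have "\<dots> = (\<Sum>q | q \<in> pos_le (real t) \<and> prime q. ln (real q) / real q) +
      (\<Sum>q | q \<in> pos_le (real t) \<and> prime q. ln (real q) / (real q * (real q - 1)))"
    unfolding sum.distrib[symmetric]
  proof (intro sum.cong refl)
    fix q assume "q \<in> {q. q \<in> pos_le (real t) \<and> prime q}"
    then have q: "real q > 1" using prime_gt_1_nat by auto
    show "ln (real q) * (1 / (real q - 1)) = ln (real q) / real q + ln (real q) / (real q * (real q - 1))"
      using q by (simp add: field_simps)
  qed
  finally show ?thesis
    using sum_primes_ln_div_bound[of "real t"] sum_primes_ln_div_mult_le[of "real t"] ln_ge_half[OF assms] assms
    by (simp add: abs_le_iff)
qed

text \<open>This abstracts the residue class: c will be the indicator of j modulo l minus
  \<open>1 / totient l\<close>. The pointwise bound covers all n because c is also applied to the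
  default value 1 of \<open>P3\<close>.\<close>

locale mertens_weight =
  fixes c :: "nat \<Rightarrow> real" and M :: real
  assumes abs_c_le: "\<bar>c n\<bar> \<le> 1"
    and M_ge_1: "M \<ge> 1"
    and mertens: "\<bar>\<Sum>p\<in>primes_in 1 n. c p * ln (real p) / real p\<bar> \<le> M"
begin

lemma sum_c_ln_bound: "\<bar>\<Sum>p\<in>primes_in u v. c p * ln (real p) / real p\<bar> \<le> 2 * M"
proof (cases "1 \<le> u \<and> u \<le> v")
  case True
  have "primes_in 1 v = primes_in 1 (u - 1) \<union> primes_in u v" using True by (auto simp: primes_in_def)
  moreover have "primes_in 1 (u - 1) \<inter> primes_in u v = {}" using True by (auto simp: primes_in_def)
  ultimately have "(\<Sum>p\<in>primes_in 1 v. c p * ln (real p) / real p) =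
      (\<Sum>p\<in>primes_in 1 (u - 1). c p * ln (real p) / real p) + (\<Sum>p\<in>primes_in u v. c p * ln (real p) / real p)"
    by (simp only:) (intro sum.union_disjoint, auto)
  then show ?thesis using mertens[of v] mertens[of "u - 1"] by linarith
next
  case False
  show ?thesis
  proof (cases "u = 0")
    case True
    then have "primes_in u v = primes_in 1 v" by (auto simp: Suc_le_eq prime_gt_0_nat)
    then show ?thesis using mertens[of v] M_ge_1 by simp
  next
    case False
    with \<open>\<not> (1 \<le> u \<and> u \<le> v)\<close> have "primes_in u v = {}" by auto
    then show ?thesis using M_ge_1 by simp
  qed
qed

text \<open>Partial summation against the decreasing function \<open>1 / ln\<close>: dropping the
  factor \<open>ln p\<close> gains \<open>1 / ln u\<close>.\<close>

lemma sum_c_bound: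
  assumes "2 \<le> u"
  shows "\<bar>\<Sum>p\<in>primes_in u v. c p / real p\<bar> \<le> 2 * M / ln (real u)"
proof (cases "u \<le> v")
  case True
  define S where "S = (\<lambda>v. \<Sum>p\<in>primes_in u v. c p * ln (real p) / real p)"
  define X where "X = (\<lambda>v. \<Sum>p\<in>primes_in u v. c p / real p)"
  have "\<bar>X v - S v / ln (real v)\<bar> \<le> 2 * M * (1 / ln (real u) - 1 / ln (real v))"
    using True
  proof (induction v rule: dec_induct)
    case base
    have "primes_in u u = (if prime u then {u} else {})" by auto
    then show ?case using assms by (simp add: X_def S_def)
  next
    case (step n)
    let ?l = "ln (real n)" and ?l' = "ln (real (Suc n))"
    have l: "?l > 0" "?l' > 0" "?l \<le> ?l'" using step.hyps assms by auto
    have eqs: "primes_in u (Suc n) = (if prime (Suc n) then insert (Suc n) (primes_in u n) else primes_in u n)"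
      using step.hyps by (auto simp: le_Suc_eq)
    have "Suc n \<notin> primes_in u n" by simp
    then have SX: "S (Suc n) - S n = (if prime (Suc n) then c (Suc n) * ?l' / real (Suc n) else 0)"
      "X (Suc n) - X n = (if prime (Suc n) then c (Suc n) / real (Suc n) else 0)"
      unfolding S_def X_def eqs by (simp_all del: of_nat_Suc mem_primes_in)
    have "X (Suc n) = X n + (S (Suc n) - S n) / ?l'"
      using SX l by (auto simp: algebra_simps simp del: of_nat_Suc)
    then have "X (Suc n) - S (Suc n) / ?l' = (X n - S n / ?l) + S n * (1 / ?l - 1 / ?l')"
      by (simp add: algebra_simps diff_divide_distrib)
    moreover have "\<bar>S n * (1 / ?l - 1 / ?l')\<bar> \<le> 2 * M * (1 / ?l - 1 / ?l')"
    proof -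
      have "0 \<le> 1 / ?l - 1 / ?l'" using frac_le[of 1 1 ?l ?l'] l by simp
      moreover have "\<bar>S n\<bar> \<le> 2 * M" unfolding S_def by (rule sum_c_ln_bound)
      ultimately show ?thesis unfolding abs_mult by (simp add: mult_right_mono)
    qed
    ultimately have "\<bar>X (Suc n) - S (Suc n) / ?l'\<bar> \<le>
        2 * M * (1 / ln (real u) - 1 / ?l) + 2 * M * (1 / ?l - 1 / ?l')"
      using step.IH by linarith
    then show ?case by (simp add: algebra_simps)
  qed
  moreover have "\<bar>S v / ln (real v)\<bar> \<le> 2 * M * (1 / ln (real v))"
  proof -
    have "\<bar>S v\<bar> \<le> 2 * M" unfolding S_def by (rule sum_c_ln_bound)
    then show ?thesis using True assms by (simp add: divide_right_mono)
  qed
  ultimately have "\<bar>X v\<bar> \<le> 2 * M * (1 / ln (real u) - 1 / ln (real v)) + 2 * M * (1 / ln (real v))"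
    by linarith
  then show ?thesis unfolding X_def by (simp add: algebra_simps)
next
  case False
  then have "primes_in u v = {}" by auto
  then show ?thesis using M_ge_1 assms by simp
qed

lemma sum_c_bound':
  assumes "2 \<le> T" "T \<le> u"
  shows "\<bar>\<Sum>p\<in>primes_in u v. c p / real p\<bar> \<le> 2 * M / ln (real T)"
proof -
  have "2 * M / ln (real u) \<le> 2 * M / ln (real T)"
    using assms M_ge_1 by (intro divide_left_mono) auto
  with sum_c_bound[of u v] assms show ?thesis by linarith
qed

text \<open>Since \<open>ln (y / p / d) = ln (y / d) - ln p\<close>, the inner sum over p is
  \<open>a * X v - S v\<close> with \<open>a = ln (y / d) - 1\<close>, where X is O(M / ln T) and S
  is O(M). The growth ln T, both of a and of \<open>R1\<close>, is paid for by the decay of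
  X.\<close>

lemma sum_interval_R1_bound:
  assumes T: "2 \<le> T" "T \<le> u" "v \<le> T\<^sup>2" and y: "y > 0"
  shows "\<bar>\<Sum>p\<in>primes_in u v. c p / real p * (R1 (T\<^sup>2) (y / real p) - R0 (T\<^sup>2) (y / real p))\<bar> \<le>
    (300 + 240 * exp 64 + 40 * exp 67) * M"
proof -
  let ?\<tau> = "T\<^sup>2"
  define Y where "Y = y / real (T\<^sup>2)"
  have Y: "Y > 0" "Y * real T = y / real T" using y T by (auto simp: Y_def power2_eq_square)
  have lnT: "ln (real T) \<ge> 1 / 2" "ln (real ?\<tau>) = 2 * ln (real T)" using T ln_ge_half by (auto simp: ln_realpow)
  define X where "X = (\<lambda>v. \<Sum>p\<in>primes_in u v. c p / real p)"
  define S where "S = (\<lambda>v. \<Sum>p\<in>primes_in u v. c p * ln (real p) / real p)"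
  have X: "\<bar>X v\<bar> \<le> 2 * M / ln (real T)" for v unfolding X_def using T by (intro sum_c_bound')
  have S: "\<bar>S v\<bar> \<le> 2 * M" for v unfolding S_def by (rule sum_c_ln_bound)
  have lin: "(\<Sum>p\<in>primes_in u v. c p / real p * (a - ln (real p))) = a * X v - S v" for a v
    unfolding X_def S_def sum_distrib_left sum_subtractf[symmetric]
    by (intro sum.cong refl) (simp add: algebra_simps diff_divide_distrib)
  have lin_bound: "\<bar>a * X v - S v\<bar> \<le> 6 * M" if "\<bar>a\<bar> \<le> 2 * ln (real T)" for a v
  proof -
    have "\<bar>a * X v\<bar> \<le> (2 * ln (real T)) * (2 * M / ln (real T))"
      unfolding abs_mult using that X lnT by (intro mult_mono) auto
    also have "\<dots> = 4 * M" using lnT by simp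
    finally show ?thesis using S[of v] by linarith
  qed
  define E where "E = (\<lambda>d. \<Sum>p\<in>primes_in u (min v (nat \<lfloor>y / real d\<rfloor>)). c p / real p * (ln (y / real d) - 1 - ln (real p)))"
  have "(\<Sum>p\<in>primes_in u v. c p / real p * (R1 ?\<tau> (y / real p) - R0 ?\<tau> (y / real p))) =
      (\<Sum>p\<in>primes_in u v. \<Sum>d\<in>rough_le ?\<tau> (y / real p). moebius d / real d * (c p / real p * (ln (y / real d) - 1 - ln (real p))))"
  proof (intro sum.cong refl)
    fix p assume "p \<in> primes_in u v"
    then have p: "real p > 0" using prime_gt_0_nat[of p] by auto
    have "R1 ?\<tau> (y / real p) - R0 ?\<tau> (y / real p) =
        (\<Sum>d\<in>rough_le ?\<tau> (y / real p). moebius d / real d * (ln (y / real d) - 1 - ln (real p)))"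
      unfolding R1_def R0_def sum_subtractf[symmetric]
    proof (intro sum.cong refl)
      fix d assume "d \<in> rough_le ?\<tau> (y / real p)"
      then have "real d > 0" using rough_pos by auto
      then show "moebius d / real d * ln (y / real p / real d) - moebius d / real d =
          moebius d / real d * (ln (y / real d) - 1 - ln (real p))"
        using p y by (simp add: ln_div ln_mult algebra_simps)
    qed
    then show "c p / real p * (R1 ?\<tau> (y / real p) - R0 ?\<tau> (y / real p)) =
        (\<Sum>d\<in>rough_le ?\<tau> (y / real p). moebius d / real d * (c p / real p * (ln (y / real d) - 1 - ln (real p))))"
      by (simp add: sum_distrib_left mult_ac)
  qed
  also have "\<dots> = (\<Sum>d\<in>rough_le ?\<tau> (Y * real T). moebius d / real d * E d)"
    unfolding Y E_def using T y by (subst sum_primes_rough_swap[where T = T]) (auto simp: sum_distrib_left)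
  finally have eq: "(\<Sum>p\<in>primes_in u v. c p / real p * (R1 ?\<tau> (y / real p) - R0 ?\<tau> (y / real p))) =
      (\<Sum>d\<in>rough_le ?\<tau> (Y * real T). moebius d / real d * E d)" .
  have combine: "s \<le> 2 * a' + b'' + g' \<Longrightarrow> a' \<le> a \<Longrightarrow> b'' \<le> b' \<Longrightarrow> b' = b \<Longrightarrow> g' = g \<Longrightarrow> s \<le> 2 * a + b + g"
    for s a a' b b' b'' g g' :: real by simp
  \<comment> \<open>The value of the inner sum at d = Y. For smaller d it grows by
    \<open>X v * ln (Y / d)\<close>, so that \<beta> is \<open>X v\<close>.\<close>
  let ?\<alpha> = "(ln (real ?\<tau>) - 1) * X v - S v"
  have "\<bar>\<Sum>d\<in>rough_le ?\<tau> (Y * real T). moebius d / real d * E d\<bar> \<le>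
      2 * \<bar>?\<alpha>\<bar> + (20 + 20 * exp 67) * ln (real T) * \<bar>X v\<bar> + (41 + 40 * exp 64) * \<bar>6 * M\<bar>"
  proof (rule sum_moebius_rough_weight_bound[OF T(1) Y(1)])
    fix d assume d: "rough ?\<tau> d" "real d \<le> Y"
    then have dpos: "d > 0" using rough_pos by blast
    have "v \<le> nat \<lfloor>y / real d\<rfloor>"
      using T(3) square_le_nat_floor[of T d y] T d dpos unfolding Y_def by linarith
    then have "E d = (ln (y / real d) - 1) * X v - S v"
      unfolding E_def lin by (simp add: min_absorb1)
    moreover have "ln (y / real d) = ln (Y / real d) + ln (real ?\<tau>)"
    proof -
      have "y / real d = Y / real d * real ?\<tau>" using T by (simp add: Y_def)
      moreover have "Y / real d > 0" "real ?\<tau> > 0" using Y T dpos by auto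
      ultimately show ?thesis by (simp only: ln_mult_pos)
    qed
    ultimately show "E d = ?\<alpha> + X v * ln (Y / real d)" by (simp add: algebra_simps)
  next
    fix d assume d: "rough ?\<tau> d" "real d > Y" "real d \<le> Y * real T"
    then have dpos: "d > 0" using rough_pos by blast
    have "real T \<le> y / real d" "y / real d \<le> real ?\<tau>"
      using d dpos T y unfolding Y(2) by (auto simp: Y_def field_simps)
    then have "ln (real T) \<le> ln (y / real d)" "ln (y / real d) \<le> 2 * ln (real T)"
      using T unfolding lnT(2)[symmetric] by auto
    then have "\<bar>ln (y / real d) - 1\<bar> \<le> 2 * ln (real T)" using lnT by linarith
    then show "\<bar>E d\<bar> \<le> 6 * M" unfolding E_def lin by (rule lin_bound)
  qed
  moreover have "\<bar>?\<alpha>\<bar> \<le> 6 * M" using lnT by (intro lin_bound) linarith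
  moreover have "(20 + 20 * exp 67) * ln (real T) * \<bar>X v\<bar> \<le> (20 + 20 * exp 67) * ln (real T) * (2 * M / ln (real T))"
    using X lnT by (intro mult_left_mono) auto
  moreover have "\<dots> = (40 + 40 * exp 67) * M" using lnT by simp
  moreover have "(41 + 40 * exp 64) * \<bar>6 * M\<bar> = (246 + 240 * exp 64) * M" using M_ge_1 by (simp add: algebra_simps)
  ultimately have "\<bar>\<Sum>d\<in>rough_le ?\<tau> (Y * real T). moebius d / real d * E d\<bar> \<le>
      2 * (6 * M) + (40 + 40 * exp 67) * M + (246 + 240 * exp 64) * M"
    by (rule combine)
  also have "\<dots> \<le> (300 + 240 * exp 64 + 40 * exp 67) * M" using M_ge_1 by (simp add: algebra_simps)
  finally show ?thesis unfolding eq .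
qed

lemma sum_interval_rough_R1_bound:
  assumes T: "2 \<le> T" "T \<le> u" "v \<le> T\<^sup>2" and y: "y > 0"
  shows "\<bar>\<Sum>p\<in>primes_in u v. c p / real p * (R1 p (y / real p) - R0 p (y / real p))\<bar> \<le>
    2 * exp 64 * ((300 + 240 * exp 64 + 40 * exp 67) * M)"
proof (rule sum_interval_transfer[OF T y, where F = "\<lambda>t z. R1 t z - R0 t z" and
      G = "\<lambda>z. R1 (T\<^sup>2) z - R0 (T\<^sup>2) z"])
  fix t z assume "t \<le> T\<^sup>2"
  show "R1 t z - R0 t z = (\<Sum>a | a \<in> rough_le t z \<and> smooth (T\<^sup>2) a.
      moebius a / real a * (R1 (T\<^sup>2) (z / real a) - R0 (T\<^sup>2) (z / real a)))"
    unfolding R0_split[OF \<open>t \<le> T\<^sup>2\<close>, of z] R1_split[OF \<open>t \<le> T\<^sup>2\<close>, of z]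
    by (simp add: right_diff_distrib sum_subtractf)
qed (use sum_interval_R1_bound[OF T(1,2)] in auto)

end

text \<open>The intervals from \<open>2 ^ 2 ^ k\<close> to \<open>2 ^ 2 ^ (k + 1)\<close> have the
  shape required by the hypothesis, and K of them reach v; so K can be taken of order ln ln
  v.\<close>

lemma sum_primes_in_dyadic_le:
  fixes f :: "nat \<Rightarrow> real"
  assumes "\<And>T u v. 2 \<le> T \<Longrightarrow> T \<le> u \<Longrightarrow> v \<le> T\<^sup>2 \<Longrightarrow> \<bar>\<Sum>p\<in>primes_in u v. f p\<bar> \<le> D"
    and "v < 2 ^ 2 ^ K"
  shows "\<bar>\<Sum>p\<in>primes_in 2 v. f p\<bar> \<le> real K * D"
  using assms(2)
proof (induction K arbitrary: v)
  case 0
  then have "primes_in 2 v = {}" by auto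
  then show ?case by simp
next
  case (Suc K)
  define T :: nat where "T = 2 ^ 2 ^ K"
  have T: "2 \<le> T" using self_le_power[of "2::nat" "2 ^ K"] by (simp add: T_def)
  have "(2::nat) ^ 2 ^ Suc K = T\<^sup>2" by (simp add: T_def power_mult [symmetric] mult.commute)
  then have v: "v \<le> T\<^sup>2" using Suc.prems by simp
  have un: "primes_in 2 v = primes_in 2 (min v (T - 1)) \<union> primes_in T v" using T by auto
  have "(\<Sum>p\<in>primes_in 2 (min v (T - 1)) \<union> primes_in T v. f p) =
      (\<Sum>p\<in>primes_in 2 (min v (T - 1)). f p) + (\<Sum>p\<in>primes_in T v. f p)"
    using T by (intro sum.union_disjoint) auto
  moreover have "\<bar>\<Sum>p\<in>primes_in 2 (min v (T - 1)). f p\<bar> \<le> real K * D"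
    using T by (intro Suc.IH) (auto simp: T_def min_less_iff_disj)
  moreover have "\<bar>\<Sum>p\<in>primes_in T v. f p\<bar> \<le> D" using assms(1)[OF T order_refl v] .
  ultimately show ?case unfolding un[symmetric] by (simp add: algebra_simps)
qed

lemma sum_smooth_le_smooth_swap:
  "(\<Sum>b\<in>smooth_le t z. \<Sum>s\<in>smooth_le t (z / real b). f b s) =
   (\<Sum>s\<in>smooth_le t z. \<Sum>b\<in>smooth_le t (z / real s). f b s)"
proof -
  have "(\<Sum>b\<in>smooth_le t z. \<Sum>s\<in>smooth_le t (z / real b). f b s) =
      (\<Sum>b\<in>pos_le z. \<Sum>s\<in>pos_le (z / real b). if smooth t b \<and> smooth t s then f b s else 0)"
    unfolding sum_smooth_le_conv by (intro sum.cong refl) (auto intro!: sum.cong)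
  also have "\<dots> = (\<Sum>s\<in>pos_le z. \<Sum>b\<in>pos_le (z / real s). if smooth t b \<and> smooth t s then f b s else 0)"
    by (rule sum_pos_le_swap)
  also have "\<dots> = (\<Sum>s\<in>smooth_le t z. \<Sum>b\<in>smooth_le t (z / real s). f b s)"
    unfolding sum_smooth_le_conv by (intro sum.cong refl) (auto intro!: sum.cong)
  finally show ?thesis .
qed

section \<open>Logarithmic weights on smooth numbers\<close>

definition smooth_ln :: "nat \<Rightarrow> real \<Rightarrow> real" where
  "smooth_ln t z = (\<Sum>b\<in>smooth_le t z. ln (real b))"

lemma smooth_ln_eq:
  "smooth_ln t z = (\<Sum>r\<in>smooth_le t z. mangoldt r * real (card (smooth_le t (z / real r))))"
proof -
  have "smooth_ln t z = (\<Sum>n\<in>pos_le z. \<Sum>d | d dvd n. if smooth t (d * (n div d)) then mangoldt d else 0)"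
    unfolding smooth_ln_def sum_smooth_le_conv
  proof (intro sum.cong refl)
    fix n assume "n \<in> pos_le z"
    have "(\<Sum>d | d dvd n. if smooth t (d * (n div d)) then mangoldt d else 0) =
        (\<Sum>d | d dvd n. if smooth t n then mangoldt d else (0 :: real))"
      by (intro sum.cong) auto
    then show "(if smooth t n then ln (real n) else 0) =
        (\<Sum>d | d dvd n. if smooth t (d * (n div d)) then mangoldt d else 0)"
      using \<open>n \<in> pos_le z\<close> by (simp add: mangoldt_sum)
  qed
  also have "\<dots> = (\<Sum>d\<in>pos_le z. \<Sum>k\<in>pos_le (z / real d). if smooth t (d * k) then mangoldt d else 0)"
    by (rule sum_divisors_swap)
  also have "\<dots> = (\<Sum>r\<in>smooth_le t z. \<Sum>k\<in>smooth_le t (z / real r). mangoldt r)"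
    unfolding sum_smooth_le_conv by (intro sum.cong refl) (auto simp: smooth_mult_iff intro!: sum.cong)
  finally show ?thesis by (simp add: mult.commute)
qed

lemma mangoldt_smooth_or_rough: "mangoldt s \<noteq> (0::real) \<Longrightarrow> smooth t s \<longleftrightarrow> \<not> rough t s"
proof -
  assume "mangoldt s \<noteq> (0::real)"
  then have "primepow s" by (auto simp: mangoldt_def split: if_splits)
  then obtain q a where "prime q" "a > 0" "s = q ^ a" by (auto simp: primepow_def)
  then show ?thesis by (auto simp: smooth_prime_power rough_prime_power)
qed

text \<open>A prime power is smooth or rough according to its prime, so \<open>psi\<close> splits
  into two parts. The smooth part, with b and s exchanged, is \<open>smooth_ln\<close> by
  \<open>smooth_ln_eq\<close>.\<close>

lemma sum_smooth_le_rough_mangoldt: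
  "(\<Sum>b\<in>smooth_le t z. \<Sum>s\<in>rough_le t (z / real b). mangoldt s) = U t z - smooth_ln t z"
proof -
  have split: "psi w = (\<Sum>s\<in>smooth_le t w. mangoldt s) + (\<Sum>s\<in>rough_le t w. mangoldt s)" for w
    unfolding psi_def sum_smooth_le_conv sum_rough_le_conv sum.distrib[symmetric]
  proof (intro sum.cong refl)
    fix s show "mangoldt s = (if smooth t s then mangoldt s else 0) + (if rough t s then mangoldt s else 0 :: real)"
      using mangoldt_smooth_or_rough[of s t] by auto
  qed
  have "smooth_ln t z = (\<Sum>b\<in>smooth_le t z. \<Sum>s\<in>smooth_le t (z / real b). mangoldt s)"
    unfolding smooth_ln_eq by (subst sum_smooth_le_smooth_swap) (simp add: mult.commute)
  then show ?thesis
    unfolding U_def split by (simp add: sum.distrib)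
qed

text \<open>In the product p d the prime p is the least prime factor, so these products are distinct
  integers up to y. The double sum is therefore O(y), without any loss from the number of primes
  p.\<close>

lemma sum_primes_rough_one_plus_ln_le:
  assumes "y > 0"
  shows "(\<Sum>p\<in>primes_in u v. \<Sum>d\<in>rough_le p (y / real p). 1 + ln (y / real p / real d)) \<le> 3 * y"
proof -
  let ?S = "Sigma (primes_in u v) (\<lambda>p. rough_le p (y / real p))"
  have no: False if "prime p" "prime p'" "p < p'" "rough p' d'" "p * d = p' * d'" for p p' d d' :: nat
  proof -
    have "p dvd p' * d'" using that(5) by (metis dvd_triv_left)
    then have "p dvd d'" using that prime_dvd_mult_iff[of p p' d'] primes_dvd_imp_eq[of p p'] by auto
    then have "p \<in> prime_factors d'" using that rough_pos[of p' d'] by (auto simp: in_prime_factors_iff)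
    then show False using that by (auto simp: rough_def)
  qed
  have inj: "inj_on (\<lambda>(p, d). p * d) ?S"
  proof (rule inj_onI, clarify)
    fix p d p' d' assume *: "p \<in> primes_in u v" "d \<in> rough_le p (y / real p)" "p' \<in> primes_in u v"
      "d' \<in> rough_le p' (y / real p')" "p * d = p' * d'"
    then have "p = p'" using no[of p p' d' d] no[of p' p d d'] by (cases p p' rule: linorder_cases) auto
    with * show "p = p' \<and> d = d'" using prime_gt_0_nat[of p] by auto
  qed
  have sub: "(\<lambda>(p, d). p * d) ` ?S \<subseteq> pos_le y"
  proof clarify
    fix p d assume "p \<in> primes_in u v" "d \<in> rough_le p (y / real p)"
    then have "p > 0" "d > 0" "real d \<le> y / real p" using prime_gt_0_nat rough_pos by auto
    then show "p * d \<in> pos_le y" by (simp add: field_simps)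
  qed
  have "(\<Sum>p\<in>primes_in u v. \<Sum>d\<in>rough_le p (y / real p). 1 + ln (y / real p / real d)) =
      (\<Sum>(p, d)\<in>?S. 1 + ln (y / real p / real d))"
    by (subst sum.Sigma) auto
  also have "\<dots> = (\<Sum>x\<in>?S. 1 + ln (y / real (case x of (p, d) \<Rightarrow> p * d)))"
    by (intro sum.cong) auto
  also have "\<dots> = (\<Sum>k\<in>(\<lambda>(p, d). p * d) ` ?S. 1 + ln (y / real k))"
    by (subst sum.reindex[OF inj]) simp
  also have "\<dots> \<le> 3 * y" using assms sub by (intro sum_one_plus_ln_le) auto
  finally show ?thesis .
qed

section \<open>Estimates over one interval of primes\<close>

definition C_rough :: real where "C_rough = 10 * exp 64 + 2"

lemma C_rough_pos: "C_rough > 0" by (simp add: C_rough_def add_pos_pos)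

lemma card_rough_prime_le:
  assumes "prime p" "z \<ge> 0"
  shows "real (card (rough_le p z)) \<le> (if z < 1 then 0 else C_rough * z / ln (real p) + 1)"
  using card_rough_le_bound'[of p z] assms prime_ge_2_nat[of p] by (auto simp: C_rough_def)

context mertens_weight
begin

text \<open>The main term is a sum of \<open>R0\<close> with the weights
  \<open>c p * ln p / p\<close>. In the error, ln p cancels the density 1 / ln p of p-rough
  integers, and the contribution of the integer 1 adds up to Chebyshev's function.\<close>

lemma sum_interval_ln_card_bound:
  assumes T: "2 \<le> T" "T \<le> u" "v \<le> T\<^sup>2" and y: "y > 0"
  shows "\<bar>\<Sum>p\<in>primes_in u v. c p * (ln (real p) * real (card (smooth_le p (y / real p))))\<bar> \<le>
    (2 * C_int * M + 62 * C_rough + 10) * y"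
proof -
  define w where "w = (\<lambda>p. real (card (smooth_le p (y / real p))) - y / real p * R0 p (y / real p))"
  have eq: "(\<Sum>p\<in>primes_in u v. c p * (ln (real p) * real (card (smooth_le p (y / real p))))) =
      y * (\<Sum>p\<in>primes_in u v. (c p * ln (real p)) / real p * R0 p (y / real p)) +
      (\<Sum>p\<in>primes_in u v. c p * ln (real p) * w p)"
    unfolding w_def sum_distrib_left sum.distrib[symmetric]
    by (intro sum.cong refl) (simp add: algebra_simps)
  have 1: "\<bar>\<Sum>p\<in>primes_in u v. (c p * ln (real p)) / real p * R0 p (y / real p)\<bar> \<le> C_int * (2 * M)"
    by (intro sum_interval_rough_R0_bound[OF T y] sum_c_ln_bound)
  have "\<bar>\<Sum>p\<in>primes_in u v. c p * ln (real p) * w p\<bar> \<le>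
      (\<Sum>p\<in>primes_in u v. C_rough * y * (1 / real p) + (if real p \<le> y then ln (real p) else 0))"
  proof (rule order_trans[OF sum_abs sum_mono])
    fix p assume p: "p \<in> primes_in u v"
    then have p': "prime p" "real p > 0" "ln (real p) > 0" using prime_gt_0_nat prime_gt_1_nat by auto
    have "\<bar>w p\<bar> \<le> real (card (rough_le p (y / real p)))"
      unfolding w_def using y by (intro card_smooth_le_approx) auto
    also have "\<dots> \<le> (if y / real p < 1 then 0 else C_rough * (y / real p) / ln (real p) + 1)"
      using p' y by (intro card_rough_prime_le) auto
    finally have w: "\<bar>w p\<bar> \<le> (if y / real p < 1 then 0 else C_rough * (y / real p) / ln (real p) + 1)" .
    have "\<bar>c p * ln (real p) * w p\<bar> = \<bar>c p\<bar> * (ln (real p) * \<bar>w p\<bar>)" using p' by (simp add: abs_mult)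
    also have "\<dots> \<le> 1 * (ln (real p) * (if y / real p < 1 then 0 else C_rough * (y / real p) / ln (real p) + 1))"
      using w p' abs_c_le[of p] by (intro mult_mono mult_left_mono) auto
    also have "\<dots> \<le> C_rough * y * (1 / real p) + (if real p \<le> y then ln (real p) else 0)"
      using p' y C_rough_pos by (auto simp: field_simps)
    finally show "\<bar>c p * ln (real p) * w p\<bar> \<le> C_rough * y * (1 / real p) + (if real p \<le> y then ln (real p) else 0)" .
  qed
  also have "\<dots> = C_rough * y * (\<Sum>p\<in>primes_in u v. 1 / real p) + (\<Sum>p | p \<in> primes_in u v \<and> real p \<le> y. ln (real p))"
    by (simp add: sum.distrib sum_distrib_left sum.inter_filter del: mem_primes_in)
  also have "\<dots> \<le> C_rough * y * 62 + 10 * y"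
    using y C_rough_pos sum_primes_in_ln_le[of u v y] psi_le[of y]
    by (intro add_mono mult_left_mono sum_primes_in_inverse_le[OF T]) auto
  finally have 2: "\<bar>\<Sum>p\<in>primes_in u v. c p * ln (real p) * w p\<bar> \<le> C_rough * y * 62 + 10 * y" .
  have "\<bar>y * (\<Sum>p\<in>primes_in u v. (c p * ln (real p)) / real p * R0 p (y / real p))\<bar> \<le> y * (C_int * (2 * M))"
    unfolding abs_mult using 1 y by (intro mult_mono) auto
  with 2 show ?thesis unfolding eq by (simp add: algebra_simps)
qed

text \<open>The main term is treated by \<open>sum_interval_rough_R1_bound\<close>; the Stirling
  errors of all p together cost \<open>3 * y\<close> because the products p d are distinct.\<close>

lemma sum_interval_U_bound:
  assumes T: "2 \<le> T" "T \<le> u" "v \<le> T\<^sup>2" and y: "y > 0"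
  shows "\<bar>\<Sum>p\<in>primes_in u v. c p * U p (y / real p)\<bar> \<le>
    (2 * exp 64 * ((300 + 240 * exp 64 + 40 * exp 67) * M) + 3) * y"
proof -
  define w where "w = (\<lambda>p. U p (y / real p) - y / real p * (R1 p (y / real p) - R0 p (y / real p)))"
  have eq: "(\<Sum>p\<in>primes_in u v. c p * U p (y / real p)) =
      y * (\<Sum>p\<in>primes_in u v. c p / real p * (R1 p (y / real p) - R0 p (y / real p))) +
      (\<Sum>p\<in>primes_in u v. c p * w p)"
    unfolding w_def sum_distrib_left sum.distrib[symmetric]
    by (intro sum.cong refl) (simp add: algebra_simps)
  have "\<bar>\<Sum>p\<in>primes_in u v. c p * w p\<bar> \<le>
      (\<Sum>p\<in>primes_in u v. \<Sum>d\<in>rough_le p (y / real p). 1 + ln (y / real p / real d))"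
  proof (rule order_trans[OF sum_abs sum_mono])
    fix p assume p: "p \<in> primes_in u v"
    have "\<bar>w p\<bar> \<le> (\<Sum>d\<in>rough_le p (y / real p). 1 + ln (y / real p / real d))"
      unfolding w_def using y by (intro U_approx) auto
    then show "\<bar>c p * w p\<bar> \<le> (\<Sum>d\<in>rough_le p (y / real p). 1 + ln (y / real p / real d))"
      unfolding abs_mult using abs_c_le[of p] by (meson abs_ge_zero mult_left_le_one_le order_trans)
  qed
  also have "\<dots> \<le> 3 * y" by (rule sum_primes_rough_one_plus_ln_le[OF y])
  finally have 2: "\<bar>\<Sum>p\<in>primes_in u v. c p * w p\<bar> \<le> 3 * y" .
  have "\<bar>y * (\<Sum>p\<in>primes_in u v. c p / real p * (R1 p (y / real p) - R0 p (y / real p)))\<bar> \<le>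
      y * (2 * exp 64 * ((300 + 240 * exp 64 + 40 * exp 67) * M))"
    unfolding abs_mult using y by (intro mult_mono sum_interval_rough_R1_bound[OF T]) auto
  with 2 show ?thesis unfolding eq by (simp add: algebra_simps)
qed

text \<open>Writing ln b as a sum of \<open>mangoldt r\<close> leads to smooth counts up to
  \<open>y / p / r\<close>. For fixed r the weights are only \<open>c p / p\<close>, but their sums
  gain 1 / ln T, which pays for the sum of \<open>mangoldt r / r\<close> over smooth r.\<close>

lemma sum_interval_smooth_ln_bound:
  assumes T: "2 \<le> T" "T \<le> u" "v \<le> T\<^sup>2" and y: "y > 0"
  shows "\<bar>\<Sum>p\<in>primes_in u v. c p * smooth_ln p (y / real p)\<bar> \<le>
    (200 * C_int * M + 62 * (50 * C_rough + 10)) * y"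
proof -
  define w where "w = (\<lambda>p r. real (card (smooth_le p (y / real p / real r))) - y / real p / real r * R0 p (y / real p / real r))"
  have eq: "(\<Sum>p\<in>primes_in u v. c p * smooth_ln p (y / real p)) =
      y * (\<Sum>p\<in>primes_in u v. \<Sum>r\<in>smooth_le p (y / real p). mangoldt r / real r * (c p / real p * R0 p (y / real r / real p))) +
      (\<Sum>p\<in>primes_in u v. \<Sum>r\<in>smooth_le p (y / real p). c p * mangoldt r * w p r)"
    unfolding w_def smooth_ln_eq sum_distrib_left sum.distrib[symmetric]
    by (intro sum.cong refl) (simp add: algebra_simps)
  have "(\<Sum>p\<in>primes_in u v. \<Sum>r\<in>smooth_le p (y / real p). mangoldt r / real r * (c p / real p * R0 p (y / real r / real p))) =
      (\<Sum>p\<in>primes_in u v. \<Sum>r | r \<in> smooth_le (T\<^sup>2) y \<and> smooth p r. mangoldt r / real r * (c p / real p * R0 p (y / real r / real p)))"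
  proof (rule sum.cong[OF refl], rule sum.mono_neutral_left)
    fix p assume "p \<in> primes_in u v"
    then have p: "p \<ge> 1" "p \<le> T\<^sup>2" using T prime_gt_0_nat[of p] by auto
    show "finite {r. r \<in> smooth_le (T\<^sup>2) y \<and> smooth p r}"
      by (rule finite_subset[OF _ finite_smooth_le[of "T\<^sup>2" y]]) auto
    have "y / real p \<le> y / 1" using p y by (intro divide_left_mono) auto
    then show "smooth_le p (y / real p) \<subseteq> {r. r \<in> smooth_le (T\<^sup>2) y \<and> smooth p r}"
      using smooth_mono[OF _ p(2)] by auto
    have "R0 p (y / real r / real p) = 0" if "smooth p r" "\<not> real r \<le> y / real p" for r
      using that p smooth_pos[of p r] by (intro R0_eq_0) (auto simp: field_simps)
    then show "\<forall>r\<in>{r. r \<in> smooth_le (T\<^sup>2) y \<and> smooth p r} - smooth_le p (y / real p).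
        mangoldt r / real r * (c p / real p * R0 p (y / real r / real p)) = 0" by auto
  qed
  also have "\<dots> = (\<Sum>r\<in>smooth_le (T\<^sup>2) y. \<Sum>p | p \<in> primes_in u v \<and> smooth p r. mangoldt r / real r * (c p / real p * R0 p (y / real r / real p)))"
    by (rule sum.swap_restrict) auto
  finally have eq2: "(\<Sum>p\<in>primes_in u v. \<Sum>r\<in>smooth_le p (y / real p). mangoldt r / real r * (c p / real p * R0 p (y / real r / real p))) =
      (\<Sum>r\<in>smooth_le (T\<^sup>2) y. mangoldt r / real r * (\<Sum>p | p \<in> primes_in u v \<and> smooth p r. c p / real p * R0 p (y / real r / real p)))"
    by (simp only: sum_distrib_left)
  have "\<bar>\<Sum>r\<in>smooth_le (T\<^sup>2) y. mangoldt r / real r * (\<Sum>p | p \<in> primes_in u v \<and> smooth p r. c p / real p * R0 p (y / real r / real p))\<bar>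
     \<le> (\<Sum>r\<in>smooth_le (T\<^sup>2) y. mangoldt r / real r * (C_int * (2 * M / ln (real T))))"
  proof (rule order_trans[OF sum_abs sum_mono])
    fix r assume r: "r \<in> smooth_le (T\<^sup>2) y"
    show "\<bar>mangoldt r / real r * (\<Sum>p | p \<in> primes_in u v \<and> smooth p r. c p / real p * R0 p (y / real r / real p))\<bar>
       \<le> mangoldt r / real r * (C_int * (2 * M / ln (real T)))"
    proof (cases "mangoldt r = (0 :: real)")
      case False
      then have "primepow r" by (auto simp: mangoldt_def split: if_splits)
      then obtain q a where q: "prime q" "a > 0" "r = q ^ a" by (auto simp: primepow_def)
      \<comment> \<open>A power of q is p-smooth exactly when q <= p, so r only raises the lower end
        of the interval.\<close>
      have set_eq: "{p. p \<in> primes_in u v \<and> smooth p r} = primes_in (max u q) v"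
        using q by (auto simp: smooth_prime_power)
      have bound: "\<bar>\<Sum>p\<in>primes_in (max u q) v. c p / real p * R0 p (y / real r / real p)\<bar> \<le> C_int * (2 * M / ln (real T))"
        using T y r smooth_pos by (intro sum_interval_rough_R0_bound[where T = T] sum_c_bound') auto
      show ?thesis
        unfolding abs_mult set_eq by (rule mult_mono[OF _ bound]) (simp_all add: mangoldt_nonneg)
    qed simp
  qed
  also have "\<dots> = (\<Sum>r\<in>smooth_le (T\<^sup>2) y. mangoldt r / real r) * (C_int * (2 * M / ln (real T)))"
    by (simp only: sum_distrib_right)
  also have "\<dots> \<le> (50 * ln (real (T\<^sup>2))) * (C_int * (2 * M / ln (real T)))"
    using two_le_square[OF T(1)] T M_ge_1 by (intro mult_right_mono sum_smooth_le_mangoldt_le) (auto simp: C_int_def)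
  also have "\<dots> = 200 * C_int * M" using T by (simp add: ln_realpow)
  finally have 1: "\<bar>\<Sum>p\<in>primes_in u v. \<Sum>r\<in>smooth_le p (y / real p). mangoldt r / real r * (c p / real p * R0 p (y / real r / real p))\<bar> \<le> 200 * C_int * M"
    unfolding eq2 .
  have "\<bar>\<Sum>p\<in>primes_in u v. \<Sum>r\<in>smooth_le p (y / real p). c p * mangoldt r * w p r\<bar> \<le>
      (\<Sum>p\<in>primes_in u v. (50 * C_rough + 10) * y * (1 / real p))"
  proof (rule order_trans[OF sum_abs sum_mono])
    fix p assume p: "p \<in> primes_in u v"
    then have p': "prime p" "p \<ge> 2" "ln (real p) > 0" using prime_gt_1_nat[of p] by auto
    have "\<bar>\<Sum>r\<in>smooth_le p (y / real p). c p * mangoldt r * w p r\<bar> \<le>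
        (\<Sum>r\<in>smooth_le p (y / real p). mangoldt r / real r * (C_rough * (y / real p) / ln (real p)) + mangoldt r)"
    proof (rule order_trans[OF sum_abs sum_mono])
      fix r assume r: "r \<in> smooth_le p (y / real p)"
      have "\<bar>w p r\<bar> \<le> real (card (rough_le p (y / real p / real r)))"
        unfolding w_def using y by (intro card_smooth_le_approx) auto
      also have "\<dots> \<le> C_rough * (y / real p / real r) / ln (real p) + 1"
        unfolding C_rough_def using p' y by (intro card_rough_le_bound') auto
      finally have "\<bar>w p r\<bar> \<le> C_rough * (y / real p / real r) / ln (real p) + 1" .
      then have "\<bar>c p * mangoldt r\<bar> * \<bar>w p r\<bar> \<le> mangoldt r * (C_rough * (y / real p / real r) / ln (real p) + 1)"
        using abs_c_le[of p] by (intro mult_mono) (auto simp: abs_mult mangoldt_nonneg mult_left_le_one_le)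
      then show "\<bar>c p * mangoldt r * w p r\<bar> \<le> mangoldt r / real r * (C_rough * (y / real p) / ln (real p)) + mangoldt r"
        by (simp add: abs_mult algebra_simps)
    qed
    also have "\<dots> = (\<Sum>r\<in>smooth_le p (y / real p). mangoldt r / real r) * (C_rough * (y / real p) / ln (real p)) +
        (\<Sum>r\<in>smooth_le p (y / real p). mangoldt r)"
      by (simp only: sum.distrib sum_distrib_right)
    also have "\<dots> \<le> (50 * ln (real p)) * (C_rough * (y / real p) / ln (real p)) + 10 * (y / real p)"
    proof (intro add_mono mult_right_mono)
      show "(\<Sum>r\<in>smooth_le p (y / real p). mangoldt r / real r) \<le> 50 * ln (real p)"
        using p' by (intro sum_smooth_le_mangoldt_le)
      have "(\<Sum>r\<in>smooth_le p (y / real p). mangoldt r) \<le> psi (y / real p)"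
        unfolding psi_def smooth_le_def by (intro sum_mono2) (auto simp: mangoldt_nonneg)
      also have "\<dots> \<le> 10 * (y / real p)" using y by (intro psi_le) auto
      finally show "(\<Sum>r\<in>smooth_le p (y / real p). mangoldt r) \<le> 10 * (y / real p)" .
    qed (use y p' C_rough_pos in auto)
    also have "\<dots> = (50 * C_rough + 10) * y * (1 / real p)" using p' by (simp add: field_simps)
    finally show "\<bar>\<Sum>r\<in>smooth_le p (y / real p). c p * mangoldt r * w p r\<bar> \<le> (50 * C_rough + 10) * y * (1 / real p)" .
  qed
  also have "\<dots> = (50 * C_rough + 10) * y * (\<Sum>p\<in>primes_in u v. 1 / real p)"
    by (simp only: sum_distrib_left)
  also have "\<dots> \<le> (50 * C_rough + 10) * y * 62"
    using y C_rough_pos by (intro mult_left_mono sum_primes_in_inverse_le[OF T]) auto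
  finally have 2: "\<bar>\<Sum>p\<in>primes_in u v. \<Sum>r\<in>smooth_le p (y / real p). c p * mangoldt r * w p r\<bar> \<le> (50 * C_rough + 10) * y * 62" .
  have "\<bar>y * (\<Sum>p\<in>primes_in u v. \<Sum>r\<in>smooth_le p (y / real p). mangoldt r / real r * (c p / real p * R0 p (y / real r / real p)))\<bar> \<le>
      y * (200 * C_int * M)"
    unfolding abs_mult using y 1 by (intro mult_mono) auto
  with 2 show ?thesis unfolding eq by (simp add: algebra_simps)
qed

end

section \<open>The largest prime factor\<close>

text \<open>For n <= 1 the set is empty and the value unspecified, hence the assumptions n > 1 and
  the removal of 1 from summation sets below.\<close>

abbreviation lpf :: "nat \<Rightarrow> nat" where "lpf n \<equiv> Max (prime_factors n)"

lemma prime_factors_nonempty: "n > 1 \<Longrightarrow> prime_factors n \<noteq> {}" for n :: nat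
  by (auto simp: prime_factorization_empty_iff)

lemma lpf_in: "n > 1 \<Longrightarrow> lpf n \<in> prime_factors n"
  using prime_factors_nonempty by (intro Max_in) auto

lemma prime_lpf: "n > 1 \<Longrightarrow> prime (lpf n)"
  using lpf_in[of n] by (auto simp: in_prime_factors_iff)

lemma smooth_iff_lpf_le: "n > 1 \<Longrightarrow> smooth t n \<longleftrightarrow> lpf n \<le> t"
  using prime_factors_nonempty[of n] by (auto simp: smooth_def)

lemma lpf_prime_mult:
  assumes "prime p" "smooth p b"
  shows "lpf (p * b) = p"
proof (rule Max_eqI)
  show "p \<in> prime_factors (p * b)" using assms smooth_pos[of p b]
    by (auto simp: in_prime_factors_iff prime_gt_0_nat)
  fix q assume "q \<in> prime_factors (p * b)"
  moreover have "smooth p (p * b)"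
    using assms smooth_prime_power[of p 1 p] by (simp add: smooth_mult_iff)
  ultimately show "q \<le> p" by (auto simp: smooth_def)
qed auto

lemma smooth_lpf: "n > 0 \<Longrightarrow> smooth (lpf n) n"
  by (auto simp: smooth_def)

text \<open>Every m > 1 is uniquely p b with p its largest prime and b p-smooth; b may again be
  divisible by p.\<close>

lemma sum_by_largest_prime:
  "(\<Sum>m\<in>smooth_le w y - {1}. g m) = (\<Sum>p\<in>primes_in 2 w. \<Sum>b\<in>smooth_le p (y / real p). g (p * b))"
proof -
  have "(\<Sum>p\<in>primes_in 2 w. \<Sum>b\<in>smooth_le p (y / real p). g (p * b)) =
      (\<Sum>(p, b)\<in>Sigma (primes_in 2 w) (\<lambda>p. smooth_le p (y / real p)). g (p * b))"
    by (subst sum.Sigma) auto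
  also have "\<dots> = (\<Sum>m\<in>smooth_le w y - {1}. g m)"
  proof (rule sum.reindex_bij_witness[where i = "\<lambda>m. (lpf m, m div lpf m)" and j = "\<lambda>(p, b). p * b"])
    fix x assume "x \<in> Sigma (primes_in 2 w) (\<lambda>p. smooth_le p (y / real p))"
    then obtain p b where x: "x = (p, b)" and p: "prime p" "p \<le> w" "p \<ge> 2" and b: "smooth p b" "real b \<le> y / real p"
      by auto
    have l: "lpf (p * b) = p" by (rule lpf_prime_mult[OF p(1) b(1)])
    show "(lpf (case x of (p, b) \<Rightarrow> p * b), (case x of (p, b) \<Rightarrow> p * b) div lpf (case x of (p, b) \<Rightarrow> p * b)) = x"
      unfolding x prod.case l using p by simp
    have "smooth w (p * b)" using p b smooth_mono[of p b w] smooth_prime_power[of p 1 w] by (simp add: smooth_mult_iff)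
    moreover have "real (p * b) \<le> y" using b p by (simp add: field_simps)
    moreover have "p * b \<noteq> 1" using p by auto
    ultimately show "(case x of (p, b) \<Rightarrow> p * b) \<in> smooth_le w y - {1}" unfolding x by simp
    show "g (case x of (p, b) \<Rightarrow> p * b) = (case x of (p, b) \<Rightarrow> g (p * b))" unfolding x by simp
  next
    fix m assume m: "m \<in> smooth_le w y - {1}"
    then have m1: "m > 1" using smooth_pos[of w m] by auto
    have lp: "prime (lpf m)" "lpf m dvd m" using lpf_in[OF m1] by (auto simp: in_prime_factors_iff)
    show "(case (lpf m, m div lpf m) of (p, b) \<Rightarrow> p * b) = m" using lp by simp
    have "lpf m \<le> w" using m m1 smooth_iff_lpf_le by auto
    moreover have "smooth (lpf m) (m div lpf m)"
      using smooth_dvd[OF smooth_lpf, of m "m div lpf m"] m1 lp by (auto simp: div_dvd_iff_mult)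
    moreover have "real (m div lpf m) \<le> y / real (lpf m)"
      using lp m prime_gt_0_nat[of "lpf m"] by (auto simp: real_of_nat_div divide_right_mono)
    ultimately show "(lpf m, m div lpf m) \<in> Sigma (primes_in 2 w) (\<lambda>p. smooth_le p (y / real p))"
      using lp prime_ge_2_nat by auto
  qed
  finally show ?thesis ..
qed

lemma nat_floor_less_power:
  fixes y :: real
  assumes "y < 2 ^ 2 ^ K"
  shows "nat \<lfloor>y\<rfloor> < 2 ^ 2 ^ K"
proof (cases "y < 0")
  case False
  then have "real (nat \<lfloor>y\<rfloor>) \<le> y" by simp
  with assms have "real (nat \<lfloor>y\<rfloor>) < 2 ^ 2 ^ K" by linarith
  then have "real (nat \<lfloor>y\<rfloor>) < real (2 ^ 2 ^ K)" by (simp only: of_nat_power of_nat_numeral)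
  then show ?thesis by (simp only: of_nat_less_iff)
qed simp

section \<open>Sums weighted at the largest prime factor\<close>

context mertens_weight
begin

text \<open>\<open>K1\<close> arises when the logarithm sits on a prime power s whose prime is above
  those of m, and \<open>K2\<close> when it sits on m itself.\<close>

definition K1 :: "nat \<Rightarrow> real \<Rightarrow> real" where
  "K1 w y = (\<Sum>m\<in>smooth_le w y - {1}. c (lpf m) * (\<Sum>s\<in>rough_le (lpf m) (y / real m). mangoldt s))"

definition K2 :: "nat \<Rightarrow> real \<Rightarrow> real" where
  "K2 w y = (\<Sum>m\<in>smooth_le w y - {1}. c (lpf m) * ln (real m))"

lemma K1_eq: "K1 w y = (\<Sum>p\<in>primes_in 2 w. c p * (U p (y / real p) - smooth_ln p (y / real p)))"
  unfolding K1_def sum_by_largest_prime sum_smooth_le_rough_mangoldt[symmetric] sum_distrib_left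
proof (rule sum.cong[OF refl], rule sum.cong[OF refl])
  fix p b assume *: "p \<in> primes_in 2 w" "b \<in> smooth_le p (y / real p)"
  then have "lpf (p * b) = p" by (intro lpf_prime_mult) auto
  then show "(\<Sum>s\<in>rough_le (lpf (p * b)) (y / real (p * b)). c (lpf (p * b)) * mangoldt s) =
      (\<Sum>s\<in>rough_le p (y / real p / real b). c p * mangoldt s)"
    by simp
qed

lemma K2_eq: "K2 w y = (\<Sum>p\<in>primes_in 2 w. c p * (ln (real p) * real (card (smooth_le p (y / real p))))) +
    (\<Sum>p\<in>primes_in 2 w. c p * smooth_ln p (y / real p))"
  unfolding K2_def sum_by_largest_prime sum.distrib[symmetric]
proof (intro sum.cong refl)
  fix p assume p: "p \<in> primes_in 2 w"
  have "(\<Sum>b\<in>smooth_le p (y / real p). c (lpf (p * b)) * ln (real (p * b))) =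
      (\<Sum>b\<in>smooth_le p (y / real p). c p * ln (real p) + c p * ln (real b))"
  proof (intro sum.cong refl)
    fix b assume b: "b \<in> smooth_le p (y / real p)"
    then have "lpf (p * b) = p" using p by (intro lpf_prime_mult) auto
    moreover have "p > 0" "b > 0" using p b smooth_pos by auto
    ultimately show "c (lpf (p * b)) * ln (real (p * b)) = c p * ln (real p) + c p * ln (real b)"
      by (simp add: ln_mult distrib_left)
  qed
  also have "\<dots> = c p * (ln (real p) * real (card (smooth_le p (y / real p)))) + c p * smooth_ln p (y / real p)"
    by (simp add: sum.distrib smooth_ln_def sum_distrib_left)
  finally show "(\<Sum>b\<in>smooth_le p (y / real p). c (lpf (p * b)) * ln (real (p * b))) =
      c p * (ln (real p) * real (card (smooth_le p (y / real p)))) + c p * smooth_ln p (y / real p)" .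
qed

text \<open>Terms with p > y vanish, so the number of intervals is governed by y, whatever w
  is.\<close>

lemma sum_primes_truncate:
  assumes "\<And>p. prime p \<Longrightarrow> y / real p < 1 \<Longrightarrow> f p = (0 :: real)"
  shows "(\<Sum>p\<in>primes_in 2 w. f p) = (\<Sum>p\<in>primes_in 2 (min w (nat \<lfloor>y\<rfloor>)). f p)"
proof -
  have "f p = 0" if "prime p" "\<not> real p \<le> y" for p
    using assms[OF that(1)] that prime_gt_0_nat[OF that(1)] by (simp add: field_simps)
  then show ?thesis
    unfolding primes_in_le_real[symmetric] by (intro sum.mono_neutral_right) auto
qed

text \<open>Uniformity in w matters because w will be \<open>fst r2 - 1\<close>, where
  \<open>r2\<close> is a summation variable.\<close>

lemma K1_K2_bound:
  "\<exists>C\<ge>0. \<forall>K w y. 0 < y \<and> y < 2 ^ 2 ^ K \<longrightarrow> \<bar>K1 w y\<bar> \<le> C * real K * y \<and> \<bar>K2 w y\<bar> \<le> C * real K * y"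
proof -
  define Ca where "Ca = 2 * C_int * M + 62 * C_rough + 10"
  define Cb where "Cb = 200 * C_int * M + 62 * (50 * C_rough + 10)"
  define Cc where "Cc = 2 * exp 64 * ((300 + 240 * exp 64 + 40 * exp 67) * M) + 3"
  have nonneg: "Ca \<ge> 0" "Cb \<ge> 0" "Cc \<ge> 0"
    using C_rough_pos M_ge_1 by (auto simp: Ca_def Cb_def Cc_def C_int_def intro!: add_nonneg_nonneg)
  show ?thesis
  proof (intro exI[of _ "Ca + Cb + Cc"] conjI allI impI)
    show "0 \<le> Ca + Cb + Cc" using nonneg by simp
  next
    fix K w and y :: real assume y: "0 < y \<and> y < 2 ^ 2 ^ K"
    define v where "v = min w (nat \<lfloor>y\<rfloor>)"
    have v: "v < 2 ^ 2 ^ K" using nat_floor_less_power[of y K] y unfolding v_def min_less_iff_disj by blast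
    have a: "\<bar>\<Sum>p\<in>primes_in 2 v. c p * (ln (real p) * real (card (smooth_le p (y / real p))))\<bar> \<le> real K * (Ca * y)"
      unfolding Ca_def using y by (intro sum_primes_in_dyadic_le[OF _ v] sum_interval_ln_card_bound) auto
    have b: "\<bar>\<Sum>p\<in>primes_in 2 v. c p * smooth_ln p (y / real p)\<bar> \<le> real K * (Cb * y)"
      unfolding Cb_def using y by (intro sum_primes_in_dyadic_le[OF _ v] sum_interval_smooth_ln_bound) auto
    have c: "\<bar>\<Sum>p\<in>primes_in 2 v. c p * U p (y / real p)\<bar> \<le> real K * (Cc * y)"
      unfolding Cc_def using y by (intro sum_primes_in_dyadic_le[OF _ v] sum_interval_U_bound) auto
    have "K1 w y = (\<Sum>p\<in>primes_in 2 v. c p * (U p (y / real p) - smooth_ln p (y / real p)))"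
      unfolding K1_eq v_def by (rule sum_primes_truncate) (simp add: U_def smooth_ln_def)
    also have "\<dots> = (\<Sum>p\<in>primes_in 2 v. c p * U p (y / real p)) - (\<Sum>p\<in>primes_in 2 v. c p * smooth_ln p (y / real p))"
      by (simp add: right_diff_distrib sum_subtractf)
    finally have 1: "\<bar>K1 w y\<bar> \<le> real K * (Cc * y) + real K * (Cb * y)" using b c by linarith
    have "K2 w y = (\<Sum>p\<in>primes_in 2 v. c p * (ln (real p) * real (card (smooth_le p (y / real p))))) +
        (\<Sum>p\<in>primes_in 2 v. c p * smooth_ln p (y / real p))"
      unfolding K2_eq v_def by (intro arg_cong2[of _ _ _ _ "(+)"] sum_primes_truncate) (simp_all add: smooth_ln_def)
    then have 2: "\<bar>K2 w y\<bar> \<le> real K * (Ca * y) + real K * (Cb * y)" using a b by linarith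
    have "0 \<le> real K * (Ca * y)" "0 \<le> real K * (Cb * y)" "0 \<le> real K * (Cc * y)" using nonneg y by auto
    with 1 2 show "\<bar>K1 w y\<bar> \<le> (Ca + Cb + Cc) * real K * y" "\<bar>K2 w y\<bar> \<le> (Ca + Cb + Cc) * real K * y"
      by (simp_all add: algebra_simps)
  qed
qed

end

section \<open>The third largest prime factor\<close>

lemma prime_factors_prime_power_mult:
  fixes q m :: nat
  assumes "prime q" "a > 0" "m > 0"
  shows "prime_factors (q ^ a * m) = insert q (prime_factors m)"
proof -
  have "q ^ a \<noteq> 0" "m \<noteq> 0" using assms by auto
  then have "prime_factors (q ^ a * m) = prime_factors (q ^ a) \<union> prime_factors m"
    by (rule prime_factors_product)
  also have "prime_factors (q ^ a) = {q}"
    using assms by (simp add: prime_factors_power prime_prime_factors)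
  finally show ?thesis by simp
qed

lemma lpf_prime_power_mult:
  assumes "prime q" "a > 0" "smooth (q - 1) m"
  shows "lpf (q ^ a * m) = q"
proof -
  have "m > 0" using assms smooth_pos by blast
  moreover have "p \<le> q" if "p \<in> prime_factors m" for p using that assms(3) by (fastforce simp: smooth_def)
  ultimately show ?thesis
    unfolding prime_factors_prime_power_mult[OF assms(1,2) \<open>m > 0\<close>] by (intro Max_eqI) auto
qed

lemma prime_power_smooth_decomp_exists:
  assumes "n > 1"
  shows "\<exists>a m. a > 0 \<and> smooth (lpf n - 1) m \<and> n = lpf n ^ a * m"
proof -
  define q where "q = lpf n"
  have q: "prime q" "q dvd n" "q > 0" using lpf_in[OF assms] by (auto simp: q_def in_prime_factors_iff prime_gt_0_nat)
  \<comment> \<open>At the threshold q - 1, with q the largest prime, the rough part b can contain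
    no prime but q.\<close>
  obtain m b where mb: "smooth (q - 1) m" "rough (q - 1) b" "n = m * b"
    using ex_smooth_rough_decomp[of n "q - 1"] assms by auto
  have b0: "b > 0" and m0: "m > 0" using mb rough_pos smooth_pos by auto
  have "\<not> q dvd m"
  proof
    assume "q dvd m"
    then have "q \<in> prime_factors m" using q m0 by (auto simp: in_prime_factors_iff)
    then have "q \<le> q - 1" using mb(1) unfolding smooth_def by blast
    with q show False by simp
  qed
  then have "q dvd b" using q mb(3) by (simp add: prime_dvd_mult_iff)
  have "prime_factors b = {q}"
  proof
    show "prime_factors b \<subseteq> {q}"
    proof
      fix p assume p: "p \<in> prime_factors b"
      then have "p > q - 1" using mb(2) by (auto simp: rough_def)
      moreover have "p \<in> prime_factors n" using p mb b0 m0 by (auto simp: in_prime_factors_iff)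
      then have "p \<le> q" unfolding q_def by (intro Max_ge) auto
      ultimately show "p \<in> {q}" by simp
    qed
    show "{q} \<subseteq> prime_factors b" using q \<open>q dvd b\<close> b0 by (auto simp: in_prime_factors_iff)
  qed
  then have "b = q ^ multiplicity q b" using prime_factorization_nat[of b] b0 by simp
  moreover have "multiplicity q b > 0" using \<open>q dvd b\<close> b0 q by (simp add: prime_multiplicity_gt_zero_iff)
  ultimately show ?thesis using mb unfolding q_def[symmetric]
    by (intro exI[of _ "multiplicity q b"] exI[of _ m]) (simp add: mult.commute)
qed

lemma le_of_mult_le':
  fixes r m :: nat
  assumes "real (r * m) \<le> z" "z \<le> x" "r > 0" "m > 0"
  shows "real r \<le> x" "real m \<le> x"
proof -
  have "r \<le> r * m" "m \<le> r * m" using assms by auto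
  then have "real r \<le> real (r * m)" "real m \<le> real (r * m)" by (simp_all only: of_nat_le_iff)
  with assms show "real r \<le> x" "real m \<le> x" by linarith+
qed

text \<open>Here the full power of the largest prime is removed, so the primes of m are strictly
  smaller. The ranges are boxes depending on x only, with all conditions moved into the summand, so
  that the sums can later be exchanged freely.\<close>

lemma sum_by_largest_prime_power:
  assumes "z \<le> x"
  shows "(\<Sum>n\<in>smooth_le w z - {1}. f n) =
    (\<Sum>(q, a)\<in>ppow_le x. \<Sum>m\<in>pos_le x.
       if q \<le> w \<and> smooth (q - 1) m \<and> real (q ^ a * m) \<le> z then f (q ^ a * m) else (0 :: real))"
proof -
  let ?h = "\<lambda>u :: (nat \<times> nat) \<times> nat. fst (fst u) ^ snd (fst u) * snd u"
  let ?S = "{u \<in> ppow_le x \<times> pos_le x. fst (fst u) \<le> w \<and> smooth (fst (fst u) - 1) (snd u) \<and> real (?h u) \<le> z}"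
  have "(\<Sum>(q, a)\<in>ppow_le x. \<Sum>m\<in>pos_le x.
       if q \<le> w \<and> smooth (q - 1) m \<and> real (q ^ a * m) \<le> z then f (q ^ a * m) else 0) =
     (\<Sum>u\<in>ppow_le x \<times> pos_le x. if fst (fst u) \<le> w \<and> smooth (fst (fst u) - 1) (snd u) \<and> real (?h u) \<le> z
        then f (?h u) else 0)"
    unfolding sum.cartesian_product[symmetric] case_prod_unfold
    by (simp only: sum.cartesian_product case_prod_unfold)
  also have "\<dots> = (\<Sum>u\<in>?S. f (?h u))"
    by (rule sum.inter_filter[symmetric]) auto
  also have "\<dots> = (\<Sum>n\<in>smooth_le w z - {1}. f n)"
  proof (rule sum.reindex_bij_betw)
    show "bij_betw ?h ?S (smooth_le w z - {1})"
      unfolding bij_betw_def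
    proof (intro conjI subset_antisym subsetI)
      show "inj_on ?h ?S"
      proof (rule inj_onI)
        fix u u' assume u: "u \<in> ?S" "u' \<in> ?S" "?h u = ?h u'"
        obtain q a m q' a' m' where eqs: "u = ((q, a), m)" "u' = ((q', a'), m')" by (metis prod.exhaust)
        have *: "(q, a) \<in> ppow_le x" "(q', a') \<in> ppow_le x" "smooth (q - 1) m" "smooth (q' - 1) m'"
          "q ^ a * m = q' ^ a' * m'"
          using u unfolding eqs by auto
        then have pr: "prime q" "a > 0" "prime q'" "a' > 0" by auto
        have qq: "q = q'" using lpf_prime_power_mult[of q a m] lpf_prime_power_mult[of q' a' m'] * pr by simp
        have "rough (q - 1) (q ^ a)" "rough (q - 1) (q ^ a')"
          using pr prime_gt_0_nat[of q] by (simp_all add: rough_prime_power)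
        then have "m = m'" "q ^ a = q ^ a'"
          using smooth_rough_decomp_unique[of "q - 1" m "q ^ a" m' "q ^ a'"] * qq by (simp_all add: mult.commute)
        then show "u = u'" unfolding eqs using qq pr prime_gt_1_nat[of q] by (simp add: power_inject_exp)
      qed
    next
      fix n assume "n \<in> ?h ` ?S"
      then obtain q a m where n: "n = q ^ a * m" "prime q" "a > 0" "q \<le> w" "smooth (q - 1) m" "real (q ^ a * m) \<le> z"
        by auto
      have "smooth w n" unfolding n(1) smooth_mult_iff
        using n smooth_mono[of "q - 1" m w] by (simp add: smooth_prime_power)
      moreover have "n \<noteq> 1" using n prime_gt_1_nat[of q] by simp
      ultimately show "n \<in> smooth_le w z - {1}" using n by simp
    next
      fix n assume n: "n \<in> smooth_le w z - {1}"
      then have n1: "n > 1" using smooth_pos[of w n] by auto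
      define q where "q = lpf n"
      obtain a m where am: "a > 0" "smooth (q - 1) m" "q ^ a * m = n"
        using prime_power_smooth_decomp_exists[OF n1] unfolding q_def by metis
      have q: "prime q" "q > 0" using prime_lpf[OF n1] prime_gt_0_nat unfolding q_def by auto
      have le: "real (q ^ a * m) \<le> z" using am(3) n by simp
      then have "real (q ^ a) \<le> x" "real m \<le> x"
        using le_of_mult_le'[of "q ^ a" m z x] q smooth_pos[OF am(2)] assms by auto
      moreover have "q \<le> w" using n n1 smooth_iff_lpf_le unfolding q_def by auto
      ultimately have "((q, a), m) \<in> ?S"
        using am(1,2) q le smooth_pos[OF am(2)] by simp
      then show "n \<in> ?h ` ?S"
        using am(3) by (intro image_eqI[of _ _ "((q, a), m)"]) auto
    qed
  qed
  finally show ?thesis ..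
qed

lemma pos_le_eq_smooth_le: "pos_le x = smooth_le (nat \<lfloor>x\<rfloor>) x"
proof (intro equalityI subsetI)
  fix n assume n: "n \<in> pos_le x"
  have "n \<le> nat \<lfloor>x\<rfloor>" using n by (intro le_nat_floor) auto
  moreover have "p \<le> n" if "p \<in> prime_factors n" for p
    using that n by (auto simp: in_prime_factors_iff intro: dvd_imp_le)
  ultimately show "n \<in> smooth_le (nat \<lfloor>x\<rfloor>) x" using n by (fastforce simp: smooth_def)
qed (auto simp: smooth_pos)

lemma sum_by_largest_prime_power_all:
  "(\<Sum>n\<in>pos_le x - {1}. f n) =
    (\<Sum>(q, a)\<in>ppow_le x. \<Sum>m\<in>pos_le x.
       if smooth (q - 1) m \<and> real (q ^ a * m) \<le> x then f (q ^ a * m) else (0 :: real))"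
proof -
  have "q \<le> nat \<lfloor>x\<rfloor>" if "(q, a) \<in> ppow_le x" for q a
    using subsetD[OF ppow_le_subset that] by (intro le_nat_floor) auto
  then show ?thesis
    unfolding pos_le_eq_smooth_le[of x] sum_by_largest_prime_power[OF order_refl]
    by (intro sum.cong refl) (auto simp: pos_le_eq_smooth_le[symmetric])
qed

section \<open>Reading off \<open>P3\<close> from a factorization\<close>

lemma sorted_list_of_set_insert_greatest:
  assumes "finite A" "\<And>y. y \<in> A \<Longrightarrow> y < x"
  shows "sorted_list_of_set (insert x A) = sorted_list_of_set A @ [x :: nat]"
proof (rule sorted_distinct_set_unique)
  show "sorted (sorted_list_of_set A @ [x])" using assms by (auto simp: sorted_append less_imp_le)
  show "distinct (sorted_list_of_set A @ [x])" using assms by auto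
  show "sorted (sorted_list_of_set (insert x A))" "distinct (sorted_list_of_set (insert x A))"
    by (rule sorted_sorted_list_of_set, rule distinct_sorted_list_of_set)
  have "set (sorted_list_of_set (insert x A)) = insert x A"
    using assms by (intro set_sorted_list_of_set) auto
  then show "set (sorted_list_of_set (insert x A)) = set (sorted_list_of_set A @ [x])"
    using assms by (simp only: set_append set_sorted_list_of_set) auto
qed

lemma last_sorted_list_of_set:
  assumes "finite A" "A \<noteq> {}"
  shows "last (sorted_list_of_set A) = Max (A :: nat set)"
proof -
  let ?l = "sorted_list_of_set A"
  have l: "?l = butlast ?l @ [last ?l]" using assms by (intro append_butlast_last_id[symmetric]) simp
  have A: "A = insert (last ?l) (set (butlast ?l))"
    using arg_cong[OF l, of set] assms(1) by simp
  have "sorted (butlast ?l @ [last ?l])" using l sorted_sorted_list_of_set[of A] by metis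
  then have "y \<le> last ?l" if "y \<in> set (butlast ?l)" for y using that by (simp only: sorted_append) auto
  moreover have "y = last ?l \<or> y \<in> set (butlast ?l)" if "y \<in> A" for y using that by (subst (asm) A) simp
  ultimately have "y \<le> last ?l" if "y \<in> A" for y using that by (metis order_refl)
  moreover have "last ?l \<in> A" using last_in_set[of ?l] assms by simp
  ultimately have "Max A = last ?l" using assms by (intro Max_eqI) auto
  then show ?thesis ..
qed

text \<open>q2 and q1 are appended to the sorted list of the prime factors of m, so entry 2 of the
  reversed list is the last entry for m.\<close>

lemma P3_decomp:
  assumes q1: "prime q1" "a1 > 0" and q2: "prime q2" "a2 > 0" "q2 < q1"
    and m: "smooth (q2 - 1) m" "m > 1"
  shows "card (prime_factors (q1 ^ a1 * (q2 ^ a2 * m))) \<ge> 3" "P3 (q1 ^ a1 * (q2 ^ a2 * m)) = lpf m"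
proof -
  let ?F = "prime_factors m"
  have pf: "prime_factors (q1 ^ a1 * (q2 ^ a2 * m)) = insert q1 (insert q2 ?F)"
    using assms prime_gt_0_nat by (simp add: prime_factors_prime_power_mult)
  have lt: "y < q2" if "y \<in> ?F" for y
    using that m prime_gt_0_nat[OF q2(1)] by (fastforce simp: smooth_def)
  have l1: "sorted_list_of_set (insert q2 ?F) = sorted_list_of_set ?F @ [q2]"
    by (rule sorted_list_of_set_insert_greatest) (auto intro: lt)
  have l: "sorted_list_of_set (insert q1 (insert q2 ?F)) = sorted_list_of_set ?F @ [q2, q1]"
    by (subst sorted_list_of_set_insert_greatest) (use lt q2 l1 in \<open>auto intro: less_trans\<close>)
  have ne: "?F \<noteq> {}" using m by (intro prime_factors_nonempty)
  have "card (insert q1 (insert q2 ?F)) = Suc (Suc (card ?F))"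
  proof -
    have "q2 \<notin> ?F" using lt[of q2] by auto
    moreover have "q1 \<notin> insert q2 ?F" using lt[of q1] q2 by auto
    ultimately show ?thesis by (simp add: card_insert_disjoint)
  qed
  moreover have "card ?F \<ge> 1" using ne by (simp add: Suc_le_eq card_gt_0_iff)
  ultimately show c3: "card (prime_factors (q1 ^ a1 * (q2 ^ a2 * m))) \<ge> 3" unfolding pf by simp
  have ne': "sorted_list_of_set ?F \<noteq> []" using ne by simp
  have "P3 (q1 ^ a1 * (q2 ^ a2 * m)) = rev (sorted_list_of_set ?F) ! 0"
    using c3 unfolding P3_def pf l by simp
  also have "\<dots> = last (sorted_list_of_set ?F)" using ne' by (simp add: hd_conv_nth[symmetric] hd_rev)
  also have "\<dots> = lpf m"
    using ne by (intro last_sorted_list_of_set) auto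
  finally show "P3 (q1 ^ a1 * (q2 ^ a2 * m)) = lpf m" .
qed

text \<open>124 is 2 times 62: the geometric series over the exponents is at most 2 / q, and each of
  the K intervals of primes contributes 62.\<close>

lemma sum_inverse_ppow_le:
  assumes "x < 2 ^ 2 ^ K"
  shows "(\<Sum>(q, a)\<in>ppow_le x. 1 / real q ^ a) \<le> 124 * real K"
proof -
  have "(\<Sum>(q, a)\<in>ppow_le x. 1 / real q ^ a) \<le> (\<Sum>q | q \<in> pos_le x \<and> prime q. \<Sum>a=1..nat \<lfloor>x\<rfloor>. 1 / real q ^ a)"
    by (rule sum_ppow_le_le) auto
  also have "\<dots> \<le> (\<Sum>q | q \<in> pos_le x \<and> prime q. 2 * (1 / real q))"
  proof (intro sum_mono)
    fix q assume "q \<in> {q. q \<in> pos_le x \<and> prime q}"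
    then have q: "real q \<ge> 2" using prime_ge_2_nat by auto
    have "(\<Sum>a=1..nat \<lfloor>x\<rfloor>. 1 / real q ^ a) \<le> 1 / (real q - 1)" using q by (intro sum_inverse_power_le) auto
    also have "\<dots> \<le> 2 * (1 / real q)" using q by (simp add: field_simps)
    finally show "(\<Sum>a=1..nat \<lfloor>x\<rfloor>. 1 / real q ^ a) \<le> 2 * (1 / real q)" .
  qed
  also have "\<dots> = 2 * (\<Sum>q\<in>primes_in 2 (nat \<lfloor>x\<rfloor>). 1 / real q)"
  proof -
    have "{q. q \<in> pos_le x \<and> prime q} = primes_in 2 (nat \<lfloor>x\<rfloor>)"
      unfolding pos_le_altdef by (auto dest: prime_ge_2_nat)
    then show ?thesis by (simp only: sum_distrib_left)
  qed
  also have "(\<Sum>q\<in>primes_in 2 (nat \<lfloor>x\<rfloor>). 1 / real q) \<le> real K * 62"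
  proof -
    have "\<bar>\<Sum>q\<in>primes_in 2 (nat \<lfloor>x\<rfloor>). 1 / real q\<bar> \<le> real K * 62"
    proof (rule sum_primes_in_dyadic_le[OF _ nat_floor_less_power[OF assms]])
      fix T u v :: nat assume "2 \<le> T" "T \<le> u" "v \<le> T\<^sup>2"
      then show "\<bar>\<Sum>q\<in>primes_in u v. 1 / real q\<bar> \<le> 62"
        using sum_primes_in_inverse_le[of T u v] sum_nonneg[of "primes_in u v" "\<lambda>q. 1 / real q"] by simp
    qed
    then show ?thesis by linarith
  qed
  finally show ?thesis by simp
qed

lemma inverse_square_prime_le:
  assumes "prime q"
  shows "ln (real q) * (1 / (real q - 1)\<^sup>2) \<le> 2 * (ln (real q) / (real q * (real q - 1)))"
proof -
  have q: "real q \<ge> 2" using assms prime_ge_2_nat by fastforce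
  have "1 / (real q - 1) \<le> 2 / real q" using q by (simp add: field_simps)
  then have "1 / (real q - 1) * (1 / (real q - 1)) \<le> 2 / real q * (1 / (real q - 1))"
    using q by (intro mult_right_mono) auto
  then have "ln (real q) * (1 / (real q - 1) * (1 / (real q - 1))) \<le> ln (real q) * (2 / real q * (1 / (real q - 1)))"
    by (intro mult_left_mono) auto
  then show ?thesis by (simp add: power2_eq_square mult_ac)
qed

lemma sum_primes_ln_inverse_square_le:
  "(\<Sum>q | q \<in> pos_le x \<and> prime q. ln (real q) * (1 / (real q - 1)\<^sup>2)) \<le> 4"
proof -
  have "(\<Sum>q | q \<in> pos_le x \<and> prime q. ln (real q) * (1 / (real q - 1)\<^sup>2)) \<le>
      (\<Sum>q | q \<in> pos_le x \<and> prime q. 2 * (ln (real q) / (real q * (real q - 1))))"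
    by (intro sum_mono inverse_square_prime_le) auto
  also have "\<dots> = 2 * (\<Sum>q | q \<in> pos_le x \<and> prime q. ln (real q) / (real q * (real q - 1)))"
    by (simp add: sum_distrib_left)
  finally show ?thesis using sum_primes_ln_div_mult_le[of x] by linarith
qed

text \<open>The numerator is the excess of \<open>ln (q ^ a)\<close> over \<open>ln q\<close>; the
  sum bounds the cost of replacing the logarithm of a prime power by its \<open>mangoldt\<close>
  value.\<close>

lemma sum_ppow_excess_le: "(\<Sum>(q, a)\<in>ppow_le x. (real a - 1) * ln (real q) / real q ^ a) \<le> 4"
proof -
  have "(\<Sum>(q, a)\<in>ppow_le x. (real a - 1) * ln (real q) / real q ^ a) \<le>
      (\<Sum>q | q \<in> pos_le x \<and> prime q. \<Sum>a=1..nat \<lfloor>x\<rfloor>. (real a - 1) * ln (real q) / real q ^ a)"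
    by (rule sum_ppow_le_le) auto
  also have "\<dots> \<le> (\<Sum>q | q \<in> pos_le x \<and> prime q. ln (real q) * (1 / (real q - 1)\<^sup>2))"
  proof (intro sum_mono)
    fix q assume "q \<in> {q. q \<in> pos_le x \<and> prime q}"
    then have q: "real q \<ge> 2" using prime_ge_2_nat by auto
    have "(\<Sum>a=1..N. (real a - 1) * ln (real q) / real q ^ a) \<le> ln (real q) * (1 / (real q - 1)\<^sup>2)" for N
    proof (cases N)
      case (Suc M)
      have "(\<Sum>a=1..Suc M. (real a - 1) * ln (real q) / real q ^ a) =
          (\<Sum>a=Suc 1..Suc M. (real a - 1) * ln (real q) / real q ^ a)"
        by (subst sum.atLeast_Suc_atMost) auto
      also have "\<dots> = (\<Sum>a=1..M. (real (Suc a) - 1) * ln (real q) / real q ^ Suc a)"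
        by (rule sum.shift_bounds_cl_Suc_ivl)
      also have "\<dots> = ln (real q) * (\<Sum>a=1..M. real a / real q ^ Suc a)"
        by (simp add: sum_distrib_left mult.commute)
      also have "\<dots> \<le> ln (real q) * (1 / (real q - 1)\<^sup>2)"
        using q by (intro mult_left_mono sum_mult_inverse_power_le) auto
      finally show ?thesis using Suc by simp
    qed simp
    then show "(\<Sum>a=1..nat \<lfloor>x\<rfloor>. (real a - 1) * ln (real q) / real q ^ a) \<le> ln (real q) * (1 / (real q - 1)\<^sup>2)" .
  qed
  also have "\<dots> \<le> 4" by (rule sum_primes_ln_inverse_square_le)
  finally show ?thesis .
qed

text \<open>Pairs of prime powers with the same prime enter when the condition
  \<open>fst r1 \<noteq> fst r2\<close> is dropped.\<close>

lemma sum_ppow_same_prime_le: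
  "(\<Sum>(q, a)\<in>ppow_le x. \<Sum>(q', a')\<in>ppow_le x. if q = q' then ln (real q) / (real q ^ a * real q' ^ a') else 0) \<le> 4"
proof -
  let ?N = "nat \<lfloor>x\<rfloor>" and ?P = "{q. q \<in> pos_le x \<and> prime q}"
  have finP: "finite ?P" by (rule finite_subset[OF _ finite_pos_le[of x]]) auto
  have "(\<Sum>(q, a)\<in>ppow_le x. \<Sum>(q', a')\<in>ppow_le x. if q = q' then ln (real q) / (real q ^ a * real q' ^ a') else 0) \<le>
      (\<Sum>q\<in>?P. \<Sum>a=1..?N. \<Sum>(q', a')\<in>ppow_le x. if q = q' then ln (real q) / (real q ^ a * real q' ^ a') else 0)"
    by (rule sum_ppow_le_le) (auto intro!: sum_nonneg)
  also have "\<dots> \<le> (\<Sum>q\<in>?P. \<Sum>a=1..?N. \<Sum>q'\<in>?P. \<Sum>a'=1..?N. if q = q' then ln (real q) / (real q ^ a * real q' ^ a') else 0)"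
    by (intro sum_mono sum_ppow_le_le) auto
  also have "\<dots> = (\<Sum>q\<in>?P. \<Sum>a=1..?N. \<Sum>q'\<in>?P. if q = q' then (\<Sum>a'=1..?N. ln (real q) / (real q ^ a * real q ^ a')) else 0)"
    by (intro sum.cong refl) auto
  also have "\<dots> = (\<Sum>q\<in>?P. \<Sum>a=1..?N. \<Sum>a'=1..?N. ln (real q) / (real q ^ a * real q ^ a'))"
  proof -
    have "(\<Sum>q'\<in>?P. if q = q' then Z else 0) = Z" if "q \<in> ?P" for q and Z :: real
      using that by (simp only: sum.delta'[OF finP] if_True)
    then show ?thesis by (intro sum.cong[of ?P ?P] sum.cong[of "{1..?N}" "{1..?N}"] refl)
  qed
  also have "\<dots> = (\<Sum>q\<in>?P. ln (real q) * ((\<Sum>a=1..?N. 1 / real q ^ a) * (\<Sum>a'=1..?N. 1 / real q ^ a')))"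
    by (simp only: sum_product, simp only: sum_distrib_left) (intro sum.cong refl, simp)
  also have "\<dots> \<le> (\<Sum>q\<in>?P. ln (real q) * (1 / (real q - 1)\<^sup>2))"
  proof (intro sum_mono mult_left_mono)
    fix q assume "q \<in> ?P"
    then have q: "real q \<ge> 2" using prime_ge_2_nat by auto
    have "(\<Sum>a=1..?N. 1 / real q ^ a) * (\<Sum>a'=1..?N. 1 / real q ^ a') \<le> 1 / (real q - 1) * (1 / (real q - 1))"
      using q by (intro mult_mono sum_inverse_power_le sum_nonneg) auto
    then show "(\<Sum>a=1..?N. 1 / real q ^ a) * (\<Sum>a'=1..?N. 1 / real q ^ a') \<le> 1 / (real q - 1)\<^sup>2"
      by (simp add: power2_eq_square)
  qed auto
  also have "\<dots> \<le> 4" by (rule sum_primes_ln_inverse_square_le)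
  finally show ?thesis .
qed

lemma card_prime_factors_prime_power_mult:
  assumes "prime q" "a > 0" "smooth (q - 1) m"
  shows "card (prime_factors (q ^ a * m)) = Suc (card (prime_factors m))"
proof -
  have "m > 0" using assms smooth_pos by blast
  have "q \<notin> prime_factors m" using assms prime_gt_0_nat[of q] by (fastforce simp: smooth_def)
  then show ?thesis using prime_factors_prime_power_mult[OF assms(1,2) \<open>m > 0\<close>] by simp
qed

lemma card_prime_factors_mono: "m > 0 \<Longrightarrow> n > 0 \<Longrightarrow> card (prime_factors n) \<le> card (prime_factors (m * n))" for m n :: nat
  by (intro card_mono) (auto simp: prime_factors_product)

text \<open>Induction on j, removing the largest prime power of n. Its reciprocals sum to at most
  \<open>124 * K\<close>, and raising 124 to 125 absorbs the term for n = 1.\<close>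

lemma sum_inverse_card_prime_factors_le:
  assumes "K \<ge> 1" "x < 2 ^ 2 ^ K"
  shows "(\<Sum>n | n \<in> pos_le x \<and> card (prime_factors n) \<le> j. 1 / real n) \<le> (125 * real K) ^ j"
proof (induction j)
  case 0
  have "{n. n \<in> pos_le x \<and> card (prime_factors n) \<le> 0} \<subseteq> {1}"
    by (auto simp: prime_factorization_empty_iff)
  then have "(\<Sum>n | n \<in> pos_le x \<and> card (prime_factors n) \<le> 0. 1 / real n) \<le> (\<Sum>n\<in>{1}. 1 / real n)"
    by (intro sum_mono2) auto
  then show ?case by simp
next
  case (Suc j)
  let ?W = "\<Sum>n | n \<in> pos_le x \<and> card (prime_factors n) \<le> j. 1 / real n"
  have "(\<Sum>n | n \<in> pos_le x \<and> card (prime_factors n) \<le> Suc j. 1 / real n) =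
      (\<Sum>n\<in>pos_le x. if card (prime_factors n) \<le> Suc j then 1 / real n else 0)"
    by (rule sum.inter_filter) auto
  also have "\<dots> \<le> (\<Sum>n\<in>insert 1 (pos_le x - {1}). if card (prime_factors n) \<le> Suc j then 1 / real n else 0)"
    by (intro sum_mono2) auto
  also have "\<dots> = 1 + (\<Sum>n\<in>pos_le x - {1}. if card (prime_factors n) \<le> Suc j then 1 / real n else 0)"
    by (subst sum.insert) auto
  also have "(\<Sum>n\<in>pos_le x - {1}. if card (prime_factors n) \<le> Suc j then 1 / real n else 0) =
      (\<Sum>(q, a)\<in>ppow_le x. \<Sum>m\<in>pos_le x. if smooth (q - 1) m \<and> real (q ^ a * m) \<le> x then
         (if card (prime_factors (q ^ a * m)) \<le> Suc j then 1 / real (q ^ a * m) else 0) else 0)"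
    by (rule sum_by_largest_prime_power_all)
  also have "\<dots> \<le> (\<Sum>(q, a)\<in>ppow_le x. \<Sum>m\<in>pos_le x. 1 / real q ^ a * (if card (prime_factors m) \<le> j then 1 / real m else 0))"
    unfolding case_prod_unfold
  proof (intro sum_mono)
    fix r m assume r: "r \<in> ppow_le x" and m: "m \<in> pos_le x"
    then obtain q a where qa: "r = (q, a)" "prime q" "a > 0" by (cases r) auto
    show "(if smooth (fst r - 1) m \<and> real (fst r ^ snd r * m) \<le> x then
         (if card (prime_factors (fst r ^ snd r * m)) \<le> Suc j then 1 / real (fst r ^ snd r * m) else 0) else 0) \<le>
        1 / real (fst r) ^ snd r * (if card (prime_factors m) \<le> j then 1 / real m else 0)"
      using card_prime_factors_prime_power_mult[of q a m] qa by (auto simp: mult.commute)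
  qed
  also have "\<dots> = (\<Sum>(q, a)\<in>ppow_le x. 1 / real q ^ a) * ?W"
    unfolding sum.inter_filter[OF finite_pos_le] by (simp only: sum_product case_prod_unfold)
  also have "\<dots> \<le> (124 * real K) * (125 * real K) ^ j"
    using Suc.IH assms by (intro mult_mono sum_inverse_ppow_le sum_nonneg) auto
  also have "1 + (124 * real K) * (125 * real K) ^ j \<le> (125 * real K) ^ Suc j"
  proof -
    have "1 \<le> (125 * real K) ^ j" using assms by (intro one_le_power) simp
    then have "1 * 1 \<le> real K * (125 * real K) ^ j" using assms by (intro mult_mono) auto
    then show ?thesis by (simp only: power_Suc)
  qed
  finally show ?case by simp
qed

text \<open>These are the integers where \<open>P3\<close> has its default value 1. Having at most
  two prime factors passes to divisors, so \<open>sum_ln_divisor_closed_le\<close> applies.\<close>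

lemma sum_ln_card_prime_factors_le2:
  assumes "K \<ge> 1" "x < 2 ^ 2 ^ K" "x > 0"
  shows "(\<Sum>n | n \<in> pos_le x \<and> card (prime_factors n) \<le> 2. ln (real n)) \<le> 10 * (125 * real K)\<^sup>2 * x"
proof -
  have "(\<Sum>n | n \<in> pos_le x \<and> card (prime_factors n) \<le> 2. ln (real n)) \<le>
      (\<Sum>k | k \<in> pos_le x \<and> card (prime_factors k) \<le> 2. psi (x / real k))"
  proof (rule sum_ln_divisor_closed_le)
    fix m n :: nat assume "card (prime_factors (m * n)) \<le> 2" "m > 0" "n > 0"
    then show "card (prime_factors n) \<le> 2" using card_prime_factors_mono[of m n] by linarith
  qed
  also have "\<dots> \<le> (\<Sum>k | k \<in> pos_le x \<and> card (prime_factors k) \<le> 2. 10 * x * (1 / real k))"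
    using assms psi_le[of "x / real k" for k] by (intro sum_mono) auto
  also have "\<dots> = 10 * x * (\<Sum>k | k \<in> pos_le x \<and> card (prime_factors k) \<le> 2. 1 / real k)"
    by (simp only: sum_distrib_left)
  also have "\<dots> \<le> 10 * x * (125 * real K)\<^sup>2"
    using assms by (intro mult_left_mono sum_inverse_card_prime_factors_le) auto
  finally show ?thesis by (simp add: mult_ac)
qed

definition ppval :: "nat \<times> nat \<Rightarrow> nat" where
  "ppval r = fst r ^ snd r"

lemma ppval_pos: "r \<in> ppow_le x \<Longrightarrow> ppval r > 0"
  by (cases r) (auto simp: ppval_def prime_gt_0_nat)

lemma ppval_le: "r \<in> ppow_le x \<Longrightarrow> real (ppval r) \<le> x"
  by (cases r) (auto simp: ppval_def)

lemma fst_ppow_le: "r \<in> ppow_le x \<Longrightarrow> prime (fst r)" "r \<in> ppow_le x \<Longrightarrow> snd r > 0"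
  by (cases r; auto)+

lemma sum_inverse_ppval_le: "x < 2 ^ 2 ^ K \<Longrightarrow> (\<Sum>r\<in>ppow_le x. 1 / real (ppval r)) \<le> 124 * real K"
  using sum_inverse_ppow_le[of x K] by (simp add: case_prod_unfold ppval_def)

lemma card_pos_le_bounded:
  assumes "x > 0" "R > 0"
  shows "(\<Sum>m\<in>pos_le x. if real (R * m) \<le> x then D else 0) \<le> \<bar>D\<bar> * (x / real R)"
proof -
  have "(\<Sum>m\<in>pos_le x. if real (R * m) \<le> x then D else 0) = (\<Sum>m | m \<in> pos_le x \<and> real (R * m) \<le> x. D)"
    by (rule sum.inter_filter[symmetric]) auto
  also have "\<dots> = D * real (card {m. m \<in> pos_le x \<and> real (R * m) \<le> x})" by simp
  also have "\<dots> \<le> \<bar>D\<bar> * real (card {m. m \<in> pos_le x \<and> real (R * m) \<le> x})"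
    by (intro mult_right_mono) auto
  also have "\<dots> \<le> \<bar>D\<bar> * real (card (pos_le (x / real R)))"
    using assms by (intro mult_left_mono of_nat_mono card_mono) (auto simp: field_simps)
  also have "\<dots> \<le> \<bar>D\<bar> * (x / real R)"
    using assms by (intro mult_left_mono card_pos_le_le) auto
  finally show ?thesis .
qed

section \<open>Integers with at least three prime factors\<close>

context mertens_weight
begin

definition F3 :: "nat \<Rightarrow> real" where
  "F3 n = (if card (prime_factors n) \<ge> 3 then c (P3 n) * ln (real n) else 0)"

text \<open>The order of the two primes is left out on purpose: the condition is symmetric in
  \<open>r1\<close> and \<open>r2\<close> and admits equal primes, so that \<open>r1\<close> can be
  summed freely together with m.\<close>

definition Hset :: "real \<Rightarrow> nat \<times> nat \<Rightarrow> nat \<times> nat \<Rightarrow> nat \<Rightarrow> bool" where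
  "Hset x r1 r2 m \<longleftrightarrow> m > 1 \<and> lpf m < fst r1 \<and> lpf m < fst r2 \<and> real (ppval r1 * ppval r2 * m) \<le> x"

lemma Hset_commute: "Hset x r1 r2 m \<longleftrightarrow> Hset x r2 r1 m"
  by (auto simp: Hset_def mult_ac)

text \<open>Two applications of the prime power decomposition: \<open>r1\<close> and
  \<open>r2\<close> carry the largest and the second largest prime, and ln n splits into three
  logarithms.\<close>

lemma sum_F3_eq:
  "(\<Sum>n\<in>pos_le x. F3 n) = (\<Sum>r1\<in>ppow_le x. \<Sum>r2\<in>ppow_le x. \<Sum>m\<in>pos_le x.
     if fst r2 < fst r1 \<and> Hset x r1 r2 m then c (lpf m) * (ln (real m) + (ln (real (ppval r1)) + ln (real (ppval r2)))) else 0)"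
proof -
  have "(\<Sum>n\<in>pos_le x. F3 n) = (\<Sum>n\<in>pos_le x - {1}. F3 n)"
    by (rule sum.mono_neutral_right) (auto simp: F3_def)
  also have "\<dots> = (\<Sum>(q, a)\<in>ppow_le x. \<Sum>n\<in>pos_le x. if smooth (q - 1) n \<and> real (q ^ a * n) \<le> x then F3 (q ^ a * n) else 0)"
    by (rule sum_by_largest_prime_power_all)
  also have "\<dots> = (\<Sum>r1\<in>ppow_le x. \<Sum>r2\<in>ppow_le x. \<Sum>m\<in>pos_le x.
     if fst r2 < fst r1 \<and> Hset x r1 r2 m then c (lpf m) * (ln (real m) + (ln (real (ppval r1)) + ln (real (ppval r2)))) else 0)"
    unfolding case_prod_unfold
  proof (rule sum.cong[OF refl])
    fix r1 assume r1: "r1 \<in> ppow_le x"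
    let ?q = "fst r1" and ?R = "ppval r1"
    note q = fst_ppow_le[OF r1] ppval_pos[OF r1]
    have qpos: "?q > 0" using q prime_gt_0_nat by blast
    have R1: "?R \<ge> 1" using q by simp
    have xpos: "x > 0" using ppval_le[OF r1] q(3) by linarith
    have xle: "x / real ?R \<le> x"
      using divide_left_mono[of 1 "real ?R" x] R1 xpos by auto
    have "(\<Sum>n\<in>pos_le x. if smooth (?q - 1) n \<and> real (?q ^ snd r1 * n) \<le> x then F3 (?q ^ snd r1 * n) else 0) =
        (\<Sum>n | n \<in> pos_le x \<and> smooth (?q - 1) n \<and> real (?R * n) \<le> x. F3 (?R * n))"
      unfolding ppval_def[symmetric] by (rule sum.inter_filter[symmetric]) auto
    also have "\<dots> = (\<Sum>n\<in>smooth_le (?q - 1) (x / real ?R) - {1}. F3 (?R * n))"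
    proof (rule sum.mono_neutral_right)
      show "smooth_le (?q - 1) (x / real ?R) - {1} \<subseteq> {n. n \<in> pos_le x \<and> smooth (?q - 1) n \<and> real (?R * n) \<le> x}"
      proof
        fix n assume n: "n \<in> smooth_le (?q - 1) (x / real ?R) - {1}"
        then have "real n \<le> x / real ?R" "smooth (?q - 1) n" by auto
        with xle have "real n \<le> x" "real (?R * n) \<le> x" using q(3) by (linarith, simp add: field_simps)
        then show "n \<in> {n. n \<in> pos_le x \<and> smooth (?q - 1) n \<and> real (?R * n) \<le> x}"
          using n smooth_pos by auto
      qed
      show "\<forall>n\<in>{n. n \<in> pos_le x \<and> smooth (?q - 1) n \<and> real (?R * n) \<le> x} - (smooth_le (?q - 1) (x / real ?R) - {1}). F3 (?R * n) = 0"
      proof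
        fix n assume n: "n \<in> {n. n \<in> pos_le x \<and> smooth (?q - 1) n \<and> real (?R * n) \<le> x} - (smooth_le (?q - 1) (x / real ?R) - {1})"
        then have "real n \<le> x / real ?R" using q(3) by (auto simp: field_simps)
        with n have "n = 1" by auto
        then show "F3 (?R * n) = 0"
          using card_prime_factors_prime_power_mult[OF q(1,2), of 1] by (simp add: F3_def ppval_def)
      qed
    qed (rule finite_subset[OF _ finite_pos_le[of x]], auto)
    also have "\<dots> = (\<Sum>(q, a)\<in>ppow_le x. \<Sum>m\<in>pos_le x.
       if q \<le> ?q - 1 \<and> smooth (q - 1) m \<and> real (q ^ a * m) \<le> x / real ?R then F3 (?R * (q ^ a * m)) else 0)"
      by (rule sum_by_largest_prime_power[OF xle])
    also have "\<dots> = (\<Sum>r2\<in>ppow_le x. \<Sum>m\<in>pos_le x.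
       if fst r2 < ?q \<and> Hset x r1 r2 m then c (lpf m) * (ln (real m) + (ln (real ?R) + ln (real (ppval r2)))) else 0)"
      unfolding case_prod_unfold
    proof (intro sum.cong refl)
      fix r2 m assume r2: "r2 \<in> ppow_le x" and m: "m \<in> pos_le x"
      note q2 = fst_ppow_le[OF r2] ppval_pos[OF r2]
      have q2pos: "fst r2 > 0" using q2 prime_gt_0_nat by blast
      show "(if fst r2 \<le> ?q - 1 \<and> smooth (fst r2 - 1) m \<and> real (fst r2 ^ snd r2 * m) \<le> x / real ?R
           then F3 (?R * (fst r2 ^ snd r2 * m)) else 0) =
         (if fst r2 < ?q \<and> Hset x r1 r2 m then c (lpf m) * (ln (real m) + (ln (real ?R) + ln (real (ppval r2)))) else 0)"
      \<comment> \<open>For m = 1 there are only two prime factors, so \<open>F3\<close> vanishes,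
        in agreement with the condition \<open>m > 1\<close> in \<open>Hset\<close>.\<close>
      proof (cases "m = 1")
        case True
        show ?thesis
        proof (cases "fst r2 \<le> ?q - 1")
          case le: True
          have "card (prime_factors (?q ^ snd r1 * (fst r2 ^ snd r2 * 1))) = 2"
            using card_prime_factors_prime_power_mult[OF q2(1,2), of 1] q q2 le
            by (subst card_prime_factors_prime_power_mult) (auto simp: smooth_prime_power)
          then have "F3 (?R * (fst r2 ^ snd r2 * m)) = 0" unfolding True F3_def ppval_def by simp
          then show ?thesis using True by (simp add: Hset_def)
        next
          case False
          then show ?thesis using True by (simp add: Hset_def)
        qed
      next
        case False
        then have m1: "m > 1" using m by simp
        have bd: "real (fst r2 ^ snd r2 * m) \<le> x / real ?R \<longleftrightarrow> real (?R * ppval r2 * m) \<le> x"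
          using q(3) by (simp add: ppval_def field_simps)
        have sm: "smooth (fst r2 - 1) m \<longleftrightarrow> lpf m < fst r2"
          unfolding smooth_iff_lpf_le[OF m1] using q2pos by linarith
        have lt: "fst r2 \<le> ?q - 1 \<longleftrightarrow> fst r2 < ?q" using qpos by linarith
        show ?thesis
        proof (cases "fst r2 < ?q \<and> Hset x r1 r2 m")
          case True
          then have *: "fst r2 < ?q" "lpf m < fst r2" by (auto simp: Hset_def)
          have "card (prime_factors (?R * (fst r2 ^ snd r2 * m))) \<ge> 3" "P3 (?R * (fst r2 ^ snd r2 * m)) = lpf m"
            unfolding ppval_def using * sm m1 q q2 by (intro P3_decomp; simp)+
          moreover have "ln (real (?R * (fst r2 ^ snd r2 * m))) = ln (real m) + (ln (real ?R) + ln (real (ppval r2)))"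
            using m1 q(3) q2(3) by (simp add: ln_mult ppval_def[of r2, symmetric] flip: of_nat_power)
          ultimately have "F3 (?R * (fst r2 ^ snd r2 * m)) = c (lpf m) * (ln (real m) + (ln (real ?R) + ln (real (ppval r2))))"
            unfolding F3_def by simp
          moreover have "fst r2 \<le> ?q - 1 \<and> smooth (fst r2 - 1) m \<and> real (fst r2 ^ snd r2 * m) \<le> x / real ?R"
            unfolding bd sm lt using True by (auto simp: Hset_def)
          ultimately show ?thesis using True by (simp only: if_True simp_thms)
        next
          case False
          then have "\<not> (fst r2 \<le> ?q - 1 \<and> smooth (fst r2 - 1) m \<and> real (fst r2 ^ snd r2 * m) \<le> x / real ?R)"
            unfolding bd sm lt using m1 by (auto simp: Hset_def)
          then show ?thesis using False by (simp only: if_False)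
        qed
      qed
    qed
    finally show "(\<Sum>n\<in>pos_le x. if smooth (?q - 1) n \<and> real (?q ^ snd r1 * n) \<le> x then F3 (?q ^ snd r1 * n) else 0) =
       (\<Sum>r2\<in>ppow_le x. \<Sum>m\<in>pos_le x.
       if fst r2 < ?q \<and> Hset x r1 r2 m then c (lpf m) * (ln (real m) + (ln (real ?R) + ln (real (ppval r2)))) else 0)" .
  qed
  finally show ?thesis .
qed

end

lemma sum_rough_le_mangoldt_eq:
  assumes "z \<le> x"
  shows "(\<Sum>s\<in>rough_le t z. mangoldt s) =
    (\<Sum>r\<in>ppow_le x. if t < fst r \<and> real (ppval r) \<le> z then ln (real (fst r)) else 0)"
proof -
  have "(\<Sum>s\<in>rough_le t z. mangoldt s) = (\<Sum>s\<in>{s \<in> pos_le x. rough t s \<and> real s \<le> z}. mangoldt s)"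
    using assms by (intro sum.cong) (auto simp: rough_pos)
  also have "\<dots> = (\<Sum>s\<in>pos_le x. mangoldt s * (if rough t s \<and> real s \<le> z then 1 else 0))"
    by (subst sum.inter_filter) (auto intro!: sum.cong)
  also have "\<dots> = (\<Sum>(q, a)\<in>ppow_le x. ln (real q) * (if rough t (q ^ a) \<and> real (q ^ a) \<le> z then 1 else 0))"
    by (rule sum_mangoldt_eq_ppow)
  also have "\<dots> = (\<Sum>r\<in>ppow_le x. if t < fst r \<and> real (ppval r) \<le> z then ln (real (fst r)) else 0)"
    by (intro sum.cong) (auto simp: ppval_def rough_prime_power)
  finally show ?thesis .
qed

context mertens_weight
begin

lemma Hset_iff_smooth:
  assumes r: "r1 \<in> ppow_le x" "r2 \<in> ppow_le x" and lt: "fst r2 < fst r1"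
  shows "{m \<in> pos_le x. Hset x r1 r2 m} = smooth_le (fst r2 - 1) (x / (real (ppval r1) * real (ppval r2))) - {1}"
proof -
  note pos = ppval_pos[OF r(1)] ppval_pos[OF r(2)]
  have q2: "fst r2 > 0" using fst_ppow_le(1)[OF r(2)] prime_gt_0_nat by blast
  have bd: "real m \<le> x / (real (ppval r1) * real (ppval r2)) \<longleftrightarrow> real (ppval r1 * ppval r2 * m) \<le> x" for m
    using pos by (simp add: field_simps)
  have sm: "smooth (fst r2 - 1) m \<longleftrightarrow> lpf m < fst r2" if "m > 1" for m
    unfolding smooth_iff_lpf_le[OF that] using q2 by linarith
  have mle: "real m \<le> x" if "real (ppval r1 * ppval r2 * m) \<le> x" for m
    using le_of_mult_le[of "ppval r1 * ppval r2" m x] that pos by (simp add: mult_ac)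
  show ?thesis
  proof (intro equalityI subsetI)
    fix m assume m: "m \<in> {m \<in> pos_le x. Hset x r1 r2 m}"
    then have "m > 1" "lpf m < fst r2" "real (ppval r1 * ppval r2 * m) \<le> x" by (simp_all only: Hset_def mem_Collect_eq)
    then show "m \<in> smooth_le (fst r2 - 1) (x / (real (ppval r1) * real (ppval r2))) - {1}"
      using sm[of m] bd[of m] by simp
  next
    fix m assume m: "m \<in> smooth_le (fst r2 - 1) (x / (real (ppval r1) * real (ppval r2))) - {1}"
    then have m1: "m > 1" using smooth_pos[of "fst r2 - 1" m] by auto
    have "lpf m < fst r2" "real (ppval r1 * ppval r2 * m) \<le> x" using m sm[OF m1] bd[of m] by (simp_all only: mem_smooth_le Diff_iff)
    then show "m \<in> {m \<in> pos_le x. Hset x r1 r2 m}" using m1 mle[of m] lt by (simp add: Hset_def)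
  qed
qed

text \<open>When \<open>fst r2 < fst r1\<close>, the condition on m coming from \<open>r1\<close>
  follows from the one coming from \<open>r2\<close>, so m runs through smooth numbers as in
  \<open>K2\<close>.\<close>

lemma sum_ln_m_eq_K2:
  assumes r: "r1 \<in> ppow_le x" "r2 \<in> ppow_le x"
  shows "(\<Sum>m\<in>pos_le x. if fst r2 < fst r1 \<and> Hset x r1 r2 m then c (lpf m) * ln (real m) else 0) =
    (if fst r2 < fst r1 then K2 (fst r2 - 1) (x / (real (ppval r1) * real (ppval r2))) else 0)"
proof (cases "fst r2 < fst r1")
  case True
  then have "(\<Sum>m\<in>pos_le x. if fst r2 < fst r1 \<and> Hset x r1 r2 m then c (lpf m) * ln (real m) else 0) =
      (\<Sum>m\<in>{m \<in> pos_le x. Hset x r1 r2 m}. c (lpf m) * ln (real m))"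
    by (subst sum.inter_filter) (auto intro!: sum.cong)
  then show ?thesis unfolding Hset_iff_smooth[OF r True] K2_def using True by simp
qed simp

text \<open>Only \<open>r2\<close> is fixed. The inner sum of \<open>mangoldt\<close> in
  \<open>K1\<close> supplies \<open>r1\<close>, which therefore carries the logarithm of its prime
  instead of that of the whole power.\<close>

lemma K1_eq_Hset:
  assumes r2: "r2 \<in> ppow_le x"
  shows "K1 (fst r2 - 1) (x / real (ppval r2)) =
    (\<Sum>m\<in>pos_le x. \<Sum>r1\<in>ppow_le x. if Hset x r1 r2 m then c (lpf m) * ln (real (fst r1)) else 0)"
proof -
  note pos = ppval_pos[OF r2]
  have q2: "fst r2 > 0" using fst_ppow_le(1)[OF r2] prime_gt_0_nat by blast
  have xpos: "x > 0" using ppval_le[OF r2] pos by linarith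
  have xle: "x / real R \<le> x" if "R > 0" for R :: nat
    using divide_left_mono[of 1 "real R" x] that xpos by auto
  let ?S = "smooth_le (fst r2 - 1) (x / real (ppval r2)) - {1}"
  have sub: "?S \<subseteq> pos_le x"
  proof
    fix m assume "m \<in> ?S"
    then have "real m \<le> x / real (ppval r2)" "m > 0" using smooth_pos by auto
    with xle[OF pos] show "m \<in> pos_le x" by simp
  qed
  have "K1 (fst r2 - 1) (x / real (ppval r2)) =
      (\<Sum>m\<in>?S. \<Sum>r1\<in>ppow_le x. if Hset x r1 r2 m then c (lpf m) * ln (real (fst r1)) else 0)"
    unfolding K1_def
  proof (rule sum.cong[OF refl])
    fix m assume m: "m \<in> ?S"
    then have m1: "m > 1" using smooth_pos[of "fst r2 - 1" m] by auto
    have "lpf m \<le> fst r2 - 1" using m m1 by (simp add: smooth_iff_lpf_le)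
    then have lt: "lpf m < fst r2" using q2 by linarith
    have "x / real (ppval r2) / real m \<le> x" using xle[of "ppval r2 * m"] pos m1 by simp
    then have "c (lpf m) * (\<Sum>s\<in>rough_le (lpf m) (x / real (ppval r2) / real m). mangoldt s) =
        (\<Sum>r1\<in>ppow_le x. c (lpf m) * (if lpf m < fst r1 \<and> real (ppval r1) \<le> x / real (ppval r2) / real m then ln (real (fst r1)) else 0))"
      by (simp only: sum_rough_le_mangoldt_eq sum_distrib_left)
    also have "\<dots> = (\<Sum>r1\<in>ppow_le x. if Hset x r1 r2 m then c (lpf m) * ln (real (fst r1)) else 0)"
    proof (intro sum.cong refl)
      fix r1
      have "real (ppval r1) \<le> x / real (ppval r2) / real m \<longleftrightarrow> real (ppval r1 * ppval r2 * m) \<le> x"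
        using pos m1 by (simp add: field_simps)
      then have "lpf m < fst r1 \<and> real (ppval r1) \<le> x / real (ppval r2) / real m \<longleftrightarrow> Hset x r1 r2 m"
        unfolding Hset_def using m1 lt by blast
      then show "c (lpf m) * (if lpf m < fst r1 \<and> real (ppval r1) \<le> x / real (ppval r2) / real m then ln (real (fst r1)) else 0) =
          (if Hset x r1 r2 m then c (lpf m) * ln (real (fst r1)) else 0)" by simp
    qed
    finally show "c (lpf m) * (\<Sum>s\<in>rough_le (lpf m) (x / real (ppval r2) / real m). mangoldt s) =
        (\<Sum>r1\<in>ppow_le x. if Hset x r1 r2 m then c (lpf m) * ln (real (fst r1)) else 0)" .
  qed
  also have "\<dots> = (\<Sum>m\<in>pos_le x. \<Sum>r1\<in>ppow_le x. if Hset x r1 r2 m then c (lpf m) * ln (real (fst r1)) else 0)"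
  proof (rule sum.mono_neutral_left[OF finite_pos_le sub], rule ballI, rule sum.neutral, rule ballI)
    fix m r1 assume m: "m \<in> pos_le x - ?S" and r1: "r1 \<in> ppow_le x"
    have "\<not> Hset x r1 r2 m"
    proof
      assume H: "Hset x r1 r2 m"
      then have m1: "m > 1" and lt: "lpf m < fst r2" and le: "real (ppval r1 * ppval r2 * m) \<le> x" by (simp_all only: Hset_def)
      have "1 * (real (ppval r2) * real m) \<le> real (ppval r1) * (real (ppval r2) * real m)"
        using ppval_pos[OF r1] by (intro mult_right_mono) auto
      with le have "real (ppval r2) * real m \<le> x" by (simp add: mult_ac)
      then have "real m \<le> x / real (ppval r2)" using pos by (simp add: field_simps)
      moreover have "smooth (fst r2 - 1) m" unfolding smooth_iff_lpf_le[OF m1] using lt by linarith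
      ultimately have "m \<in> ?S" using m1 by simp
      with m show False by blast
    qed
    then show "(if Hset x r1 r2 m then c (lpf m) * ln (real (fst r1)) else 0) = 0" by simp
  qed
  finally show ?thesis .
qed

text \<open>Exchanging \<open>r1\<close> and \<open>r2\<close> frees the weighted prime power from the order condition.\<close>

lemma sum_ln_ppval_symmetrize:
  "(\<Sum>r1\<in>ppow_le x. \<Sum>r2\<in>ppow_le x. \<Sum>m\<in>pos_le x.
     if fst r2 < fst r1 \<and> Hset x r1 r2 m then c (lpf m) * (ln (real (ppval r1)) + ln (real (ppval r2))) else 0) =
   (\<Sum>r1\<in>ppow_le x. \<Sum>r2\<in>ppow_le x. \<Sum>m\<in>pos_le x.
     if fst r1 \<noteq> fst r2 \<and> Hset x r1 r2 m then c (lpf m) * ln (real (ppval r1)) else 0)" (is "?L = ?R")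
proof -
  let ?g = "\<lambda>r1 r2. \<Sum>m\<in>pos_le x. if fst r2 < fst r1 \<and> Hset x r1 r2 m then c (lpf m) * ln (real (ppval r1)) else 0"
  let ?h = "\<lambda>r1 r2. \<Sum>m\<in>pos_le x. if fst r2 < fst r1 \<and> Hset x r1 r2 m then c (lpf m) * ln (real (ppval r2)) else 0"
  have "?L = (\<Sum>r1\<in>ppow_le x. \<Sum>r2\<in>ppow_le x. ?g r1 r2 + ?h r1 r2)"
    unfolding sum.distrib[symmetric] by (intro sum.cong refl) (auto simp: distrib_left)
  also have "\<dots> = (\<Sum>r1\<in>ppow_le x. \<Sum>r2\<in>ppow_le x. ?g r1 r2) + (\<Sum>r1\<in>ppow_le x. \<Sum>r2\<in>ppow_le x. ?h r1 r2)"
    by (simp only: sum.distrib)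
  also have "(\<Sum>r1\<in>ppow_le x. \<Sum>r2\<in>ppow_le x. ?h r1 r2) = (\<Sum>r1\<in>ppow_le x. \<Sum>r2\<in>ppow_le x. ?h r2 r1)"
    by (rule sum.swap)
  also have "(\<Sum>r1\<in>ppow_le x. \<Sum>r2\<in>ppow_le x. ?g r1 r2) + (\<Sum>r1\<in>ppow_le x. \<Sum>r2\<in>ppow_le x. ?h r2 r1) = ?R"
    unfolding sum.distrib[symmetric]
    by (intro sum.cong refl) (use Hset_commute[of x] in \<open>auto simp: neq_iff\<close>)
  finally show ?thesis .
qed

text \<open>\<open>A\<close> carries ln m and is a double sum of \<open>K2\<close>. The symmetrized
  \<open>B\<close> is compared with \<open>D\<close>, a single sum of \<open>K1\<close>; the
  discrepancy stems from exponents above 1 and from equal primes. The cube arises in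
  \<open>A\<close>: each sum over prime powers costs O(K), and \<open>K2\<close> costs the third
  factor.\<close>

lemma sum_F3_bound:
  "\<exists>C\<ge>0. \<forall>K x. 1 \<le> K \<and> 0 < x \<and> x < 2 ^ 2 ^ K \<longrightarrow> \<bar>\<Sum>n\<in>pos_le x. F3 n\<bar> \<le> C * real K ^ 3 * x"
proof -
  obtain C where C: "C \<ge> 0" "\<And>K w y. 0 < y \<Longrightarrow> y < 2 ^ 2 ^ K \<Longrightarrow> \<bar>K1 w y\<bar> \<le> C * real K * y"
    "\<And>K w y. 0 < y \<Longrightarrow> y < 2 ^ 2 ^ K \<Longrightarrow> \<bar>K2 w y\<bar> \<le> C * real K * y"
    using K1_K2_bound by blast
  show ?thesis
  proof (intro exI[of _ "C * 124\<^sup>2 + C * 124 + 500"] conjI allI impI)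
    show "C * 124\<^sup>2 + C * 124 + 500 \<ge> 0" using C by simp
  next
    fix K :: nat and x :: real assume Kx: "1 \<le> K \<and> 0 < x \<and> x < 2 ^ 2 ^ K"
    then have K: "K \<ge> 1" and x: "x > 0" "x < 2 ^ 2 ^ K" by auto
    let ?PP = "ppow_le x"
    define P where "P = (\<Sum>r\<in>?PP. 1 / real (ppval r))"
    have P: "P \<le> 124 * real K" "P \<ge> 0"
      unfolding P_def using sum_inverse_ppval_le[OF x(2)] by (simp, intro sum_nonneg, simp)
    define A where "A = (\<Sum>r1\<in>?PP. \<Sum>r2\<in>?PP. \<Sum>m\<in>pos_le x. if fst r2 < fst r1 \<and> Hset x r1 r2 m then c (lpf m) * ln (real m) else 0)"
    define B where "B = (\<Sum>r1\<in>?PP. \<Sum>r2\<in>?PP. \<Sum>m\<in>pos_le x.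
      if fst r1 \<noteq> fst r2 \<and> Hset x r1 r2 m then c (lpf m) * ln (real (ppval r1)) else 0)"
    define D where "D = (\<Sum>r2\<in>?PP. K1 (fst r2 - 1) (x / real (ppval r2)))"
    have F3: "(\<Sum>n\<in>pos_le x. F3 n) = A + B"
      unfolding sum_F3_eq A_def B_def sum_ln_ppval_symmetrize[symmetric] sum.distrib[symmetric]
      by (intro sum.cong refl) (simp add: distrib_left)
    have "\<bar>A\<bar> \<le> (\<Sum>r1\<in>?PP. \<Sum>r2\<in>?PP. C * real K * x * (1 / real (ppval r1) * (1 / real (ppval r2))))"
      unfolding A_def
    proof (rule order_trans[OF sum_abs sum_mono], rule order_trans[OF sum_abs sum_mono])
      fix r1 r2 assume r: "r1 \<in> ?PP" "r2 \<in> ?PP"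
      let ?y = "x / (real (ppval r1) * real (ppval r2))"
      have ge: "1 \<le> real (ppval r1) * real (ppval r2)"
        using ppval_pos[OF r(1)] ppval_pos[OF r(2)] mult_mono[of 1 "real (ppval r1)" 1 "real (ppval r2)"] by simp
      have y: "?y > 0" "?y < 2 ^ 2 ^ K"
      proof -
        show "?y > 0" using x ge by simp
        have "?y \<le> x / 1" using x ge by (intro divide_left_mono) auto
        with x show "?y < 2 ^ 2 ^ K" by simp
      qed
      have "\<bar>\<Sum>m\<in>pos_le x. if fst r2 < fst r1 \<and> Hset x r1 r2 m then c (lpf m) * ln (real m) else 0\<bar> \<le> C * real K * ?y"
      proof -
        have "0 \<le> C * real K * ?y" using C(1) y(1) by (intro mult_nonneg_nonneg) auto
        then show ?thesis unfolding sum_ln_m_eq_K2[OF r] using C(3)[OF y, of "fst r2 - 1"] by simp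
      qed
      then show "\<bar>\<Sum>m\<in>pos_le x. if fst r2 < fst r1 \<and> Hset x r1 r2 m then c (lpf m) * ln (real m) else 0\<bar> \<le>
          C * real K * x * (1 / real (ppval r1) * (1 / real (ppval r2)))" by simp
    qed
    also have "\<dots> = C * real K * x * (P * P)"
      unfolding P_def by (simp only: sum_product, simp only: sum_distrib_left)
    also have "\<dots> \<le> C * real K * x * ((124 * real K) * (124 * real K))"
      using P C x by (intro mult_left_mono mult_mono) auto
    also have "\<dots> = C * 124\<^sup>2 * real K ^ 3 * x" by (simp add: power3_eq_cube power2_eq_square mult_ac)
    finally have boundA: "\<bar>A\<bar> \<le> C * 124\<^sup>2 * real K ^ 3 * x" .
    have "\<bar>D\<bar> \<le> (\<Sum>r2\<in>?PP. C * real K * x * (1 / real (ppval r2)))"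
      unfolding D_def
    proof (rule order_trans[OF sum_abs sum_mono])
      fix r2 assume r: "r2 \<in> ?PP"
      have ge: "1 \<le> real (ppval r2)" using ppval_pos[OF r] by simp
      have "x / real (ppval r2) \<le> x / 1" using x ge by (intro divide_left_mono) auto
      then have "x / real (ppval r2) < 2 ^ 2 ^ K" using x by simp
      then show "\<bar>K1 (fst r2 - 1) (x / real (ppval r2))\<bar> \<le> C * real K * x * (1 / real (ppval r2))"
        using C(2)[of "x / real (ppval r2)" K "fst r2 - 1"] x ge by simp
    qed
    also have "\<dots> = C * real K * x * P" unfolding P_def by (simp only: sum_distrib_left)
    also have "\<dots> \<le> C * real K * x * (124 * real K)" using P C x by (intro mult_left_mono) auto
    also have "\<dots> = C * 124 * real K ^ 2 * x" by (simp add: power2_eq_square mult_ac)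
    also have "\<dots> \<le> C * 124 * real K ^ 3 * x"
      using C x K power_increasing[of 2 3 "real K"] by (intro mult_right_mono mult_left_mono) auto
    finally have boundD: "\<bar>D\<bar> \<le> C * 124 * real K ^ 3 * x" .
    have Deq: "D = (\<Sum>r1\<in>?PP. \<Sum>r2\<in>?PP. \<Sum>m\<in>pos_le x. if Hset x r1 r2 m then c (lpf m) * ln (real (fst r1)) else 0)"
    proof -
      have "D = (\<Sum>r2\<in>?PP. \<Sum>m\<in>pos_le x. \<Sum>r1\<in>?PP. if Hset x r1 r2 m then c (lpf m) * ln (real (fst r1)) else 0)"
        unfolding D_def by (intro sum.cong refl K1_eq_Hset)
      also have "\<dots> = (\<Sum>r2\<in>?PP. \<Sum>r1\<in>?PP. \<Sum>m\<in>pos_le x. if Hset x r1 r2 m then c (lpf m) * ln (real (fst r1)) else 0)"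
        by (intro sum.cong refl sum.swap)
      also have "\<dots> = (\<Sum>r1\<in>?PP. \<Sum>r2\<in>?PP. \<Sum>m\<in>pos_le x. if Hset x r1 r2 m then c (lpf m) * ln (real (fst r1)) else 0)"
        by (rule sum.swap)
      finally show ?thesis .
    qed
    \<comment> \<open>This bounds the difference between the logarithms in \<open>B\<close> and
      \<open>D\<close>. For different primes it is exactly that difference, (a - 1) ln q; for equal
      primes it is a ln q, which is at least ln q.\<close>
    define E where "E = (\<lambda>r1 r2 :: nat \<times> nat. ((real (snd r1) - 1) + (if fst r1 = fst r2 then 1 else 0)) * ln (real (fst r1)))"
    have E0: "E r1 r2 \<ge> 0" if "r1 \<in> ?PP" for r1 r2
      using fst_ppow_le(2)[OF that] by (simp add: E_def)
    have "B - D = (\<Sum>r1\<in>?PP. \<Sum>r2\<in>?PP. \<Sum>m\<in>pos_le x.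
        (if fst r1 \<noteq> fst r2 \<and> Hset x r1 r2 m then c (lpf m) * ln (real (ppval r1)) else 0) -
        (if Hset x r1 r2 m then c (lpf m) * ln (real (fst r1)) else 0))"
      unfolding B_def Deq by (simp only: sum_subtractf)
    then have "\<bar>B - D\<bar> \<le> (\<Sum>r1\<in>?PP. \<Sum>r2\<in>?PP. x * (E r1 r2 * (1 / real (ppval r1) * (1 / real (ppval r2)))))"
    proof (simp only:, intro order_trans[OF sum_abs sum_mono])
      fix r1 r2 assume r: "r1 \<in> ?PP" "r2 \<in> ?PP"
      note pr = fst_ppow_le[OF r(1)] ppval_pos[OF r(1)] ppval_pos[OF r(2)]
      have lnR: "ln (real (ppval r1)) = real (snd r1) * ln (real (fst r1))"
        using pr(1) prime_gt_0_nat by (simp add: ppval_def ln_realpow)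
      have "\<bar>\<Sum>m\<in>pos_le x. (if fst r1 \<noteq> fst r2 \<and> Hset x r1 r2 m then c (lpf m) * ln (real (ppval r1)) else 0) -
          (if Hset x r1 r2 m then c (lpf m) * ln (real (fst r1)) else 0)\<bar> \<le>
          (\<Sum>m\<in>pos_le x. if real (ppval r1 * ppval r2 * m) \<le> x then E r1 r2 else 0)"
      proof (rule order_trans[OF sum_abs sum_mono])
        fix m
        show "\<bar>(if fst r1 \<noteq> fst r2 \<and> Hset x r1 r2 m then c (lpf m) * ln (real (ppval r1)) else 0) -
          (if Hset x r1 r2 m then c (lpf m) * ln (real (fst r1)) else 0)\<bar> \<le>
          (if real (ppval r1 * ppval r2 * m) \<le> x then E r1 r2 else 0)"
        proof (cases "Hset x r1 r2 m")
          case True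
          then have le: "real (ppval r1 * ppval r2 * m) \<le> x" by (simp only: Hset_def)
          have "\<bar>(if fst r1 \<noteq> fst r2 \<and> Hset x r1 r2 m then c (lpf m) * ln (real (ppval r1)) else 0) -
              (if Hset x r1 r2 m then c (lpf m) * ln (real (fst r1)) else 0)\<bar> \<le> \<bar>c (lpf m)\<bar> * E r1 r2"
          proof (cases "fst r1 = fst r2")
            case eq: True
            have "1 * ln (real (fst r1)) \<le> real (snd r1) * ln (real (fst r1))"
              using pr(2) by (intro mult_right_mono) auto
            also have "\<dots> = E r1 r2" using eq by (simp add: E_def)
            finally have "\<bar>c (lpf m)\<bar> * ln (real (fst r1)) \<le> \<bar>c (lpf m)\<bar> * E r1 r2"
              by (intro mult_left_mono) auto
            then show ?thesis using True eq by (simp add: abs_mult)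
          next
            case neq: False
            have "c (lpf m) * ln (real (ppval r1)) - c (lpf m) * ln (real (fst r1)) = c (lpf m) * E r1 r2"
              using neq by (simp add: E_def lnR algebra_simps)
            then show ?thesis using True neq E0[OF r(1)] by (simp add: abs_mult)
          qed
          also have "\<dots> \<le> 1 * E r1 r2" by (intro mult_right_mono abs_c_le E0 r)
          finally show ?thesis using le by simp
        next
          case False
          then show ?thesis using E0[OF r(1)] by simp
        qed
      qed
      also have "\<dots> \<le> \<bar>E r1 r2\<bar> * (x / real (ppval r1 * ppval r2))"
        using x pr by (intro card_pos_le_bounded) auto
      also have "\<dots> = x * (E r1 r2 * (1 / real (ppval r1) * (1 / real (ppval r2))))"
        using E0[OF r(1)] by simp
      finally show "\<bar>\<Sum>m\<in>pos_le x. (if fst r1 \<noteq> fst r2 \<and> Hset x r1 r2 m then c (lpf m) * ln (real (ppval r1)) else 0) -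
          (if Hset x r1 r2 m then c (lpf m) * ln (real (fst r1)) else 0)\<bar> \<le>
          x * (E r1 r2 * (1 / real (ppval r1) * (1 / real (ppval r2))))" .
    qed
    also have "\<dots> = x * (\<Sum>r1\<in>?PP. \<Sum>r2\<in>?PP. E r1 r2 * (1 / real (ppval r1) * (1 / real (ppval r2))))"
      by (simp only: sum_distrib_left)
    also have "(\<Sum>r1\<in>?PP. \<Sum>r2\<in>?PP. E r1 r2 * (1 / real (ppval r1) * (1 / real (ppval r2)))) =
        (\<Sum>r1\<in>?PP. (real (snd r1) - 1) * ln (real (fst r1)) / real (fst r1) ^ snd r1) * P +
        (\<Sum>r1\<in>?PP. \<Sum>r2\<in>?PP. if fst r1 = fst r2 then ln (real (fst r1)) / (real (fst r1) ^ snd r1 * real (fst r2) ^ snd r2) else 0)"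
      unfolding P_def sum_product sum.distrib[symmetric]
      by (intro sum.cong refl) (simp add: E_def ppval_def algebra_simps add_divide_distrib diff_divide_distrib)
    also have "x * \<dots> \<le> x * (4 * (124 * real K) + 4)"
      using P x sum_ppow_excess_le[of x] sum_ppow_same_prime_le[of x]
      by (intro mult_left_mono add_mono mult_mono) (simp_all add: case_prod_unfold)
    \<comment> \<open>With K >= 1, the 500 is 4 * 124 + 4.\<close>
    also have "\<dots> \<le> x * (500 * real K ^ 3)"
    proof (intro mult_left_mono)
      have "4 * (124 * real K) + 4 \<le> 500 * real K ^ 1" using K by simp
      also have "\<dots> \<le> 500 * real K ^ 3" using K power_increasing[of 1 3 "real K"] by (intro mult_left_mono) auto
      finally show "4 * (124 * real K) + 4 \<le> 500 * real K ^ 3" .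
    qed (use x in simp)
    finally have "\<bar>B - D\<bar> \<le> x * (500 * real K ^ 3)" .
    with boundA boundD have "\<bar>A + B\<bar> \<le> C * 124\<^sup>2 * real K ^ 3 * x + C * 124 * real K ^ 3 * x + x * (500 * real K ^ 3)"
      by linarith
    also have "\<dots> = (C * 124\<^sup>2 + C * 124 + 500) * real K ^ 3 * x" by (simp add: algebra_simps)
    finally show "\<bar>\<Sum>n\<in>pos_le x. F3 n\<bar> \<le> (C * 124\<^sup>2 + C * 124 + 500) * real K ^ 3 * x" unfolding F3 .
  qed
qed

text \<open>The weight enters through \<open>ln x = ln n + ln (x / n)\<close>: \<open>L\<close>
  collects the second part and is O(x), and \<open>G\<close> collects the integers with at most two
  prime factors.\<close>

lemma sum_c_P3_bound:
  "\<exists>C\<ge>0. \<forall>K x. 1 \<le> K \<and> 1 \<le> x \<and> x < 2 ^ 2 ^ K \<longrightarrow> \<bar>\<Sum>n\<in>pos_le x. c (P3 n)\<bar> * ln x \<le> C * real K ^ 3 * x"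
proof -
  obtain C where C: "C \<ge> 0" "\<And>K x. 1 \<le> K \<Longrightarrow> 0 < x \<Longrightarrow> x < 2 ^ 2 ^ K \<Longrightarrow> \<bar>\<Sum>n\<in>pos_le x. F3 n\<bar> \<le> C * real K ^ 3 * x"
    using sum_F3_bound by blast
  show ?thesis
  proof (intro exI[of _ "C + 10 * 125\<^sup>2 + 2"] conjI allI impI)
    show "C + 10 * 125\<^sup>2 + 2 \<ge> 0" using C by simp
  next
    fix K :: nat and x :: real assume Kx: "1 \<le> K \<and> 1 \<le> x \<and> x < 2 ^ 2 ^ K"
    then have K: "K \<ge> 1" and x: "x \<ge> 1" "x > 0" "x < 2 ^ 2 ^ K" by auto
    define G where "G = (\<Sum>n\<in>pos_le x. if card (prime_factors n) \<le> 2 then c (P3 n) * ln (real n) else 0)"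
    define L where "L = (\<Sum>n\<in>pos_le x. c (P3 n) * ln (x / real n))"
    have eq: "(\<Sum>n\<in>pos_le x. c (P3 n)) * ln x = (\<Sum>n\<in>pos_le x. F3 n) + G + L"
      unfolding G_def L_def sum_distrib_right sum.distrib[symmetric]
      using x by (intro sum.cong refl) (auto simp: F3_def ln_div algebra_simps)
    have "\<bar>L\<bar> \<le> (\<Sum>n\<in>pos_le x. ln (x / real n))"
      unfolding L_def
    proof (rule order_trans[OF sum_abs sum_mono])
      fix n assume n: "n \<in> pos_le x"
      then have "ln (x / real n) \<ge> 0" by (auto simp: field_simps)
      then show "\<bar>c (P3 n) * ln (x / real n)\<bar> \<le> ln (x / real n)"
        using abs_c_le[of "P3 n"] by (simp add: abs_mult mult_left_le_one_le)
    qed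
    also have "\<dots> \<le> 2 * x" by (intro sum_ln_div_le x)
    finally have L: "\<bar>L\<bar> \<le> 2 * x" .
    have "\<bar>G\<bar> \<le> (\<Sum>n\<in>pos_le x. if card (prime_factors n) \<le> 2 then ln (real n) else 0)"
      unfolding G_def
    proof (rule order_trans[OF sum_abs sum_mono])
      fix n
      show "\<bar>if card (prime_factors n) \<le> 2 then c (P3 n) * ln (real n) else 0\<bar> \<le>
          (if card (prime_factors n) \<le> 2 then ln (real n) else 0)"
        using abs_c_le[of "P3 n"] by (simp add: abs_mult mult_left_le_one_le)
    qed
    also have "\<dots> = (\<Sum>n | n \<in> pos_le x \<and> card (prime_factors n) \<le> 2. ln (real n))"
      by (rule sum.inter_filter[symmetric]) auto
    also have "\<dots> \<le> 10 * (125 * real K)\<^sup>2 * x"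
      by (intro sum_ln_card_prime_factors_le2 K x)
    finally have G: "\<bar>G\<bar> \<le> 10 * 125\<^sup>2 * real K ^ 2 * x" by (simp add: power_mult_distrib)
    have "1 \<le> real K ^ 3" "real K ^ 2 \<le> real K ^ 3"
      using K power_increasing[of 2 3 "real K"] by (auto simp: one_le_power)
    then have "2 * x \<le> 2 * real K ^ 3 * x" "10 * 125\<^sup>2 * real K ^ 2 * x \<le> 10 * 125\<^sup>2 * real K ^ 3 * x"
      using x by (auto intro!: mult_right_mono)
    then have "\<bar>(\<Sum>n\<in>pos_le x. c (P3 n)) * ln x\<bar> \<le> C * real K ^ 3 * x + 10 * 125\<^sup>2 * real K ^ 3 * x + 2 * real K ^ 3 * x"
      using C(2)[OF K x(2,3)] L G unfolding eq by linarith
    also have "\<dots> = (C + 10 * 125\<^sup>2 + 2) * real K ^ 3 * x" by (simp add: algebra_simps)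
    finally show "\<bar>\<Sum>n\<in>pos_le x. c (P3 n)\<bar> * ln x \<le> (C + 10 * 125\<^sup>2 + 2) * real K ^ 3 * x"
      using x by (simp add: abs_mult)
  qed
qed

end

section \<open>Dirichlet characters\<close>

text \<open>Characters are functions on all natural numbers that vanish exactly off the units. The
  value 1 at 1 follows, since it is a nonzero idempotent.\<close>

definition dcharacter :: "nat \<Rightarrow> (nat \<Rightarrow> complex) \<Rightarrow> bool" where
  "dcharacter l \<chi> \<longleftrightarrow> (\<forall>a b. \<chi> (a * b) = \<chi> a * \<chi> b) \<and> (\<forall>a. \<chi> (a mod l) = \<chi> a) \<and> (\<forall>a. \<chi> a = 0 \<longleftrightarrow> \<not> coprime a l)"

definition principal_dchar :: "nat \<Rightarrow> nat \<Rightarrow> complex" where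
  "principal_dchar l a = (if coprime a l then 1 else 0)"

lemma coprime_mod_left: "l > 0 \<Longrightarrow> coprime (a mod l) l \<longleftrightarrow> coprime a (l :: nat)"
  by simp

lemma power_totient_mult_mod: "coprime g l \<Longrightarrow> (g ^ totient l * x) mod l = x mod (l :: nat)"
  using euler_theorem[of g l] cong_scalar_right[of "g ^ totient l" 1 l x] by (simp add: unique_euclidean_semiring_class.cong_def)

text \<open>Characters are obtained as simultaneous eigenfunctions of the shifts \<open>f \<mapsto> f (g * _)\<close>;
  \<open>unit_proj\<close> is, up to a scalar, the projection onto an eigenspace of one shift.\<close>

definition periodic_on_units :: "nat \<Rightarrow> (nat \<Rightarrow> complex) \<Rightarrow> bool" where
  "periodic_on_units l f \<longleftrightarrow> (\<forall>x. f (x mod l) = f x) \<and> (\<forall>x. \<not> coprime x l \<longrightarrow> f x = 0)"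

definition unit_proj :: "nat \<Rightarrow> nat \<Rightarrow> complex \<Rightarrow> (nat \<Rightarrow> complex) \<Rightarrow> nat \<Rightarrow> complex" where
  "unit_proj l g \<mu> f x = (\<Sum>k<totient l. \<mu> ^ k * f (g ^ k * x))"

lemma periodic_on_units_cong: "periodic_on_units l f \<Longrightarrow> x mod l = y mod l \<Longrightarrow> f x = f y"
  unfolding periodic_on_units_def by metis

lemma periodic_on_units_proj:
  assumes "periodic_on_units l f" "coprime g l"
  shows "periodic_on_units l (unit_proj l g \<mu> f)"
  unfolding periodic_on_units_def
proof (intro conjI allI impI)
  fix x
  have "f (g ^ k * (x mod l)) = f (g ^ k * x)" for k
    using assms by (intro periodic_on_units_cong) (auto simp: mod_mult_right_eq)
  then show "unit_proj l g \<mu> f (x mod l) = unit_proj l g \<mu> f x" by (simp add: unit_proj_def)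
next
  fix x assume "\<not> coprime x l"
  then have "f (g ^ k * x) = 0" for k using assms by (auto simp: periodic_on_units_def)
  then show "unit_proj l g \<mu> f x = 0" by (simp add: unit_proj_def)
qed

text \<open>Shifting k by one multiplies every term by \<mu>. The last term wraps around because
  \<open>g ^ totient l\<close> is 1 modulo l and \<open>\<mu> ^ totient l = 1\<close>.\<close>

lemma unit_proj_eigen:
  assumes f: "periodic_on_units l f" and g: "coprime g l" and mu: "\<mu> ^ totient l = 1" and l: "l > 0"
  shows "unit_proj l g \<mu> f (g * x) = inverse \<mu> * unit_proj l g \<mu> f x"
proof -
  obtain n where n: "totient l = Suc n" using l by (metis totient_gt_0_iff gr0_implies_Suc)
  have mu0: "\<mu> \<noteq> 0" using mu n by auto
  have "\<mu> * unit_proj l g \<mu> f (g * x) = (\<Sum>k<Suc n. \<mu> ^ Suc k * f (g ^ Suc k * x))"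
    unfolding unit_proj_def n sum_distrib_left by (intro sum.cong) (auto simp: mult_ac)
  also have "\<dots> = (\<Sum>k<n. \<mu> ^ Suc k * f (g ^ Suc k * x)) + \<mu> ^ Suc n * f (g ^ Suc n * x)" by simp
  also have "\<mu> ^ Suc n * f (g ^ Suc n * x) = \<mu> ^ 0 * f (g ^ 0 * x)"
  proof -
    have "f (g ^ totient l * x) = f x"
      using periodic_on_units_cong[OF f power_totient_mult_mod[OF g]] .
    then show ?thesis using mu unfolding n by simp
  qed
  also have "(\<Sum>k<n. \<mu> ^ Suc k * f (g ^ Suc k * x)) + \<mu> ^ 0 * f (g ^ 0 * x) = unit_proj l g \<mu> f x"
    unfolding unit_proj_def n sum.lessThan_Suc_shift by (simp del: power_Suc)
  finally show ?thesis using mu0 by (simp add: field_simps)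
qed

lemma unit_proj_preserves_eigen:
  assumes "\<And>x. f (h * x) = \<nu> * f x"
  shows "unit_proj l g \<mu> f (h * x) = \<nu> * unit_proj l g \<mu> f x"
proof -
  have "f (g ^ k * (h * x)) = \<nu> * f (g ^ k * x)" for k
    using assms[of "g ^ k * x"] by (simp add: mult_ac)
  then show ?thesis by (simp add: unit_proj_def sum_distrib_left mult_ac)
qed

text \<open>Summation over the roots of unity kills every k > 0. So f is recovered from its
  projections, and a nonzero value of f forces one of them to be nonzero.\<close>

lemma sum_unit_proj:
  assumes l: "l > 0"
  shows "(\<Sum>\<mu> | \<mu> ^ totient l = 1. unit_proj l g \<mu> f x) = of_nat (totient l) * f x"
proof -
  define n where "n = totient l"
  have n: "n > 0" using l by (simp add: n_def)
  have bij: "bij_betw (\<lambda>k. cis (2 * pi * real k / real n)) {..<n} {z. z ^ n = 1}"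
    by (rule bij_betw_roots_unity[OF n])
  define w where "w = cis (2 * pi / real n)"
  have wj: "cis (2 * pi * real j / real n) = w ^ j" for j
    by (simp add: w_def DeMoivre mult_ac)
  have wn: "w ^ n = 1" using n by (simp add: w_def DeMoivre)
  have "(\<Sum>\<mu> | \<mu> ^ n = 1. unit_proj l g \<mu> f x) = (\<Sum>j<n. unit_proj l g (w ^ j) f x)"
    using sum.reindex_bij_betw[OF bij, of "\<lambda>\<mu>. unit_proj l g \<mu> f x"] by (simp add: wj)
  also have "\<dots> = (\<Sum>k<n. (\<Sum>j<n. (w ^ k) ^ j) * f (g ^ k * x))"
    unfolding unit_proj_def n_def[symmetric] sum_distrib_right
    by (subst sum.swap) (simp add: power_mult[symmetric] mult.commute)
  also have "\<dots> = (\<Sum>k<n. if k = 0 then of_nat n * f (g ^ k * x) else 0)"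
  proof (intro sum.cong refl)
    fix k assume k: "k \<in> {..<n}"
    show "(\<Sum>j<n. (w ^ k) ^ j) * f (g ^ k * x) = (if k = 0 then of_nat n * f (g ^ k * x) else 0)"
    proof (cases "k = 0")
      case False
      have "w ^ k \<noteq> 1"
      proof
        assume "w ^ k = 1"
        then have "w ^ k = w ^ 0" by simp
        then have "k = 0" using bij k n unfolding bij_betw_def inj_on_def wj by blast
        with False show False by simp
      qed
      moreover have "(w ^ k) ^ n = 1" using wn by (metis power_mult mult.commute power_one)
      ultimately show ?thesis using False by (simp add: geometric_sum)
    qed simp
  qed
  also have "\<dots> = of_nat n * f x" using n by simp
  finally show ?thesis by (simp add: n_def)
qed

text \<open>The shifts commute, so projecting for one more g keeps the eigenvalues already obtained,
  and \<open>sum_unit_proj\<close> provides a nonzero projection. The extra h with prescribed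
  eigenvalue \<nu> will fix the value of the character at one chosen residue.\<close>

lemma ex_simultaneous_eigenfunction:
  assumes "finite G" "\<forall>g\<in>G. coprime g l" "l > 0"
    and "periodic_on_units l f" "\<And>x. f (h * x) = \<nu> * f x" "f x0 \<noteq> 0"
  shows "\<exists>f'. periodic_on_units l f' \<and> (\<forall>x. f' (h * x) = \<nu> * f' x) \<and> (\<exists>x. f' x \<noteq> 0) \<and>
    (\<forall>g\<in>G. \<exists>\<kappa>. \<forall>x. f' (g * x) = \<kappa> * f' x)"
  using assms(1,2)
proof (induction G rule: finite_induct)
  case empty
  show ?case using assms(4,5,6) by (intro exI[of _ f] conjI) auto
next
  case (insert g G)
  have "\<forall>g\<in>G. coprime g l" using insert.prems by simp
  from insert.IH[OF this] obtain f' where f': "periodic_on_units l f'" "\<forall>x. f' (h * x) = \<nu> * f' x" "\<exists>x. f' x \<noteq> 0"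
    "\<forall>g\<in>G. \<exists>\<kappa>. \<forall>x. f' (g * x) = \<kappa> * f' x" by blast
  then obtain y where y: "f' y \<noteq> 0" by blast
  have g: "coprime g l" using insert by simp
  have "\<exists>\<mu>. \<mu> ^ totient l = 1 \<and> unit_proj l g \<mu> f' y \<noteq> 0"
  proof (rule ccontr)
    assume "\<not> ?thesis"
    then have "(\<Sum>\<mu> | \<mu> ^ totient l = 1. unit_proj l g \<mu> f' y) = 0" by (intro sum.neutral) auto
    then show False using y assms(3) by (simp add: sum_unit_proj)
  qed
  then obtain \<mu> where mu: "\<mu> ^ totient l = 1" "unit_proj l g \<mu> f' y \<noteq> 0" by blast
  let ?f = "unit_proj l g \<mu> f'"
  have "\<forall>x. ?f (h * x) = \<nu> * ?f x" using unit_proj_preserves_eigen[of f' h \<nu> l g \<mu>] f'(2) by simp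
  moreover have "\<exists>\<kappa>. \<forall>x. ?f (g' * x) = \<kappa> * ?f x" if "g' \<in> insert g G" for g'
  proof (cases "g' = g")
    case True
    have "\<forall>x. ?f (g * x) = inverse \<mu> * ?f x" by (intro allI unit_proj_eigen[OF f'(1) g mu(1) assms(3)])
    then show ?thesis unfolding True by (intro exI[of _ "inverse \<mu>"])
  next
    case False
    then have "g' \<in> G" using that by simp
    from bspec[OF f'(4) this] obtain \<kappa> where "\<forall>x. f' (g' * x) = \<kappa> * f' x" by (elim exE)
    then have "\<forall>x. ?f (g' * x) = \<kappa> * ?f x" using unit_proj_preserves_eigen[of f' g' \<kappa> l g \<mu>] by simp
    then show ?thesis by (intro exI[of _ \<kappa>])
  qed
  moreover have "\<exists>x. ?f x \<noteq> 0" using mu(2) by (intro exI[of _ y])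
  ultimately show ?case using periodic_on_units_proj[OF f'(1) g, of \<mu>] by (intro exI[of _ ?f] conjI ballI)
qed

text \<open>If only the eigenvalue 1 of the shift by a occurred, the delta function at 1 would be
  invariant under that shift and take equal values at a and 1. A simultaneous eigenfunction, divided
  by its value at 1, is the character.\<close>

lemma ex_dcharacter_neq_1:
  assumes l: "l > 0" and a: "coprime a l" and a1: "a mod l \<noteq> 1 mod l"
  shows "\<exists>\<chi>. dcharacter l \<chi> \<and> \<chi> a \<noteq> 1"
proof -
  define \<delta> :: "nat \<Rightarrow> complex" where "\<delta> = (\<lambda>x. if x mod l = 1 mod l then 1 else 0)"
  have \<delta>: "periodic_on_units l \<delta>"
    unfolding periodic_on_units_def
  proof (intro conjI allI impI)
    fix x assume "\<not> coprime x l"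
    then have "x mod l \<noteq> 1 mod l" using l by (metis coprime_mod_left coprime_1_left)
    then show "\<delta> x = 0" by (simp add: \<delta>_def)
  qed (simp add: \<delta>_def)
  have "\<exists>\<mu> x. \<mu> ^ totient l = 1 \<and> \<mu> \<noteq> 1 \<and> unit_proj l a \<mu> \<delta> x \<noteq> 0"
  proof (rule ccontr)
    assume no: "\<not> ?thesis"
    have "of_nat (totient l) * \<delta> x = unit_proj l a 1 \<delta> x" for x
    proof -
      have "finite {\<mu> :: complex. \<mu> ^ totient l = 1}" using l by (intro finite_roots_unity) (simp add: Suc_le_eq)
      then have "(\<Sum>\<mu> | \<mu> ^ totient l = 1. unit_proj l a \<mu> \<delta> x) = (\<Sum>\<mu>\<in>{1}. unit_proj l a \<mu> \<delta> x)"
        using no by (intro sum.mono_neutral_right) auto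
      then show ?thesis by (simp add: sum_unit_proj[OF l])
    qed
    moreover have "unit_proj l a 1 \<delta> (a * 1) = unit_proj l a 1 \<delta> 1"
      using unit_proj_eigen[OF \<delta> a _ l, of 1 1] by simp
    ultimately have "of_nat (totient l) * \<delta> (a * 1) = of_nat (totient l) * \<delta> 1" by metis
    then have "\<delta> a = \<delta> 1" using l by simp
    then show False using a1 by (simp add: \<delta>_def split: if_splits)
  qed
  then obtain \<mu> x0 where mu: "\<mu> ^ totient l = 1" "\<mu> \<noteq> 1" "unit_proj l a \<mu> \<delta> x0 \<noteq> 0" by blast
  let ?G = "{g. g < l \<and> coprime g l}"
  have "\<exists>f'. periodic_on_units l f' \<and> (\<forall>x. f' (a * x) = inverse \<mu> * f' x) \<and> (\<exists>x. f' x \<noteq> 0) \<and>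
    (\<forall>g\<in>?G. \<exists>\<kappa>. \<forall>x. f' (g * x) = \<kappa> * f' x)"
    by (rule ex_simultaneous_eigenfunction[OF _ _ l periodic_on_units_proj[OF \<delta> a, of \<mu>] unit_proj_eigen[OF \<delta> a mu(1) l] mu(3)]) auto
  then obtain f where f: "periodic_on_units l f" "\<And>x. f (a * x) = inverse \<mu> * f x" "\<exists>x. f x \<noteq> 0"
    "\<And>g. g < l \<Longrightarrow> coprime g l \<Longrightarrow> \<exists>\<kappa>. \<forall>x. f (g * x) = \<kappa> * f x" by blast
  have eig: "\<exists>\<kappa>. \<forall>x. f (g * x) = \<kappa> * f x" if g: "coprime g l" for g
  proof -
    obtain \<kappa> where \<kappa>: "\<And>x. f ((g mod l) * x) = \<kappa> * f x" using f(4)[of "g mod l"] g l by auto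
    have "f (g * x) = f ((g mod l) * x)" for x
      by (rule periodic_on_units_cong[OF f(1)]) (simp add: mod_mult_left_eq)
    then show ?thesis using \<kappa> by metis
  qed
  obtain y where y: "f y \<noteq> 0" using f(3) by blast
  then have "coprime y l" using f(1) by (auto simp: periodic_on_units_def)
  then obtain \<kappa> where "f (y * 1) = \<kappa> * f 1" using eig by blast
  with y have f1: "f 1 \<noteq> 0" by auto
  define \<chi> where "\<chi> = (\<lambda>x. f x / f 1)"
  have "dcharacter l \<chi>"
    unfolding dcharacter_def
  proof (intro conjI allI)
    fix u v
    show "\<chi> (u * v) = \<chi> u * \<chi> v"
    proof (cases "coprime u l")
      case True
      then obtain \<kappa> where \<kappa>: "\<And>x. f (u * x) = \<kappa> * f x" using eig by blast
      from \<kappa>[of 1] \<kappa>[of v] show ?thesis using f1 by (simp add: \<chi>_def)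
    next
      case False
      then have "\<not> coprime (u * v) l" by simp
      with False show ?thesis using f(1) by (simp add: \<chi>_def periodic_on_units_def)
    qed
  next
    fix u show "\<chi> (u mod l) = \<chi> u" using f(1) by (simp add: \<chi>_def periodic_on_units_def)
  next
    fix u show "\<chi> u = 0 \<longleftrightarrow> \<not> coprime u l"
    proof
      assume "\<not> coprime u l" then show "\<chi> u = 0" using f(1) by (simp add: \<chi>_def periodic_on_units_def)
    next
      assume u0: "\<chi> u = 0"
      show "\<not> coprime u l"
      proof
        assume cu: "coprime u l"
        then obtain \<kappa> where \<kappa>: "\<And>x. f (u * x) = \<kappa> * f x" using eig by blast
        have "f u = 0" using u0 f1 by (simp add: \<chi>_def)
        then have "\<kappa> = 0" using \<kappa>[of 1] f1 by simp
        \<comment> \<open>The argument is 1 modulo l, so a zero eigenvalue would make f vanish at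
          1.\<close>
        then have "f (u * u ^ (totient l - 1)) = 0" using \<kappa> by simp
        moreover have "u * u ^ (totient l - 1) = u ^ totient l * 1"
          using l by (simp add: power_eq_if)
        ultimately have "f 1 = 0"
          using periodic_on_units_cong[OF f(1) power_totient_mult_mod[OF cu, of 1]] by simp
        with f1 show False by simp
      qed
    qed
  qed
  moreover have "\<chi> a \<noteq> 1"
    using f(2)[of 1] f1 mu(2) by (simp add: \<chi>_def inverse_eq_1_iff)
  ultimately show ?thesis by blast
qed

section \<open>Values and orthogonality of characters\<close>

lemma dcharacter_mult: "dcharacter l \<chi> \<Longrightarrow> \<chi> (a * b) = \<chi> a * \<chi> b"
  and dcharacter_mod: "dcharacter l \<chi> \<Longrightarrow> \<chi> (a mod l) = \<chi> a"
  and dcharacter_eq_0_iff: "dcharacter l \<chi> \<Longrightarrow> \<chi> a = 0 \<longleftrightarrow> \<not> coprime a l"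
  by (auto simp: dcharacter_def)

lemma dcharacter_cong: "dcharacter l \<chi> \<Longrightarrow> a mod l = b mod l \<Longrightarrow> \<chi> a = \<chi> b"
  using dcharacter_mod[of l \<chi> a] dcharacter_mod[of l \<chi> b] by simp

lemma dcharacter_1 [simp]: "dcharacter l \<chi> \<Longrightarrow> \<chi> (Suc 0) = 1"
  using dcharacter_mult[of l \<chi> 1 1] dcharacter_eq_0_iff[of l \<chi> 1] by simp

lemma dcharacter_power: "dcharacter l \<chi> \<Longrightarrow> \<chi> (a ^ k) = \<chi> a ^ k"
  by (induction k) (simp_all add: dcharacter_mult)

lemma dcharacter_power_totient:
  assumes "dcharacter l \<chi>" "coprime a l"
  shows "\<chi> a ^ totient l = 1"
proof -
  have "\<chi> (a ^ totient l * 1) = \<chi> 1"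
    by (rule dcharacter_cong[OF assms(1)]) (rule power_totient_mult_mod[OF assms(2)])
  then show ?thesis using assms(1) by (simp add: dcharacter_power)
qed

lemma norm_dcharacter:
  assumes "dcharacter l \<chi>" "l > 0"
  shows "norm (\<chi> a) = (if coprime a l then 1 else 0)"
proof (cases "coprime a l")
  case True
  have "norm (\<chi> a) ^ totient l = 1"
    using dcharacter_power_totient[OF assms(1) True] by (metis norm_one norm_power)
  then have "norm (\<chi> a) = 1" using assms(2) power_eq_imp_eq_base[of "norm (\<chi> a)" "totient l" 1] by simp
  with True show ?thesis by simp
next
  case False
  then show ?thesis using dcharacter_eq_0_iff[OF assms(1)] by simp
qed

lemma norm_dcharacter_le: "dcharacter l \<chi> \<Longrightarrow> l > 0 \<Longrightarrow> norm (\<chi> a) \<le> 1"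
  by (simp add: norm_dcharacter)

lemma dcharacter_principal: "l > 0 \<Longrightarrow> dcharacter l (principal_dchar l)"
  by (auto simp: dcharacter_def principal_dchar_def)

lemma dcharacter_times:
  "dcharacter l \<chi> \<Longrightarrow> dcharacter l \<psi> \<Longrightarrow> dcharacter l (\<lambda>a. \<chi> a * \<psi> a)"
  by (auto simp: dcharacter_def)

lemma dcharacter_cnj: "dcharacter l \<chi> \<Longrightarrow> dcharacter l (\<lambda>a. cnj (\<chi> a))"
  by (auto simp: dcharacter_def)

lemma dcharacter_mult_cnj:
  assumes "dcharacter l \<chi>" "l > 0"
  shows "\<chi> a * cnj (\<chi> a) = principal_dchar l a"
  using norm_dcharacter[OF assms, of a] by (simp add: complex_norm_square[symmetric] principal_dchar_def)

lemma dcharacter_times_principal: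
  "dcharacter l \<chi> \<Longrightarrow> principal_dchar l a * \<chi> a = \<chi> a"
  by (auto simp: principal_dchar_def dcharacter_eq_0_iff)

lemma bij_betw_mult_mod:
  assumes "coprime b l" "l > (0::nat)"
  shows "bij_betw (\<lambda>a. (a * b) mod l) {..<l} {..<l}"
proof -
  have "inj_on (\<lambda>a. (a * b) mod l) {..<l}"
  proof (rule inj_onI)
    fix x y assume *: "x \<in> {..<l}" "y \<in> {..<l}" "(x * b) mod l = (y * b) mod l"
    then have "[x * b = y * b] (mod l)" by (simp add: unique_euclidean_semiring_class.cong_def)
    then have "[x = y] (mod l)" using assms cong_mult_rcancel_nat by blast
    then show "x = y" using * by (simp add: unique_euclidean_semiring_class.cong_def)
  qed
  moreover have "(\<lambda>a. (a * b) mod l) ` {..<l} \<subseteq> {..<l}" using assms by auto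
  ultimately show ?thesis unfolding bij_betw_def using endo_inj_surj[of "{..<l}"] by blast
qed

text \<open>Multiplication by a unit b permutes the residues, so the sum is unchanged when
  multiplied by \<open>\<chi> b\<close>, and b can be chosen with this value different from
  1.\<close>

lemma sum_dcharacter_nonprincipal:
  assumes "dcharacter l \<chi>" "\<chi> \<noteq> principal_dchar l" "l > 0"
  shows "(\<Sum>a<l. \<chi> a) = 0"
proof -
  obtain b where b: "\<chi> b \<noteq> principal_dchar l b" using assms(2) by blast
  then have cb: "coprime b l" "\<chi> b \<noteq> 1"
    using dcharacter_eq_0_iff[OF assms(1), of b] by (auto simp: principal_dchar_def split: if_splits)
  have "(\<Sum>a<l. \<chi> a) = (\<Sum>a<l. \<chi> ((a * b) mod l))"
    by (rule sum.reindex_bij_betw[symmetric]) (rule bij_betw_mult_mod[OF cb(1) assms(3)])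
  also have "\<dots> = (\<Sum>a<l. \<chi> a) * \<chi> b"
    by (simp add: dcharacter_mod[OF assms(1)] dcharacter_mult[OF assms(1)] sum_distrib_right)
  finally have "(\<Sum>a<l. \<chi> a) * (\<chi> b - 1) = 0" by (simp add: algebra_simps)
  then show ?thesis using cb by simp
qed

definition dchars :: "nat \<Rightarrow> (nat \<Rightarrow> complex) set" where
  "dchars l = {\<chi>. dcharacter l \<chi>}"

lemma finite_dchars:
  assumes "l > 0"
  shows "finite (dchars l)"
proof -
  let ?R = "insert 0 {z :: complex. z ^ totient l = 1}"
  have fin: "finite (PiE {..<l} (\<lambda>_. ?R))"
    using assms by (intro finite_PiE finite.insertI finite_roots_unity) (auto simp: Suc_le_eq)
  have "dchars l \<subseteq> (\<lambda>g a. g (a mod l)) ` PiE {..<l} (\<lambda>_. ?R)"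
  proof
    fix \<chi> assume "\<chi> \<in> dchars l"
    then have \<chi>: "dcharacter l \<chi>" by (simp add: dchars_def)
    show "\<chi> \<in> (\<lambda>g a. g (a mod l)) ` PiE {..<l} (\<lambda>_. ?R)"
    proof (rule image_eqI)
      show "\<chi> = (\<lambda>a. restrict \<chi> {..<l} (a mod l))" using assms dcharacter_mod[OF \<chi>] by (auto simp: fun_eq_iff)
      show "restrict \<chi> {..<l} \<in> PiE {..<l} (\<lambda>_. ?R)"
        using dcharacter_power_totient[OF \<chi>] dcharacter_eq_0_iff[OF \<chi>] by (intro restrict_PiE_iff[THEN iffD2]) auto
    qed
  qed
  then show ?thesis using fin by (rule finite_surj[rotated])
qed

text \<open>Multiplication by a character \<psi> with \<open>\<psi> a \<noteq> 1\<close> permutes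
  the characters; its conjugate provides the inverse map.\<close>

lemma sum_dchars_eq_0:
  assumes "l > 0" "a mod l \<noteq> 1 mod l"
  shows "(\<Sum>\<chi>\<in>dchars l. \<chi> a) = 0"
proof (cases "coprime a l")
  case True
  obtain \<psi> where \<psi>: "dcharacter l \<psi>" "\<psi> a \<noteq> 1" using ex_dcharacter_neq_1[OF assms(1) True assms(2)] by blast
  have bij: "bij_betw (\<lambda>\<chi> b. \<psi> b * \<chi> b) (dchars l) (dchars l)"
  proof (rule bij_betwI[where g = "\<lambda>\<chi> b. cnj (\<psi> b) * \<chi> b"])
    show "(\<lambda>\<chi> b. \<psi> b * \<chi> b) \<in> dchars l \<rightarrow> dchars l" "(\<lambda>\<chi> b. cnj (\<psi> b) * \<chi> b) \<in> dchars l \<rightarrow> dchars l"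
      using \<psi>(1) by (auto simp: dchars_def intro: dcharacter_times dcharacter_cnj)
    have eq: "cnj (\<psi> b) * (\<psi> b * \<chi> b) = \<chi> b" "\<psi> b * (cnj (\<psi> b) * \<chi> b) = \<chi> b" if "\<chi> \<in> dchars l" for \<chi> b
    proof -
      have "\<psi> b * cnj (\<psi> b) * \<chi> b = \<chi> b"
        using that dcharacter_mult_cnj[OF \<psi>(1) assms(1)] dcharacter_times_principal[of l \<chi> b] by (simp add: dchars_def)
      then show "cnj (\<psi> b) * (\<psi> b * \<chi> b) = \<chi> b" "\<psi> b * (cnj (\<psi> b) * \<chi> b) = \<chi> b" by (simp_all add: mult_ac)
    qed
    show "(\<lambda>b. cnj (\<psi> b) * (\<psi> b * \<chi> b)) = \<chi>" "(\<lambda>b. \<psi> b * (cnj (\<psi> b) * \<chi> b)) = \<chi>" if "\<chi> \<in> dchars l" for \<chi>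
      using eq[OF that] by (simp_all add: fun_eq_iff)
  qed
  have "(\<Sum>\<chi>\<in>dchars l. \<chi> a) = (\<Sum>\<chi>\<in>dchars l. \<psi> a * \<chi> a)"
    using sum.reindex_bij_betw[OF bij, of "\<lambda>\<chi>. \<chi> a"] by simp
  also have "\<dots> = \<psi> a * (\<Sum>\<chi>\<in>dchars l. \<chi> a)" by (simp add: sum_distrib_left)
  finally have "(\<psi> a - 1) * (\<Sum>\<chi>\<in>dchars l. \<chi> a) = 0" by (simp add: algebra_simps)
  then show ?thesis using \<psi> by simp
next
  case False
  then show ?thesis by (intro sum.neutral) (auto simp: dchars_def dcharacter_eq_0_iff)
qed

lemma card_coprime_less:
  assumes "l \<ge> 2"
  shows "card {a. a < l \<and> coprime a l} = totient l"
proof -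
  have "{a. a < l \<and> coprime a l} = totatives l"
    using assms totatives_less[of _ l] by (auto simp: in_totatives_iff intro!: Nat.gr0I)
  then show ?thesis by (simp add: totient_def)
qed

text \<open>The sum of \<open>\<chi> a\<close> over all characters and residues is evaluated twice:
  for fixed a only a = 1 contributes, for fixed \<chi> only the principal character.\<close>

lemma card_dchars:
  assumes "l \<ge> 2"
  shows "card (dchars l) = totient l"
proof -
  have l: "l > 0" using assms by simp
  have fin: "finite (dchars l)" by (rule finite_dchars[OF l])
  have "(\<Sum>a<l. \<Sum>\<chi>\<in>dchars l. \<chi> a) = (\<Sum>a<l. if a = 1 then of_nat (card (dchars l)) else 0)"
  proof (intro sum.cong refl)
    fix a assume a: "a \<in> {..<l}"
    show "(\<Sum>\<chi>\<in>dchars l. \<chi> a) = (if a = 1 then of_nat (card (dchars l)) else 0)"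
    proof (cases "a = 1")
      case True
      have "(\<Sum>\<chi>\<in>dchars l. \<chi> a) = (\<Sum>\<chi>\<in>dchars l. 1)"
        using True by (intro sum.cong) (auto simp: dchars_def)
      then show ?thesis using True by simp
    next
      case False
      then have "a mod l \<noteq> 1 mod l" using a assms by simp
      then show ?thesis using sum_dchars_eq_0[OF l] False by simp
    qed
  qed
  also have "\<dots> = of_nat (card (dchars l))" using assms by (subst sum.delta) auto
  finally have 1: "(\<Sum>\<chi>\<in>dchars l. \<Sum>a<l. \<chi> a) = of_nat (card (dchars l))" by (subst sum.swap)
  have "(\<Sum>\<chi>\<in>dchars l. \<Sum>a<l. \<chi> a) = (\<Sum>\<chi>\<in>dchars l. if \<chi> = principal_dchar l then of_nat (totient l) else 0)"
  proof (intro sum.cong refl)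
    fix \<chi> assume \<chi>: "\<chi> \<in> dchars l"
    show "(\<Sum>a<l. \<chi> a) = (if \<chi> = principal_dchar l then of_nat (totient l) else 0)"
    proof (cases "\<chi> = principal_dchar l")
      case True
      have "(\<Sum>a<l. principal_dchar l a) = (\<Sum>a\<in>{a\<in>{..<l}. coprime a l}. 1)"
        unfolding principal_dchar_def by (rule sum.inter_filter[symmetric]) auto
      also have "\<dots> = of_nat (totient l)" using card_coprime_less[OF assms] by simp
      finally show ?thesis using True by simp
    next
      case False
      then show ?thesis using \<chi> l sum_dcharacter_nonprincipal by (simp add: dchars_def)
    qed
  qed
  also have "\<dots> = of_nat (totient l)"
    using fin dcharacter_principal[OF l] by (subst sum.delta) (auto simp: dchars_def)
  finally have "(of_nat (card (dchars l)) :: complex) = of_nat (totient l)" using 1 by simp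
  then show ?thesis by (simp only: of_nat_eq_iff)
qed

lemma sum_dchars:
  assumes "l \<ge> 2"
  shows "(\<Sum>\<chi>\<in>dchars l. \<chi> a) = (if a mod l = 1 then of_nat (totient l) else 0)"
proof (cases "a mod l = 1")
  case True
  have "(\<Sum>\<chi>\<in>dchars l. \<chi> a) = (\<Sum>\<chi>\<in>dchars l. 1)"
  proof (intro sum.cong refl)
    fix \<chi> assume "\<chi> \<in> dchars l"
    then have \<chi>: "dcharacter l \<chi>" by (simp add: dchars_def)
    have "\<chi> a = \<chi> 1" using True assms by (intro dcharacter_cong[OF \<chi>]) simp
    then show "\<chi> a = 1" using \<chi> by simp
  qed
  then show ?thesis using True card_dchars[OF assms] by simp
next
  case False
  then show ?thesis using sum_dchars_eq_0[of l a] assms by simp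
qed

text \<open>Full periods cancel, so fewer than l terms of absolute value at most 1 remain.\<close>

lemma norm_sum_dcharacter_le:
  assumes "dcharacter l \<chi>" "\<chi> \<noteq> principal_dchar l" "l > 0"
  shows "norm (\<Sum>n<N. \<chi> n) \<le> real l"
proof -
  have "(\<Sum>n<q * l + r. \<chi> n) = (\<Sum>n<r. \<chi> n)" for q r
  proof (induction q)
    case (Suc q)
    have "(\<Sum>n<Suc q * l + r. \<chi> n) = (\<Sum>n<l. \<chi> n) + (\<Sum>n<q * l + r. \<chi> (l + n))"
    proof -
      have "(\<Sum>n<l + m. \<chi> n) = (\<Sum>n<l. \<chi> n) + (\<Sum>n<m. \<chi> (l + n))" for m
        by (induction m) (simp_all add: add_ac)
      from this[of "q * l + r"] show ?thesis by (simp add: add_ac)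
    qed
    also have "(\<Sum>n<q * l + r. \<chi> (l + n)) = (\<Sum>n<q * l + r. \<chi> n)"
      by (intro sum.cong refl dcharacter_cong[OF assms(1)]) simp
    finally show ?case using Suc.IH sum_dcharacter_nonprincipal[OF assms] by simp
  qed simp
  from this[of "N div l" "N mod l"] have "(\<Sum>n<N. \<chi> n) = (\<Sum>n<N mod l. \<chi> n)" by simp
  also have "norm \<dots> \<le> (\<Sum>n<N mod l. 1)"
    by (rule order_trans[OF norm_sum sum_mono]) (rule norm_dcharacter_le[OF assms(1,3)])
  also have "\<dots> \<le> real l" using assms(3) by (simp add: less_imp_le)
  finally show ?thesis .
qed

section \<open>Dirichlet L-series at 1\<close>

text \<open>The case t = 0 of the rough divisor sum: every positive integer is 0-rough and only 1 is
  0-smooth.\<close>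

lemma sum_moebius_divisors:
  assumes "n > 0"
  shows "(\<Sum>d | d dvd n. moebius d) = (if n = 1 then 1 else 0)"
proof -
  have "(\<Sum>d | d dvd n. moebius d) = (\<Sum>d | d dvd n. if rough 0 d then moebius d else 0)"
    using assms by (intro sum.cong refl) (auto simp: rough_def in_prime_factors_iff dest: prime_gt_0_nat intro!: Nat.gr0I)
  also have "smooth 0 n \<longleftrightarrow> n = 1"
    using assms smooth_iff_lpf_le[of n 0] prime_gt_0_nat[OF prime_lpf[of n]] by (cases "n = 1") auto
  ultimately show ?thesis using sum_moebius_rough_divisors[OF assms, of 0] by simp
qed

lemma sum_disjoint_Un:
  "A = B \<union> C \<Longrightarrow> B \<inter> C = {} \<Longrightarrow> finite B \<Longrightarrow> finite C \<Longrightarrow> sum f A = sum f B + sum f C"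
  using sum.union_disjoint[of B C f] by blast

lemma ln_div_self_antimono:
  assumes "n \<ge> 3"
  shows "ln (real (Suc n)) / real (Suc n) \<le> ln (real n) / real n"
proof -
  have "exp (1::real) \<le> 3" by (rule exp_le)
  then have "1 \<le> ln (3::real)" by (simp add: ln_ge_iff)
  also have "\<dots> \<le> ln (real n)" using assms by simp
  finally have "1 \<le> ln (real n)" .
  moreover have "real n * (ln (real (Suc n)) - ln (real n)) \<le> real n * (1 / real n)"
    using assms by (intro mult_left_mono ln_Suc_diff_le) auto
  ultimately have "real n * ln (real (Suc n)) \<le> real (Suc n) * ln (real n)"
    using assms by (simp add: algebra_simps)
  then show ?thesis using assms by (simp add: field_simps)
qed

section \<open>Partial sums for a nonprincipal character\<close>

locale nonprincipal_dchar =
  fixes l :: nat and \<chi> :: "nat \<Rightarrow> complex"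
  assumes l_pos: "l > 0" and dchar: "dcharacter l \<chi>" and nonprincipal: "\<chi> \<noteq> principal_dchar l"
begin

lemmas mult = dcharacter_mult[OF dchar]
lemmas norm_le_1 = norm_dcharacter_le[OF dchar l_pos]

lemma chi_1 [simp]: "\<chi> (Suc 0) = 1"
  using dchar by (rule dcharacter_1)

lemma norm_sum_interval_le: "norm (\<Sum>n=m..N. \<chi> n) \<le> 2 * real l"
proof (cases "m \<le> Suc N")
  case True
  have "(\<Sum>n<Suc N. \<chi> n) = (\<Sum>n<m. \<chi> n) + (\<Sum>n=m..N. \<chi> n)"
    by (rule sum_disjoint_Un) (use True in auto)
  then have "(\<Sum>n=m..N. \<chi> n) = (\<Sum>n<Suc N. \<chi> n) - (\<Sum>n<m. \<chi> n)" by (simp add: algebra_simps)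
  also have "norm \<dots> \<le> real l + real l"
    by (intro order_trans[OF norm_triangle_ineq4] add_mono norm_sum_dcharacter_le[OF dchar nonprincipal l_pos])
  finally show ?thesis by simp
qed simp

text \<open>Dirichlet's test with an explicit constant: partial summation of bounded character sums
  against a decreasing function.\<close>

lemma norm_sum_weighted_le:
  fixes f :: "nat \<Rightarrow> real"
  assumes f: "\<And>n. n \<ge> m \<Longrightarrow> f (Suc n) \<le> f n" "\<And>n. n \<ge> m \<Longrightarrow> f n \<ge> 0"
  shows "norm (\<Sum>n=m..N. \<chi> n * of_real (f n)) \<le> 2 * real l * f m"
proof (cases "m \<le> N")
  case True
  define S where "S = (\<lambda>N. \<Sum>n=m..N. \<chi> n)"
  have "norm ((\<Sum>n=m..N. \<chi> n * of_real (f n)) - S N * of_real (f N)) \<le> 2 * real l * (f m - f N)"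
    using True
  proof (induction N rule: dec_induct)
    case base
    show ?case by (simp add: S_def)
  next
    case (step N)
    have "(\<Sum>n=m..Suc N. \<chi> n * of_real (f n)) - S (Suc N) * of_real (f (Suc N)) =
        ((\<Sum>n=m..N. \<chi> n * of_real (f n)) - S N * of_real (f N)) + S N * of_real (f N - f (Suc N))"
      using step.hyps by (simp add: S_def algebra_simps)
    also have "norm \<dots> \<le> 2 * real l * (f m - f N) + 2 * real l * (f N - f (Suc N))"
    proof (intro order_trans[OF norm_triangle_ineq] add_mono step.IH)
      have "norm (S N * of_real (f N - f (Suc N))) = norm (S N) * (f N - f (Suc N))"
        using f(1)[of N] step.hyps by (simp only: norm_mult norm_of_real) simp
      also have "\<dots> \<le> 2 * real l * (f N - f (Suc N))"
        using f(1)[of N] step.hyps norm_sum_interval_le[of m N] by (intro mult_right_mono) (auto simp: S_def)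
      finally show "norm (S N * of_real (f N - f (Suc N))) \<le> 2 * real l * (f N - f (Suc N))" .
    qed
    finally show ?case by (simp add: algebra_simps)
  qed
  moreover have "norm (S N * of_real (f N)) \<le> 2 * real l * f N"
    using f(2)[OF True] norm_sum_interval_le[of m N] by (simp add: norm_mult S_def mult_right_mono)
  ultimately show ?thesis
    using norm_triangle_ineq[of "(\<Sum>n=m..N. \<chi> n * of_real (f n)) - S N * of_real (f N)" "S N * of_real (f N)"]
    by (simp add: algebra_simps)
next
  case False
  then show ?thesis using f(2)[of m] by simp
qed

definition Lsum :: "real \<Rightarrow> complex" where
  "Lsum z = (\<Sum>n\<in>pos_le z. \<chi> n / of_nat n)"

lemma Lsum_nat_diff_le: "M \<ge> N \<Longrightarrow> norm (Lsum (real M) - Lsum (real N)) \<le> 2 * real l / real (Suc N)"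
proof -
  assume "M \<ge> N"
  then have "Lsum (real M) = Lsum (real N) + (\<Sum>n=Suc N..M. \<chi> n / of_nat n)"
    unfolding Lsum_def pos_le_of_nat by (intro sum_disjoint_Un) auto
  then have "norm (Lsum (real M) - Lsum (real N)) = norm (\<Sum>n=Suc N..M. \<chi> n * of_real (1 / real n))"
    by simp
  also have "\<dots> \<le> 2 * real l * (1 / real (Suc N))"
    by (rule norm_sum_weighted_le) (auto intro!: divide_left_mono)
  finally show ?thesis by simp
qed

lemma ex_L: "\<exists>L. \<forall>z>0. norm (Lsum z - L) \<le> 2 * real l / z"
proof -
  have "Cauchy (\<lambda>N. Lsum (real N))"
  proof (rule CauchyI)
    fix e :: real assume e: "e > 0"
    obtain N0 where N0: "2 * real l / e < real N0" using reals_Archimedean2 by blast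
    have le: "2 * real l / real (Suc N) < e" if "N \<ge> N0" for N
    proof -
      have "2 * real l / e < real (Suc N)" using N0 that by linarith
      then show ?thesis using e by (simp add: field_simps)
    qed
    show "\<exists>M. \<forall>m\<ge>M. \<forall>n\<ge>M. norm (Lsum (real m) - Lsum (real n)) < e"
    proof (intro exI[of _ N0] allI impI)
      fix m n assume mn: "m \<ge> N0" "n \<ge> N0"
      show "norm (Lsum (real m) - Lsum (real n)) < e"
      proof (cases "n \<le> m")
        case True
        then show ?thesis using Lsum_nat_diff_le[of n m] le[OF mn(2)] by linarith
      next
        case False
        then show ?thesis using Lsum_nat_diff_le[of m n] le[OF mn(1)] by (simp add: norm_minus_commute)
      qed
    qed
  qed
  then obtain L where L: "(\<lambda>N. Lsum (real N)) \<longlonglongrightarrow> L"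
    using Cauchy_convergent convergent_def by blast
  have N: "norm (Lsum (real N) - L) \<le> 2 * real l / real (Suc N)" for N
  proof -
    have "(\<lambda>M. norm (Lsum (real M) - Lsum (real N))) \<longlonglongrightarrow> norm (L - Lsum (real N))"
      by (intro tendsto_intros L)
    then have "norm (L - Lsum (real N)) \<le> 2 * real l / real (Suc N)"
      by (rule LIMSEQ_le_const2) (use Lsum_nat_diff_le in blast)
    then show ?thesis by (simp add: norm_minus_commute)
  qed
  have "norm (Lsum z - L) \<le> 2 * real l / z" if z: "z > 0" for z
  proof -
    let ?N = "nat \<lfloor>z\<rfloor>"
    have "Lsum z = Lsum (real ?N)" unfolding Lsum_def pos_le_altdef by simp
    moreover have "2 * real l / real (Suc ?N) \<le> 2 * real l / z"
    proof (rule divide_left_mono)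
      show "z \<le> real (Suc ?N)" using z by linarith
      show "0 < real (Suc ?N) * z" using z by (intro mult_pos_pos) linarith+
    qed simp
    ultimately show ?thesis using N[of ?N] by simp
  qed
  then show ?thesis by blast
qed

text \<open>This is the value of the Dirichlet series at 1. It is selected by its rate of
  approximation, the form in which it is used later.\<close>

definition L :: complex where
  "L = (SOME L. \<forall>z>0. norm (Lsum z - L) \<le> 2 * real l / z)"

lemma Lsum_approx: "z > 0 \<Longrightarrow> norm (Lsum z - L) \<le> 2 * real l / z"
  using someI_ex[OF ex_L] unfolding L_def by blast

text \<open>Up to sign, \<open>Lln\<close> and \<open>LLam\<close> are the partial sums at 1 of the
  derivative and of the logarithmic derivative of the Dirichlet series.\<close>

definition Lln :: "real \<Rightarrow> complex" where
  "Lln z = (\<Sum>n\<in>pos_le z. \<chi> n / of_nat n * of_real (ln (real n)))"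

definition LLam :: "real \<Rightarrow> complex" where
  "LLam z = (\<Sum>n\<in>pos_le z. \<chi> n / of_nat n * of_real (mangoldt n))"

text \<open>\<open>ln n / n\<close> decreases only from n = 3 on, so the terms with n < 3 are
  bounded separately, by 2.\<close>

lemma norm_Lln_le: "norm (Lln z) \<le> 2 * real l + 2"
proof -
  let ?N = "nat \<lfloor>z\<rfloor>"
  have small: "norm (\<Sum>n\<in>{1..<3} \<inter> {1..?N}. \<chi> n / of_nat n * of_real (ln (real n))) \<le> 2"
  proof -
    have "norm (\<Sum>n\<in>{1..<3} \<inter> {1..?N}. \<chi> n / of_nat n * of_real (ln (real n))) \<le> (\<Sum>n\<in>{1..<3} \<inter> {1..?N}. 1)"
    proof (rule order_trans[OF norm_sum sum_mono])
      fix n assume n: "n \<in> {1..<3} \<inter> {1..?N}"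
      then have "ln (real n) \<le> real n" using ln_le_minus_one[of "real n"] by auto
      then have "norm (\<chi> n) * (ln (real n) / real n) \<le> 1 * 1"
        using n by (intro mult_mono norm_le_1) auto
      then show "norm (\<chi> n / of_nat n * of_real (ln (real n))) \<le> 1" by (simp add: norm_mult norm_divide)
    qed
    also have "\<dots> \<le> real (card {1..<3::nat})" by (simp only: sum_constant mult_1_right) (intro of_nat_mono card_mono; auto)
    finally show ?thesis by simp
  qed
  have "Lln z = (\<Sum>n\<in>{1..<3} \<inter> {1..?N}. \<chi> n / of_nat n * of_real (ln (real n))) + (\<Sum>n=3..?N. \<chi> n / of_nat n * of_real (ln (real n)))"
    unfolding Lln_def pos_le_altdef by (intro sum_disjoint_Un) auto
  moreover have "norm (\<Sum>n=3..?N. \<chi> n / of_nat n * of_real (ln (real n))) \<le> 2 * real l"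
  proof -
    have "norm (\<Sum>n=3..?N. \<chi> n * of_real (ln (real n) / real n)) \<le> 2 * real l * (ln (real 3) / real 3)"
      by (rule norm_sum_weighted_le[where f = "\<lambda>n. ln (real n) / real n"]) (auto intro: ln_div_self_antimono[unfolded of_nat_Suc] simp: ln_div_self_antimono)
    also have "\<dots> \<le> 2 * real l * 1" using ln_le_minus_one[of 3] by (intro mult_left_mono) auto
    finally show ?thesis by simp
  qed
  ultimately show ?thesis using small by (smt (verit) norm_triangle_ineq)
qed

lemma Lln_eq: "Lln z = (\<Sum>d\<in>pos_le z. \<chi> d / of_nat d * of_real (mangoldt d) * Lsum (z / real d))"
proof -
  have "Lln z = (\<Sum>n\<in>pos_le z. \<Sum>d | d dvd n. \<chi> (d * (n div d)) / of_nat (d * (n div d)) * of_real (mangoldt d))"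
    unfolding Lln_def
  proof (intro sum.cong refl)
    fix n assume n: "n \<in> pos_le z"
    have "(\<Sum>d | d dvd n. \<chi> (d * (n div d)) / of_nat (d * (n div d)) * of_real (mangoldt d)) =
        (\<Sum>d | d dvd n. \<chi> n / of_nat n * of_real (mangoldt d))"
      by (intro sum.cong) auto
    also have "\<dots> = \<chi> n / of_nat n * of_real (\<Sum>d | d dvd n. mangoldt d)"
      by (simp add: sum_distrib_left)
    also have "(\<Sum>d | d dvd n. mangoldt d) = ln (real n)" using n by (simp add: mangoldt_sum)
    finally show "\<chi> n / of_nat n * of_real (ln (real n)) =
        (\<Sum>d | d dvd n. \<chi> (d * (n div d)) / of_nat (d * (n div d)) * of_real (mangoldt d))" ..
  qed
  also have "\<dots> = (\<Sum>d\<in>pos_le z. \<Sum>k\<in>pos_le (z / real d). \<chi> (d * k) / of_nat (d * k) * of_real (mangoldt d))"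
    by (rule sum_divisors_swap)
  also have "\<dots> = (\<Sum>d\<in>pos_le z. \<chi> d / of_nat d * of_real (mangoldt d) * Lsum (z / real d))"
    unfolding Lsum_def sum_distrib_left by (intro sum.cong refl) (simp add: mult)
  finally show ?thesis .
qed

text \<open>Replacing \<open>Lsum (z / d)\<close> by \<open>L\<close> in \<open>Lln_eq\<close> costs
  at most \<open>2 * l * d / z\<close> for each d, in total
  \<open>2 * l * psi z / z \<le> 20 * l\<close>; the bounded \<open>Lln\<close> adds
  \<open>2 * l + 2\<close>.\<close>

lemma norm_LLam_le_if_L_nonzero:
  assumes "L \<noteq> 0" "z \<ge> 1"
  shows "norm (LLam z) \<le> (22 * real l + 2) / norm L"
proof -
  have "L * LLam z = Lln z - (\<Sum>d\<in>pos_le z. \<chi> d / of_nat d * of_real (mangoldt d) * (Lsum (z / real d) - L))"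
    unfolding Lln_eq LLam_def by (simp add: sum_distrib_left right_diff_distrib sum_subtractf mult_ac)
  then have "norm L * norm (LLam z) \<le> norm (Lln z) + norm (\<Sum>d\<in>pos_le z. \<chi> d / of_nat d * of_real (mangoldt d) * (Lsum (z / real d) - L))"
    by (simp only: norm_mult[symmetric] norm_triangle_ineq4)
  also have "norm (\<Sum>d\<in>pos_le z. \<chi> d / of_nat d * of_real (mangoldt d) * (Lsum (z / real d) - L)) \<le>
      (\<Sum>d\<in>pos_le z. 2 * real l / z * mangoldt d)"
  proof (rule order_trans[OF norm_sum sum_mono])
    fix d assume d: "d \<in> pos_le z"
    then have "norm (Lsum (z / real d) - L) \<le> 2 * real l / (z / real d)" using assms by (intro Lsum_approx) auto
    then have "norm (\<chi> d) * (mangoldt d / real d) * norm (Lsum (z / real d) - L) \<le> 1 * (mangoldt d / real d) * (2 * real l / (z / real d))"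
      by (intro mult_mono norm_le_1) (auto simp: mangoldt_nonneg)
    then show "norm (\<chi> d / of_nat d * of_real (mangoldt d) * (Lsum (z / real d) - L)) \<le> 2 * real l / z * mangoldt d"
      using d by (simp add: norm_mult norm_divide mult_ac)
  qed
  also have "\<dots> = 2 * real l / z * psi z" by (simp add: psi_def sum_distrib_left)
  also have "\<dots> \<le> 2 * real l / z * (10 * z)" using assms by (intro mult_left_mono psi_le) auto
  also have "\<dots> = 20 * real l" using assms by simp
  finally have "norm L * norm (LLam z) \<le> 22 * real l + 2" using norm_Lln_le[of z] by linarith
  then show ?thesis using assms by (simp add: field_simps)
qed

text \<open>Complete multiplicativity turns the summand into \<open>moebius d\<close> times a
  function of n = d m, so only n = 1 survives. The function h will be both \<open>ln (z / k)\<close>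
  and the constant 1.\<close>

lemma moebius_inversion_sum:
  assumes "z \<ge> 1"
  shows "(\<Sum>d\<in>pos_le z. of_real (moebius d) * \<chi> d / of_nat d * (\<Sum>m\<in>pos_le (z / real d). \<chi> m / of_nat m * h (d * m))) = h 1"
proof -
  have "(\<Sum>d\<in>pos_le z. of_real (moebius d) * \<chi> d / of_nat d * (\<Sum>m\<in>pos_le (z / real d). \<chi> m / of_nat m * h (d * m))) =
      (\<Sum>d\<in>pos_le z. \<Sum>m\<in>pos_le (z / real d). of_real (moebius d) * (\<chi> (d * m) / of_nat (d * m) * h (d * m)))"
    unfolding sum_distrib_left by (intro sum.cong refl) (simp add: mult)
  also have "\<dots> = (\<Sum>n\<in>pos_le z. \<Sum>d | d dvd n. of_real (moebius d) * (\<chi> (d * (n div d)) / of_nat (d * (n div d)) * h (d * (n div d))))"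
    by (rule sum_divisors_swap[symmetric])
  also have "\<dots> = (\<Sum>n\<in>pos_le z. if n = 1 then h 1 else 0)"
  proof (intro sum.cong refl)
    fix n assume n: "n \<in> pos_le z"
    have "(\<Sum>d | d dvd n. of_real (moebius d) * (\<chi> (d * (n div d)) / of_nat (d * (n div d)) * h (d * (n div d)))) =
        of_real (\<Sum>d | d dvd n. moebius d) * (\<chi> n / of_nat n * h n)"
      unfolding of_real_sum sum_distrib_right by (intro sum.cong refl) auto
    also have "\<dots> = (if n = 1 then h 1 else 0)" using n by (simp add: sum_moebius_divisors)
    finally show "(\<Sum>d | d dvd n. of_real (moebius d) * (\<chi> (d * (n div d)) / of_nat (d * (n div d)) * h (d * (n div d)))) =
        (if n = 1 then h 1 else 0)" .
  qed
  also have "\<dots> = h 1" using assms by (subst sum.delta) auto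
  finally show ?thesis .
qed

text \<open>Inserting \<open>ln (z / d) = ln (z / (d m)) + (\<Sum>e | e dvd m. \<Lambda> e)\<close> under the
  Moebius sum produces both \<open>ln z\<close> and \<open>LLam z\<close>; the left-hand side is small
  because \<open>Lsum\<close> tends to 0.\<close>

lemma norm_LLam_plus_ln_le_if_L_zero:
  assumes "L = 0" "z \<ge> 1"
  shows "norm (LLam z + of_real (ln z)) \<le> 4 * real l"
proof -
  let ?m = "\<lambda>d. of_real (moebius d) * \<chi> d / of_nat d"
  have "(\<Sum>d\<in>pos_le z. ?m d * (of_real (ln (z / real d)) * Lsum (z / real d))) =
      (\<Sum>d\<in>pos_le z. ?m d * (\<Sum>m\<in>pos_le (z / real d). \<chi> m / of_nat m * of_real (ln (z / real (d * m))))) +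
      (\<Sum>d\<in>pos_le z. ?m d * Lln (z / real d))"
    unfolding sum.distrib[symmetric] distrib_left[symmetric]
  proof (intro sum.cong refl arg_cong[where f = "(*) _"])
    fix d assume d: "d \<in> pos_le z"
    have "of_real (ln (z / real d)) * Lsum (z / real d) = (\<Sum>m\<in>pos_le (z / real d). \<chi> m / of_nat m * of_real (ln (z / real d)))"
      unfolding Lsum_def sum_distrib_left by (intro sum.cong) (auto simp: mult_ac)
    also have "\<dots> = (\<Sum>m\<in>pos_le (z / real d). \<chi> m / of_nat m * of_real (ln (z / real (d * m))) + \<chi> m / of_nat m * of_real (ln (real m)))"
    proof (intro sum.cong refl)
      fix m assume m: "m \<in> pos_le (z / real d)"
      have "ln (z / real d) = ln (z / real (d * m)) + ln (real m)"
        using d m assms by (simp add: ln_div ln_mult)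
      then show "\<chi> m / of_nat m * of_real (ln (z / real d)) =
          \<chi> m / of_nat m * of_real (ln (z / real (d * m))) + \<chi> m / of_nat m * of_real (ln (real m))"
        by (simp only: of_real_add distrib_left)
    qed
    finally show "of_real (ln (z / real d)) * Lsum (z / real d) =
        (\<Sum>m\<in>pos_le (z / real d). \<chi> m / of_nat m * of_real (ln (z / real (d * m)))) + Lln (z / real d)"
      by (simp only: sum.distrib Lln_def)
  qed
  also have "(\<Sum>d\<in>pos_le z. ?m d * (\<Sum>m\<in>pos_le (z / real d). \<chi> m / of_nat m * of_real (ln (z / real (d * m))))) = of_real (ln z)"
    using moebius_inversion_sum[OF assms(2), of "\<lambda>k. of_real (ln (z / real k))"] by simp
  also have "(\<Sum>d\<in>pos_le z. ?m d * Lln (z / real d)) =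
      (\<Sum>d\<in>pos_le z. \<Sum>e\<in>pos_le (z / real d). ?m d * (\<chi> e / of_nat e * of_real (mangoldt e) * Lsum (z / real d / real e)))"
    by (simp only: Lln_eq sum_distrib_left)
  also have "\<dots> = (\<Sum>e\<in>pos_le z. \<Sum>d\<in>pos_le (z / real e). ?m d * (\<chi> e / of_nat e * of_real (mangoldt e) * Lsum (z / real d / real e)))"
    by (rule sum_pos_le_swap)
  also have "\<dots> = (\<Sum>e\<in>pos_le z. \<chi> e / of_nat e * of_real (mangoldt e) * (\<Sum>d\<in>pos_le (z / real e). ?m d * Lsum (z / real e / real d)))"
    unfolding sum_distrib_left by (intro sum.cong refl) (simp add: mult_ac)
  also have "\<dots> = LLam z"
    unfolding LLam_def
  proof (intro sum.cong refl)
    fix e assume e: "e \<in> pos_le z"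
    then have "z / real e \<ge> 1" by (simp add: field_simps)
    from moebius_inversion_sum[OF this, of "\<lambda>_. 1"]
    have "(\<Sum>d\<in>pos_le (z / real e). ?m d * Lsum (z / real e / real d)) = 1" unfolding Lsum_def by simp
    then show "\<chi> e / of_nat e * of_real (mangoldt e) * (\<Sum>d\<in>pos_le (z / real e). ?m d * Lsum (z / real e / real d)) =
        \<chi> e / of_nat e * of_real (mangoldt e)" by simp
  qed
  finally have eq: "LLam z + of_real (ln z) = (\<Sum>d\<in>pos_le z. ?m d * (of_real (ln (z / real d)) * Lsum (z / real d)))"
    by (simp add: add.commute)
  have "norm (\<Sum>d\<in>pos_le z. ?m d * (of_real (ln (z / real d)) * Lsum (z / real d))) \<le> (\<Sum>d\<in>pos_le z. 2 * real l / z * ln (z / real d))"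
  proof (rule order_trans[OF norm_sum sum_mono])
    fix d assume d: "d \<in> pos_le z"
    then have ge: "z / real d \<ge> 1" "ln (z / real d) \<ge> 0" by (auto simp: field_simps)
    have s: "norm (Lsum (z / real d)) \<le> 2 * real l / (z / real d)"
      using Lsum_approx[of "z / real d"] ge assms(1) by simp
    have "norm (?m d) \<le> 1 / real d"
    proof -
      have "\<bar>moebius d\<bar> * norm (\<chi> d) \<le> 1 * 1" by (intro mult_mono abs_moebius_le norm_le_1) auto
      then show ?thesis by (simp add: norm_mult norm_divide divide_right_mono)
    qed
    then have "norm (?m d) * (ln (z / real d) * norm (Lsum (z / real d))) \<le> 1 / real d * (ln (z / real d) * (2 * real l / (z / real d)))"
      using s ge by (intro mult_mono mult_left_mono) auto
    also have "\<dots> = 2 * real l / z * ln (z / real d)" using d by simp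
    finally show "norm (?m d * (of_real (ln (z / real d)) * Lsum (z / real d))) \<le> 2 * real l / z * ln (z / real d)"
      using ge by (simp only: norm_mult norm_of_real abs_of_nonneg)
  qed
  also have "\<dots> = 2 * real l / z * (\<Sum>d\<in>pos_le z. ln (z / real d))" by (simp only: sum_distrib_left)
  also have "\<dots> \<le> 2 * real l / z * (2 * z)" using assms by (intro mult_left_mono sum_ln_div_le) auto
  also have "\<dots> = 4 * real l" using assms by simp
  finally show ?thesis unfolding eq .
qed

end

section \<open>Nonvanishing at 1 for real characters\<close>

lemma inverse_sqrt_Suc_bounds:
  assumes "n > 0"
  shows "1 / sqrt (real (Suc n)) \<le> 2 * (sqrt (real (Suc n)) - sqrt (real n))"
    "2 * (sqrt (real (Suc n)) - sqrt (real n)) \<le> 1 / sqrt (real n)"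
proof -
  define u v where "u = sqrt (real (Suc n))" and "v = sqrt (real n)"
  have uv: "u > 0" "v > 0" "v \<le> u" "u * u - v * v = 1" using assms by (auto simp: u_def v_def)
  have "(u - v) * (u + v) = 1" using uv(4) by (simp add: algebra_simps)
  then have eq: "u - v = 1 / (u + v)" using uv by (simp add: field_simps)
  have "1 / (2 * u) \<le> 1 / (u + v)" "1 / (u + v) \<le> 1 / (2 * v)" using uv by (intro divide_left_mono; simp)+
  then show "1 / sqrt (real (Suc n)) \<le> 2 * (sqrt (real (Suc n)) - sqrt (real n))"
    "2 * (sqrt (real (Suc n)) - sqrt (real n)) \<le> 1 / sqrt (real n)"
    unfolding u_def[symmetric] v_def[symmetric] eq by simp_all
qed

lemma sum_inverse_sqrt_le: "(\<Sum>a=1..N. 1 / sqrt (real a)) \<le> 2 * sqrt (real N)"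
proof (induction N)
  case (Suc N)
  show ?case
  proof (cases "N = 0")
    case False
    then show ?thesis using Suc inverse_sqrt_Suc_bounds(1)[of N] by simp
  qed simp
qed simp

text \<open>\<open>u\<close> decreases, \<open>v\<close> increases, and their difference
  \<open>1 / sqrt (n + 1)\<close> controls the error. The limit C between them is the value of the
  zeta function at 1/2.\<close>

lemma sum_inverse_sqrt_approx:
  "\<exists>C. \<forall>y\<ge>1. \<bar>(\<Sum>a\<in>pos_le y. 1 / sqrt (real a)) - 2 * sqrt y - C\<bar> \<le> 4 / sqrt y"
proof -
  define u where "u = (\<lambda>n. (\<Sum>a=1..Suc n. 1 / sqrt (real a)) - 2 * sqrt (real (Suc n)))"
  define v where "v = (\<lambda>n. u n - 1 / sqrt (real (Suc n)))"
  have dec: "decseq u"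
    by (rule decseq_SucI) (use inverse_sqrt_Suc_bounds(1)[of "Suc n" for n] in \<open>auto simp: u_def algebra_simps\<close>)
  have inc: "incseq v"
    by (rule incseq_SucI) (use inverse_sqrt_Suc_bounds(2)[of "Suc n" for n] in \<open>auto simp: u_def v_def algebra_simps\<close>)
  have vu: "v n \<le> u n" for n by (simp add: v_def)
  have lower: "v m \<le> u n" for m n
  proof -
    have "v m \<le> v (max m n)" using inc by (auto simp: incseq_def)
    also have "\<dots> \<le> u (max m n)" by (rule vu)
    also have "\<dots> \<le> u n" using dec by (auto simp: decseq_def)
    finally show ?thesis .
  qed
  define C where "C = (INF n. u n)"
  have bdd: "bdd_below (range u)" using lower[of 0] by (intro bdd_belowI[of _ "v 0"]) auto
  have C: "v n \<le> C" "C \<le> u n" for n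
    unfolding C_def using lower bdd by (auto intro: cINF_greatest cINF_lower)
  show ?thesis
  proof (intro exI[of _ C] allI impI)
    fix y :: real assume y: "y \<ge> 1"
    define n where "n = nat \<lfloor>y\<rfloor> - 1"
    have n: "nat \<lfloor>y\<rfloor> = Suc n" "real (Suc n) \<le> y" "y \<le> real (Suc n) + 1" using y unfolding n_def by linarith+
    have s: "(\<Sum>a\<in>pos_le y. 1 / sqrt (real a)) = u n + 2 * sqrt (real (Suc n))"
      unfolding pos_le_altdef n u_def by simp
    have pos: "sqrt (real (Suc n)) > 0" "sqrt y > 0" using y by auto
    have sq: "sqrt (real (Suc n)) \<le> sqrt y" using n by simp
    have "2 * (sqrt y - sqrt (real (Suc n))) \<le> 2 * (sqrt (real (Suc (Suc n))) - sqrt (real (Suc n)))"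
      using n by simp
    also have "\<dots> \<le> 1 / sqrt (real (Suc n))" using inverse_sqrt_Suc_bounds(2)[of "Suc n"] by simp
    finally have 1: "2 * (sqrt y - sqrt (real (Suc n))) \<le> 1 / sqrt (real (Suc n))" .
    have 2: "u n - C \<ge> 0" "u n - C \<le> 1 / sqrt (real (Suc n))" using C[of n] by (simp_all add: v_def)
    have "y \<le> 4 * real (Suc n)" using n by simp
    then have "sqrt y \<le> sqrt (4 * real (Suc n))" by (rule real_sqrt_le_mono)
    also have "\<dots> = 2 * sqrt (real (Suc n))" by (simp only: real_sqrt_mult) simp
    finally have "sqrt y \<le> 2 * sqrt (real (Suc n))" .
    then have 3: "1 / sqrt (real (Suc n)) \<le> 2 / sqrt y" using pos by (simp add: field_simps)
    have "2 / sqrt y \<le> 4 / sqrt y" using pos by (intro divide_right_mono) auto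
    then show "\<bar>(\<Sum>a\<in>pos_le y. 1 / sqrt (real a)) - 2 * sqrt y - C\<bar> \<le> 4 / sqrt y"
    proof -
      have "\<bar>U + 2 * b - 2 * a - C\<bar> \<le> F"
        if "2 * (a - b) \<le> c" "0 \<le> U - C" "U - C \<le> c" "b \<le> a" "c \<le> e" "e \<le> F" for a b c e F U :: real
      proof -
        have "U + 2 * b - 2 * a - C \<le> F" using that by argo
        moreover have "- (U + 2 * b - 2 * a - C) \<le> F" using that by argo
        ultimately show ?thesis by (rule abs_leI)
      qed
      from this[OF 1 2 sq 3 \<open>2 / sqrt y \<le> 4 / sqrt y\<close>] show ?thesis unfolding s .
    qed
  qed
qed

lemma harmonic_ge_ln: "ln (real (Suc N)) \<le> (\<Sum>k=1..N. 1 / real k)"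
proof (induction N)
  case (Suc N)
  have "ln (real (Suc (Suc N))) - ln (real (Suc N)) \<le> 1 / real (Suc N)" by (rule ln_Suc_diff_le) simp
  with Suc show ?case by simp
qed simp

text \<open>As q exceeds every prime of m, the divisors of \<open>q ^ a * m\<close> are uniquely of
  the form \<open>q ^ i * d\<close> with d a divisor of m.\<close>

lemma sum_divisors_prime_power_mult:
  fixes f :: "nat \<Rightarrow> real"
  assumes q: "prime q" and m: "smooth (q - 1) m"
    and f: "\<And>a b. f (a * b) = f a * f b" "f 1 = 1"
  shows "(\<Sum>d | d dvd q ^ a * m. f d) = (\<Sum>i\<le>a. f q ^ i) * (\<Sum>d | d dvd m. f d)"
proof -
  have m0: "m > 0" using m smooth_pos by blast
  have r: "rough (q - 1) (q ^ i)" for i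
    using q prime_gt_0_nat[OF q] by (cases "i = 0") (auto simp: rough_prime_power)
  have fpow: "f (q ^ i) = f q ^ i" for i by (induction i) (simp_all add: f(1) f(2)[simplified])
  have "(\<Sum>d | d dvd q ^ a * m. f d) = (\<Sum>(i, d)\<in>{..a} \<times> {d. d dvd m}. f (q ^ i * d))"
  proof -
    have "bij_betw (\<lambda>p. q ^ fst p * snd p) ({..a} \<times> {d. d dvd m}) {d. d dvd q ^ a * m}"
      unfolding bij_betw_def
    proof (intro conjI subset_antisym subsetI)
      show "inj_on (\<lambda>p. q ^ fst p * snd p) ({..a} \<times> {d. d dvd m})"
      proof (rule inj_onI)
        fix p p' assume *: "p \<in> {..a} \<times> {d. d dvd m}" "p' \<in> {..a} \<times> {d. d dvd m}" "q ^ fst p * snd p = q ^ fst p' * snd p'"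
        then have "smooth (q - 1) (snd p)" "smooth (q - 1) (snd p')" using smooth_dvd[OF m] by auto
        then have "snd p = snd p'" "q ^ fst p = q ^ fst p'"
          using smooth_rough_decomp_unique[of "q - 1" "snd p" "q ^ fst p" "snd p'" "q ^ fst p'"] r * by (auto simp: mult.commute)
        then show "p = p'" using prime_gt_1_nat[OF q] by (simp add: prod_eq_iff power_inject_exp)
      qed
    next
      fix d assume "d \<in> (\<lambda>p. q ^ fst p * snd p) ` ({..a} \<times> {d. d dvd m})"
      then show "d \<in> {d. d dvd q ^ a * m}" by (auto intro!: mult_dvd_mono le_imp_power_dvd)
    next
      fix d assume "d \<in> {d. d dvd q ^ a * m}"
      then have d: "d dvd q ^ a * m" by simp
      obtain b c where bc: "b dvd q ^ a" "c dvd m" "d = b * c" using division_decomp[OF d] by blast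
      obtain i where i: "i \<le> a" "b = q ^ i" using bc(1) divides_primepow_nat[OF q] by blast
      then show "d \<in> (\<lambda>p. q ^ fst p * snd p) ` ({..a} \<times> {d. d dvd m})"
        using bc by (intro image_eqI[of _ _ "(i, c)"]) auto
    qed
    from sum.reindex_bij_betw[OF this, of f] show ?thesis by (simp only: case_prod_unfold)
  qed
  also have "\<dots> = (\<Sum>i\<le>a. f (q ^ i)) * (\<Sum>d | d dvd m. f d)"
    by (simp add: f(1) sum_product sum.cartesian_product)
  finally show ?thesis by (simp add: fpow)
qed

lemma sum_powers_sign:
  assumes "r \<in> {- 1, 0, 1 :: real}"
  shows "(\<Sum>i\<le>a. r ^ i) \<ge> 0" "even a \<Longrightarrow> (\<Sum>i\<le>a. r ^ i) \<ge> 1"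
proof -
  have m1: "(\<Sum>i\<le>a. (- 1) ^ i) = (if even a then 1 else 0 :: real)" by (induction a) auto
  have z: "(\<Sum>i\<le>a. 0 ^ i) = (1 :: real)" by (induction a) auto
  show "(\<Sum>i\<le>a. r ^ i) \<ge> 0" "even a \<Longrightarrow> (\<Sum>i\<le>a. r ^ i) \<ge> 1" using assms m1 z by auto
qed

text \<open>The divisor sum is multiplicative. At a prime power it is a sum of powers of -1, 0 or 1,
  hence nonnegative, and at least 1 when the exponent is even. The induction strips off the largest
  prime.\<close>

lemma sum_divisors_sign_nonneg:
  fixes f :: "nat \<Rightarrow> real"
  assumes f: "\<And>a b. f (a * b) = f a * f b" "f 1 = 1" "\<And>n. f n \<in> {- 1, 0, 1}"
  shows "n > 0 \<Longrightarrow> (\<Sum>d | d dvd n. f d) \<ge> 0" "n > 0 \<Longrightarrow> (\<Sum>d | d dvd n\<^sup>2. f d) \<ge> 1"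
proof (induction n rule: less_induct)
  case (less n)
  {
    case 1
    show ?case
    proof (cases "n = 1")
      case False
      then have n1: "n > 1" using 1 by simp
      define q where "q = lpf n"
      obtain a m where am: "a > 0" "smooth (q - 1) m" "q ^ a * m = n"
        using prime_power_smooth_decomp_exists[OF n1] unfolding q_def by metis
      have q: "prime q" using prime_lpf[OF n1] by (simp add: q_def)
      have m0: "m > 0" using am(2) smooth_pos by blast
      have "1 < q ^ a" by (rule one_less_power[OF prime_gt_1_nat[OF q] am(1)])
      then have "1 * m < q ^ a * m" using m0 by (intro mult_strict_right_mono)
      then have "(\<Sum>d | d dvd m. f d) \<ge> 0" using less.IH(1)[of m] m0 am(3) by simp
      then show ?thesis
        unfolding am(3)[symmetric] sum_divisors_prime_power_mult[OF q am(2) f(1,2)]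
        using sum_powers_sign(1)[OF f(3)] by (intro mult_nonneg_nonneg)
    qed (use f in simp)
  next
    case 2
    show ?case
    proof (cases "n = 1")
      case False
      then have n1: "n > 1" using 2 by simp
      define q where "q = lpf n"
      obtain a m where am: "a > 0" "smooth (q - 1) m" "q ^ a * m = n"
        using prime_power_smooth_decomp_exists[OF n1] unfolding q_def by metis
      have q: "prime q" using prime_lpf[OF n1] by (simp add: q_def)
      have m0: "m > 0" using am(2) smooth_pos by blast
      have "1 < q ^ a" by (rule one_less_power[OF prime_gt_1_nat[OF q] am(1)])
      then have "1 * m < q ^ a * m" using m0 by (intro mult_strict_right_mono)
      then have IH: "(\<Sum>d | d dvd m\<^sup>2. f d) \<ge> 1" using less.IH(2)[of m] m0 am(3) by simp
      have sm: "smooth (q - 1) (m\<^sup>2)" using am(2) by (simp add: power2_eq_square smooth_mult_iff)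
      have n2: "n\<^sup>2 = q ^ (2 * a) * m\<^sup>2" unfolding am(3)[symmetric] by (simp add: power_mult_distrib power_mult[symmetric] mult.commute)
      have "1 * 1 \<le> (\<Sum>i\<le>2 * a. f q ^ i) * (\<Sum>d | d dvd m\<^sup>2. f d)"
        using sum_powers_sign(2)[OF f(3), of "2 * a" q] IH by (intro mult_mono) auto
      then show ?thesis unfolding n2 sum_divisors_prime_power_mult[OF q sm f(1,2)] by simp
    qed (use f in simp)
  }
qed

context nonprincipal_dchar
begin

text \<open>The sum of \<open>(1 * \<chi>)(n) / sqrt n\<close> over \<open>n \<le> N\<^sup>2\<close> is at least \<open>ln N\<close>
  because of the squares, but the hyperbola method bounds it if \<open>L = 0\<close>.\<close>

lemma L_nonzero_if_real:
  assumes real: "\<And>a. \<chi> a * \<chi> a = principal_dchar l a"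
  shows "L \<noteq> 0"
proof
  assume L0: "L = 0"
  define f where "f = (\<lambda>n. Re (\<chi> n))"
  have pm: "\<chi> n = 1 \<or> \<chi> n = - 1 \<or> \<chi> n = 0" for n
  proof (cases "coprime n l")
    case True
    then have "\<chi> n * \<chi> n = 1" using real[of n] by (simp add: principal_dchar_def)
    then show ?thesis using square_eq_1_iff by blast
  qed (use dcharacter_eq_0_iff[OF dchar] in simp)
  have chi: "\<chi> n = of_real (f n)" for n using pm[of n] by (auto simp: f_def)
  have f: "f (a * b) = f a * f b" "f 1 = 1" "f n \<in> {- 1, 0, 1}" for a b n
  proof -
    have "of_real (f (a * b)) = (of_real (f a * f b) :: complex)" using mult[of a b] unfolding chi by simp
    then show "f (a * b) = f a * f b" by (simp only: of_real_eq_iff)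
    show "f 1 = 1" by (simp add: f_def)
    show "f n \<in> {- 1, 0, 1}" using pm[of n] by (auto simp: f_def)
  qed
  have f_le: "\<bar>f n\<bar> \<le> 1" for n using f(3)[of n] by auto
  define h where "h = (\<lambda>n. \<Sum>d | d dvd n. f d)"
  have h: "h n \<ge> 0" "h (n\<^sup>2) \<ge> 1" if "n > 0" for n
    using sum_divisors_sign_nonneg[of f, OF f that] by (simp_all add: h_def)
  have weighted: "\<bar>\<Sum>n=m..N. f n * g n\<bar> \<le> 2 * real l * g m"
    if "\<And>n. n \<ge> m \<Longrightarrow> g (Suc n) \<le> g n" "\<And>n. n \<ge> m \<Longrightarrow> g n \<ge> 0" for m N and g :: "nat \<Rightarrow> real"
  proof -
    have "norm (\<Sum>n=m..N. \<chi> n * of_real (g n)) = norm (of_real (\<Sum>n=m..N. f n * g n) :: complex)"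
      by (simp add: chi)
    then show ?thesis using norm_sum_weighted_le[of m g N] that by (simp only: norm_of_real)
  qed
  obtain C where C: "\<And>y. y \<ge> 1 \<Longrightarrow> \<bar>(\<Sum>a\<in>pos_le y. 1 / sqrt (real a)) - 2 * sqrt y - C\<bar> \<le> 4 / sqrt y"
    using sum_inverse_sqrt_approx by blast
  have bound: "ln (real (Suc N)) \<le> 8 * real l + 2 * real l * \<bar>C\<bar> + 4" if N: "N > 0" for N
  proof -
    \<comment> \<open>The divisor b is cut at N, the square root of X: for b <= N the sum over the
      cofactor is evaluated asymptotically, for b > N the cancellation in f is used.\<close>
    define X where "X = (real N)\<^sup>2"
    have N1: "1 \<le> real N" using N by simp
    have X: "X \<ge> real N" "X \<ge> 1" unfolding X_def using N1 by (simp add: power2_eq_square, rule one_le_power)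
    define A where "A = (\<lambda>y. \<Sum>a\<in>pos_le y. 1 / sqrt (real a))"
    define G where "G = (\<Sum>n\<in>pos_le X. h n / sqrt (real n))"
    have inj: "inj_on (\<lambda>k::nat. k\<^sup>2) {1..N}" by (auto simp: inj_on_def)
    have "ln (real (Suc N)) \<le> (\<Sum>k=1..N. 1 / real k)" by (rule harmonic_ge_ln)
    also have "\<dots> \<le> (\<Sum>k=1..N. h (k\<^sup>2) / sqrt (real (k\<^sup>2)))"
      by (intro sum_mono) (use h in \<open>auto intro!: divide_right_mono\<close>)
    also have "\<dots> = (\<Sum>n\<in>(\<lambda>k. k\<^sup>2) ` {1..N}. h n / sqrt (real n))" by (simp only: sum.reindex[OF inj] o_def)
    also have "\<dots> \<le> G"
      unfolding G_def using h by (intro sum_mono2) (auto simp: X_def intro!: divide_nonneg_nonneg power_mono)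
    finally have lower: "ln (real (Suc N)) \<le> G" .
    have "G = (\<Sum>n\<in>pos_le X. \<Sum>d | d dvd n. f d / sqrt (real (d * (n div d))))"
      unfolding G_def h_def sum_divide_distrib by (intro sum.cong refl) auto
    also have "\<dots> = (\<Sum>b\<in>pos_le X. \<Sum>a\<in>pos_le (X / real b). f b / sqrt (real (b * a)))"
      by (rule sum_divisors_swap)
    also have "\<dots> = (\<Sum>b\<in>pos_le X. \<Sum>a\<in>pos_le (X / real b). if b \<le> N then f b / sqrt (real (b * a)) else 0) +
        (\<Sum>b\<in>pos_le X. \<Sum>a\<in>pos_le (X / real b). if b \<le> N then 0 else f b / sqrt (real (b * a)))"
      unfolding sum.distrib[symmetric] by (intro sum.cong refl) auto
    also have "(\<Sum>b\<in>pos_le X. \<Sum>a\<in>pos_le (X / real b). if b \<le> N then f b / sqrt (real (b * a)) else 0) =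
        (\<Sum>b=1..N. f b / sqrt (real b) * A (X / real b))"
    proof -
      have "(\<Sum>b\<in>pos_le X. \<Sum>a\<in>pos_le (X / real b). if b \<le> N then f b / sqrt (real (b * a)) else 0) =
          (\<Sum>b\<in>pos_le X. if b \<le> N then f b / sqrt (real b) * A (X / real b) else 0)"
        unfolding A_def sum_distrib_left by (intro sum.cong refl) (auto simp: real_sqrt_mult)
      also have "\<dots> = (\<Sum>b\<in>{b\<in>pos_le X. b \<le> N}. f b / sqrt (real b) * A (X / real b))"
        by (rule sum.inter_filter[symmetric]) auto
      also have "{b\<in>pos_le X. b \<le> N} = {1..N}"
      proof -
        have "real b \<le> X" if "b \<le> N" for b using that X(1) by linarith
        then show ?thesis by auto
      qed
      finally show ?thesis .
    qed
    also have "(\<Sum>b\<in>pos_le X. \<Sum>a\<in>pos_le (X / real b). if b \<le> N then 0 else f b / sqrt (real (b * a))) =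
        (\<Sum>a\<in>pos_le X. \<Sum>b\<in>pos_le (X / real a). if b \<le> N then 0 else f b / sqrt (real (b * a)))"
      by (rule sum_pos_le_swap)
    finally have G: "G = (\<Sum>b=1..N. f b / sqrt (real b) * A (X / real b)) +
        (\<Sum>a\<in>pos_le X. \<Sum>b\<in>pos_le (X / real a). if b \<le> N then 0 else f b / sqrt (real (b * a)))" .
    have "\<bar>\<Sum>a\<in>pos_le X. \<Sum>b\<in>pos_le (X / real a). if b \<le> N then 0 else f b / sqrt (real (b * a))\<bar> \<le>
        (\<Sum>a\<in>pos_le X. if a \<le> N then 2 * real l / sqrt (real N) * (1 / sqrt (real a)) else 0)"
    proof (rule order_trans[OF sum_abs sum_mono])
      fix a assume a: "a \<in> pos_le X"
      have "(\<Sum>b\<in>pos_le (X / real a). if b \<le> N then 0 else f b / sqrt (real (b * a))) =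
          (\<Sum>b\<in>pos_le (X / real a). if \<not> b \<le> N then f b * (1 / sqrt (real b)) * (1 / sqrt (real a)) else 0)"
        by (intro sum.cong refl) (auto simp: real_sqrt_mult)
      also have "\<dots> = (\<Sum>b\<in>{b\<in>pos_le (X / real a). \<not> b \<le> N}. f b * (1 / sqrt (real b)) * (1 / sqrt (real a)))"
        by (rule sum.inter_filter[symmetric]) auto
      also have "{b\<in>pos_le (X / real a). \<not> b \<le> N} = {Suc N..nat \<lfloor>X / real a\<rfloor>}"
        unfolding pos_le_altdef by auto
      finally have eq: "(\<Sum>b\<in>pos_le (X / real a). if b \<le> N then 0 else f b / sqrt (real (b * a))) =
          (\<Sum>b=Suc N..nat \<lfloor>X / real a\<rfloor>. f b * (1 / sqrt (real b))) * (1 / sqrt (real a))"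
        by (simp only: sum_distrib_right)
      show "\<bar>\<Sum>b\<in>pos_le (X / real a). if b \<le> N then 0 else f b / sqrt (real (b * a))\<bar> \<le>
          (if a \<le> N then 2 * real l / sqrt (real N) * (1 / sqrt (real a)) else 0)"
      proof (cases "a \<le> N")
        case True
        have "\<bar>\<Sum>b=Suc N..nat \<lfloor>X / real a\<rfloor>. f b * (1 / sqrt (real b))\<bar> \<le> 2 * real l * (1 / sqrt (real (Suc N)))"
          by (rule weighted) (auto intro!: divide_left_mono)
        also have "\<dots> \<le> 2 * real l * (1 / sqrt (real N))"
          using N by (intro mult_left_mono divide_left_mono) auto
        finally have "\<bar>\<Sum>b=Suc N..nat \<lfloor>X / real a\<rfloor>. f b * (1 / sqrt (real b))\<bar> * (1 / sqrt (real a)) \<le>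
            2 * real l * (1 / sqrt (real N)) * (1 / sqrt (real a))"
          by (rule mult_right_mono) simp
        then show ?thesis unfolding eq abs_mult using True by simp
      next
        case False
        then have "X / real a \<le> X / real N" using N X by (intro divide_left_mono) auto
        also have "\<dots> = real N" using N by (simp add: X_def power2_eq_square)
        finally have "nat \<lfloor>X / real a\<rfloor> \<le> N" by linarith
        then show ?thesis unfolding eq using False by simp
      qed
    qed
    also have "\<dots> = (\<Sum>a\<in>{a\<in>pos_le X. a \<le> N}. 2 * real l / sqrt (real N) * (1 / sqrt (real a)))"
      by (rule sum.inter_filter[symmetric]) auto
    also have "\<dots> \<le> (\<Sum>a=1..N. 2 * real l / sqrt (real N) * (1 / sqrt (real a)))"
      by (intro sum_mono2) auto
    also have "\<dots> = 2 * real l / sqrt (real N) * (\<Sum>a=1..N. 1 / sqrt (real a))" by (simp only: sum_distrib_left)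
    also have "\<dots> \<le> 2 * real l / sqrt (real N) * (2 * sqrt (real N))"
      by (intro mult_left_mono sum_inverse_sqrt_le) auto
    also have "\<dots> = 4 * real l" using N by simp
    finally have tail: "\<bar>\<Sum>a\<in>pos_le X. \<Sum>b\<in>pos_le (X / real a). if b \<le> N then 0 else f b / sqrt (real (b * a))\<bar> \<le> 4 * real l" .
    define w where "w = (\<lambda>b. A (X / real b) - 2 * sqrt (X / real b) - C)"
    \<comment> \<open>The leading term of A yields 2 N times a partial sum of the series for
      \<open>L\<close>, and as \<open>L = 0\<close> that partial sum is O(1 / N).\<close>
    have "(\<Sum>b=1..N. f b / sqrt (real b) * A (X / real b)) =
        2 * real N * (\<Sum>b=1..N. f b / real b) + C * (\<Sum>b=1..N. f b * (1 / sqrt (real b))) + (\<Sum>b=1..N. f b / sqrt (real b) * w b)"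
      unfolding sum_distrib_left sum.distrib[symmetric]
    proof (intro sum.cong refl)
      fix b assume b: "b \<in> {1..N}"
      have "sqrt (X / real b) = real N / sqrt (real b)" using N by (simp add: X_def real_sqrt_divide)
      then have A: "A (X / real b) = 2 * (real N / sqrt (real b)) + C + w b" by (simp add: w_def)
      have sq: "sqrt (real b) * sqrt (real b) = real b" by simp
      have "f b / sqrt (real b) * (2 * (real N / sqrt (real b))) = 2 * real N * (f b / (sqrt (real b) * sqrt (real b)))"
        by (simp only: times_divide_eq_left times_divide_eq_right divide_divide_eq_left mult_ac)
      also have "\<dots> = 2 * real N * (f b / real b)" by (simp only: sq)
      finally show "f b / sqrt (real b) * A (X / real b) = 2 * real N * (f b / real b) + C * (f b * (1 / sqrt (real b))) + f b / sqrt (real b) * w b"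
        unfolding A by (simp add: distrib_left mult_ac)
    qed
    moreover have "\<bar>2 * real N * (\<Sum>b=1..N. f b / real b)\<bar> \<le> 4 * real l"
    proof -
      have "Lsum (real N) = of_real (\<Sum>b=1..N. f b / real b)" unfolding Lsum_def pos_le_of_nat by (simp add: chi)
      then have "\<bar>\<Sum>b=1..N. f b / real b\<bar> \<le> 2 * real l / real N"
        using Lsum_approx[of "real N"] N L0 by (simp only: diff_zero norm_of_real)
      then have "2 * real N * \<bar>\<Sum>b=1..N. f b / real b\<bar> \<le> 2 * real N * (2 * real l / real N)" by (intro mult_left_mono) auto
      then show ?thesis using N by (simp add: abs_mult)
    qed
    moreover have "\<bar>C * (\<Sum>b=1..N. f b * (1 / sqrt (real b)))\<bar> \<le> \<bar>C\<bar> * (2 * real l)"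
    proof -
      have "\<bar>\<Sum>b=1..N. f b * (1 / sqrt (real b))\<bar> \<le> 2 * real l * (1 / sqrt (real 1))"
        by (rule weighted) (auto intro!: divide_left_mono)
      then show ?thesis unfolding abs_mult by (intro mult_left_mono) auto
    qed
    moreover have "\<bar>\<Sum>b=1..N. f b / sqrt (real b) * w b\<bar> \<le> 4"
    proof -
      have "\<bar>\<Sum>b=1..N. f b / sqrt (real b) * w b\<bar> \<le> (\<Sum>b=1..N. 4 / real N)"
      proof (rule order_trans[OF sum_abs sum_mono])
        fix b assume b: "b \<in> {1..N}"
        have "real b \<le> X" using b X by auto
        then have "X / real b \<ge> 1" using b by (simp add: field_simps)
        then have "\<bar>w b\<bar> \<le> 4 / sqrt (X / real b)" unfolding w_def A_def by (rule C)
        also have "\<dots> = 4 * sqrt (real b) / real N" using N by (simp add: X_def real_sqrt_divide)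
        finally have "\<bar>f b\<bar> / sqrt (real b) * \<bar>w b\<bar> \<le> 1 / sqrt (real b) * (4 * sqrt (real b) / real N)"
          by (intro mult_mono divide_right_mono f_le) auto
        then show "\<bar>f b / sqrt (real b) * w b\<bar> \<le> 4 / real N" using b by (simp add: abs_mult)
      qed
      then show ?thesis using N by simp
    qed
    ultimately have "G \<le> 4 * real l + \<bar>C\<bar> * (2 * real l) + 4 + 4 * real l"
      unfolding G using tail by linarith
    with lower show ?thesis by (simp add: algebra_simps)
  qed
  obtain N :: nat where N: "exp (8 * real l + 2 * real l * \<bar>C\<bar> + 4) < real N" using reals_Archimedean2 by blast
  then have "N > 0" using exp_gt_zero[of "8 * real l + 2 * real l * \<bar>C\<bar> + 4"] by (intro Nat.gr0I) auto
  have "exp (ln (real (Suc N))) \<le> exp (8 * real l + 2 * real l * \<bar>C\<bar> + 4)" using bound[OF \<open>N > 0\<close>] by (simp only: exp_le_cancel_iff)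
  then have "real (Suc N) \<le> exp (8 * real l + 2 * real l * \<bar>C\<bar> + 4)" by (simp only: exp_ln of_nat_0_less_iff zero_less_Suc)
  with N show False by simp
qed

end

section \<open>Primes in arithmetic progressions\<close>

definition coprime_Lam :: "nat \<Rightarrow> real \<Rightarrow> real" where
  "coprime_Lam l z = (\<Sum>n\<in>pos_le z. if coprime n l then mangoldt n / real n else 0)"

text \<open>A prime power not coprime to l has its prime dividing l and is therefore l-smooth, so
  the omitted terms cost at most \<open>50 * ln l\<close>.\<close>

lemma coprime_Lam_bounds:
  assumes "l \<ge> 2" "z \<ge> 1"
  shows "coprime_Lam l z \<le> ln z + 13" "coprime_Lam l z \<ge> ln z - 13 - 50 * ln (real l)"
proof -
  have b: "\<bar>(\<Sum>d\<in>pos_le z. mangoldt d / real d) - ln z\<bar> \<le> 13" by (rule sum_mangoldt_div_bound[OF assms(2)])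
  have "coprime_Lam l z \<le> (\<Sum>d\<in>pos_le z. mangoldt d / real d)"
    unfolding coprime_Lam_def by (intro sum_mono) (auto simp: mangoldt_nonneg)
  then show "coprime_Lam l z \<le> ln z + 13" using b by linarith
  have "(\<Sum>d\<in>pos_le z. mangoldt d / real d) \<le>
      (\<Sum>d\<in>pos_le z. (if coprime d l then mangoldt d / real d else 0) + (if smooth l d then mangoldt d / real d else 0))"
  proof (intro sum_mono)
    fix d
    show "mangoldt d / real d \<le> (if coprime d l then mangoldt d / real d else 0) + (if smooth l d then mangoldt d / real d else 0)"
    proof (cases "mangoldt d = (0 :: real)")
      case False
      then have "primepow d" by (auto simp: mangoldt_def split: if_splits)
      then obtain q a where q: "prime q" "a > 0" "d = q ^ a" by (auto simp: primepow_def)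
      have "smooth l d" if "\<not> coprime d l"
      proof -
        have "q dvd l" using that q prime_imp_coprime[of q l] by (auto simp: coprime_power_left_iff)
        then have "q \<le> l" using assms by (intro dvd_imp_le) auto
        then show ?thesis using q by (simp add: smooth_prime_power)
      qed
      then show ?thesis by (auto simp: mangoldt_nonneg)
    qed simp
  qed
  also have "\<dots> = coprime_Lam l z + (\<Sum>d\<in>smooth_le l z. mangoldt d / real d)"
    unfolding coprime_Lam_def sum_smooth_le_conv by (rule sum.distrib)
  also have "\<dots> \<le> coprime_Lam l z + 50 * ln (real l)"
    using sum_smooth_le_mangoldt_le[OF assms(1), of z] by simp
  finally show "coprime_Lam l z \<ge> ln z - 13 - 50 * ln (real l)" using b by linarith
qed

text \<open>On the unit circle this is 1 - cos(2 t) = 2 (1 - cos t) (1 + cos t): if w is close to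
  -1, its square is close to 1.\<close>

lemma one_minus_Re_square_le:
  assumes "norm w = 1"
  shows "1 - Re (w * w) \<le> 4 * (1 + Re w)"
proof -
  have sq: "(Re w)\<^sup>2 + (Im w)\<^sup>2 = 1" using assms by (simp add: cmod_def)
  then have "1 - Re (w * w) = 2 * (1 - (Re w)\<^sup>2)" by (simp add: power2_eq_square algebra_simps)
  also have "\<dots> = 2 * (1 - Re w) * (1 + Re w)" by (simp add: power2_eq_square algebra_simps)
  also have "\<dots> \<le> 4 * (1 + Re w)"
  proof -
    have "\<bar>Re w\<bar> \<le> 1" using abs_Re_le_cmod[of w] assms by simp
    then show ?thesis by (intro mult_right_mono) auto
  qed
  finally show ?thesis .
qed

context nonprincipal_dchar
begin

text \<open>A one-sided bound holds whether or not \<open>L\<close> vanishes, since for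
  \<open>L = 0\<close> the sum behaves like \<open>- ln z\<close>. It will be applied to the square
  of a character before nonvanishing is known for it.\<close>

lemma Re_LLam_bounded_above: "\<exists>C. \<forall>z\<ge>1. Re (LLam z) \<le> C"
proof (cases "L = 0")
  case True
  have "Re (LLam z) \<le> 4 * real l" if "z \<ge> 1" for z
  proof -
    have "Re (LLam z + of_real (ln z)) \<le> 4 * real l"
      using norm_LLam_plus_ln_le_if_L_zero[OF True that] complex_Re_le_cmod order_trans by blast
    moreover have "ln z \<ge> 0" using that by simp
    ultimately show ?thesis by simp
  qed
  then show ?thesis by blast
next
  case False
  show ?thesis
    using norm_LLam_le_if_L_nonzero[OF False] complex_Re_le_cmod order_trans by blast
qed

text \<open>If \<open>L = 0\<close>, then \<open>\<chi>\<close> is close to -1 on most primes, so the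
  nonprincipal character \<open>\<chi>\<^sup>2\<close> would be close to 1 on most primes.\<close>

lemma L_nonzero:
  assumes l: "l \<ge> 2"
  shows "L \<noteq> 0"
proof (cases "(\<lambda>a. \<chi> a * \<chi> a) = principal_dchar l")
  case True
  then show ?thesis by (intro L_nonzero_if_real) metis
next
  case False
  interpret sq: nonprincipal_dchar l "\<lambda>a. \<chi> a * \<chi> a"
    by unfold_locales (use l_pos dcharacter_times[OF dchar dchar] False in auto)
  obtain C where C: "\<And>z. z \<ge> 1 \<Longrightarrow> Re (sq.LLam z) \<le> C" using sq.Re_LLam_bounded_above by blast
  show ?thesis
  proof
    assume L0: "L = 0"
    \<comment> \<open>In the comparison below, ln z survives on the left and cancels on the right.
      The 65 is 13 from the lower bound for \<open>coprime_Lam\<close> plus 4 times 13 from the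
      upper one.\<close>
    have bound: "ln z \<le> C + 65 + 16 * real l + 50 * ln (real l)" if z: "z \<ge> 1" for z
    proof -
      have "coprime_Lam l z - Re (sq.LLam z) = (\<Sum>n\<in>pos_le z. mangoldt n / real n * ((if coprime n l then 1 else 0) - Re (\<chi> n * \<chi> n)))"
        unfolding coprime_Lam_def sq.LLam_def Re_sum sum_subtractf[symmetric]
        by (intro sum.cong refl) (simp add: algebra_simps Re_divide_of_nat diff_divide_distrib)
      also have "\<dots> \<le> (\<Sum>n\<in>pos_le z. mangoldt n / real n * (4 * ((if coprime n l then 1 else 0) + Re (\<chi> n))))"
      proof (intro sum_mono mult_left_mono)
        fix n
        show "(if coprime n l then 1 else 0) - Re (\<chi> n * \<chi> n) \<le> 4 * ((if coprime n l then 1 else 0) + Re (\<chi> n))"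
        proof (cases "coprime n l")
          case True
          then have "norm (\<chi> n) = 1" using norm_dcharacter[OF dchar l_pos] by simp
          from one_minus_Re_square_le[OF this] True show ?thesis by simp
        next
          case False
          then have "\<chi> n = 0" using dcharacter_eq_0_iff[OF dchar] by blast
          with False show ?thesis by simp
        qed
      qed (simp add: mangoldt_nonneg)
      also have "\<dots> = 4 * (coprime_Lam l z + Re (LLam z))"
        unfolding coprime_Lam_def LLam_def Re_sum sum.distrib[symmetric] sum_distrib_left
        by (intro sum.cong refl) (simp add: algebra_simps Re_divide_of_nat add_divide_distrib)
      finally have 1: "coprime_Lam l z - Re (sq.LLam z) \<le> 4 * (coprime_Lam l z + Re (LLam z))" .
      have "Re (LLam z + of_real (ln z)) \<le> 4 * real l"
        using norm_LLam_plus_ln_le_if_L_zero[OF L0 z] complex_Re_le_cmod order_trans by blast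
      then have "Re (LLam z) \<le> 4 * real l - ln z" by simp
      moreover have "0 \<le> real l" "0 \<le> ln (real l)" by simp_all
      ultimately show ?thesis using 1 C[OF z] coprime_Lam_bounds[OF l z] by argo
    qed
    define D where "D = C + 65 + 16 * real l + 50 * ln (real l)"
    have "ln (exp (\<bar>D\<bar> + 1)) \<le> D" unfolding D_def by (rule bound) simp
    then show False by simp
  qed
qed

lemma norm_LLam_bounded:
  assumes "l \<ge> 2" "z \<ge> 1"
  shows "norm (LLam z) \<le> (22 * real l + 2) / norm L"
  using norm_LLam_le_if_L_nonzero[OF L_nonzero[OF assms(1)] assms(2)] .

end

section \<open>Mertens' theorem in residue classes\<close>

lemma character_sum_mangoldt_bounded:
  assumes "l \<ge> 2" "\<chi> \<in> dchars l"
  shows "\<exists>C. \<forall>z\<ge>1. norm ((\<Sum>n\<in>pos_le z. \<chi> n / of_nat n * of_real (mangoldt n)) -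
     (if \<chi> = principal_dchar l then of_real (ln z) else 0)) \<le> C"
proof (cases "\<chi> = principal_dchar l")
  case True
  show ?thesis
  proof (intro exI allI impI)
    fix z :: real assume z: "z \<ge> 1"
    have "(\<Sum>n\<in>pos_le z. \<chi> n / of_nat n * of_real (mangoldt n)) = of_real (coprime_Lam l z)"
      unfolding coprime_Lam_def True principal_dchar_def of_real_sum by (intro sum.cong refl) auto
    then have "(\<Sum>n\<in>pos_le z. \<chi> n / of_nat n * of_real (mangoldt n)) - (if \<chi> = principal_dchar l then of_real (ln z) else 0) =
        of_real (coprime_Lam l z - ln z)" using True by simp
    moreover have "\<bar>coprime_Lam l z - ln z\<bar> \<le> 13 + 50 * ln (real l)"
      using coprime_Lam_bounds[OF assms(1) z] assms(1) by (intro abs_leI) (simp_all add: add_increasing2)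
    ultimately show "norm ((\<Sum>n\<in>pos_le z. \<chi> n / of_nat n * of_real (mangoldt n)) -
      (if \<chi> = principal_dchar l then of_real (ln z) else 0)) \<le> 13 + 50 * ln (real l)" by (simp only: norm_of_real)
  qed
next
  case False
  interpret nonprincipal_dchar l \<chi>
    by unfold_locales (use assms False in \<open>auto simp: dchars_def\<close>)
  show ?thesis
    using norm_LLam_bounded[OF assms(1)] False unfolding LLam_def by auto
qed

text \<open>With i inverse to j modulo l, orthogonality of characters at i n detects the class of j.
  Only the principal character contributes ln z; the sums for the others are bounded because
  \<open>L\<close> does not vanish.\<close>

lemma mertens_arithmetic_progression_mangoldt:
  assumes l: "l \<ge> 2" and j: "coprime j l"
  shows "\<exists>C. \<forall>z\<ge>1. \<bar>(\<Sum>n\<in>pos_le z. if [n = j] (mod l) then mangoldt n / real n else 0) - ln z / real (totient l)\<bar> \<le> C"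
proof -
  have l0: "l > 0" using l by simp
  obtain i where i: "[j * i = 1] (mod l)" using cong_solve_coprime_nat[OF j] by auto
  have iff: "(i * n) mod l = 1 \<longleftrightarrow> [n = j] (mod l)" for n
  proof -
    have "(i * n) mod l = 1 \<longleftrightarrow> [i * n = 1] (mod l)"
      using l by (simp add: unique_euclidean_semiring_class.cong_def)
    also have "\<dots> \<longleftrightarrow> [n = j] (mod l)"
    proof
      assume "[i * n = 1] (mod l)"
      then have "[j * (i * n) = j * 1] (mod l)" by (rule cong_scalar_left)
      moreover have "[(j * i) * n = 1 * n] (mod l)" using i by (rule cong_scalar_right)
      ultimately show "[n = j] (mod l)" by (metis cong_sym cong_trans mult.assoc mult_1 mult_1_right)
    next
      assume "[n = j] (mod l)"
      then have "[i * n = i * j] (mod l)" by (rule cong_scalar_left)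
      with i show "[i * n = 1] (mod l)" by (metis cong_trans mult.commute)
    qed
    finally show ?thesis .
  qed
  have "\<forall>\<chi>\<in>dchars l. \<exists>C. \<forall>z\<ge>1. norm ((\<Sum>n\<in>pos_le z. \<chi> n / of_nat n * of_real (mangoldt n)) -
     (if \<chi> = principal_dchar l then of_real (ln z) else 0)) \<le> C"
    using character_sum_mangoldt_bounded[OF l] by blast
  then obtain C where C: "\<And>\<chi> z. \<chi> \<in> dchars l \<Longrightarrow> z \<ge> 1 \<Longrightarrow> norm ((\<Sum>n\<in>pos_le z. \<chi> n / of_nat n * of_real (mangoldt n)) -
     (if \<chi> = principal_dchar l then of_real (ln z) else 0)) \<le> C \<chi>" by metis
  show ?thesis
  proof (intro exI allI impI)
    fix z :: real assume z: "z \<ge> 1"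
    define S where "S = (\<Sum>n\<in>pos_le z. if [n = j] (mod l) then mangoldt n / real n else 0)"
    have "of_real (real (totient l) * S) = (\<Sum>n\<in>pos_le z. (\<Sum>\<chi>\<in>dchars l. \<chi> (i * n)) * of_real (mangoldt n / real n))"
      unfolding S_def sum_distrib_left of_real_sum sum_dchars[OF l] iff by (intro sum.cong refl) auto
    also have "\<dots> = (\<Sum>\<chi>\<in>dchars l. \<chi> i * (\<Sum>n\<in>pos_le z. \<chi> n / of_nat n * of_real (mangoldt n)))"
      unfolding sum_distrib_right sum_distrib_left
      by (subst sum.swap) (intro sum.cong refl, auto simp: dchars_def dcharacter_mult)
    finally have eq: "of_real (real (totient l) * S) = (\<Sum>\<chi>\<in>dchars l. \<chi> i * (\<Sum>n\<in>pos_le z. \<chi> n / of_nat n * of_real (mangoldt n)))" .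
    have "coprime i l"
    proof -
      have "coprime (j * i) l" using i cong_imp_coprime[OF cong_sym[OF i]] by simp
      then show ?thesis by simp
    qed
    then have "(\<Sum>\<chi>\<in>dchars l. \<chi> i * (if \<chi> = principal_dchar l then of_real (ln z) else 0)) = (\<Sum>\<chi>\<in>dchars l. if \<chi> = principal_dchar l then of_real (ln z) else 0)"
      by (intro sum.cong refl) (auto simp: principal_dchar_def)
    also have "\<dots> = of_real (ln z)"
      using finite_dchars[OF l0] dcharacter_principal[OF l0] by (subst sum.delta) (auto simp: dchars_def)
    finally have "of_real (real (totient l) * S - ln z) =
        (\<Sum>\<chi>\<in>dchars l. \<chi> i * ((\<Sum>n\<in>pos_le z. \<chi> n / of_nat n * of_real (mangoldt n)) - (if \<chi> = principal_dchar l then of_real (ln z) else 0)))"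
      using eq by (simp only: of_real_diff right_diff_distrib sum_subtractf)
    then have "norm (of_real (real (totient l) * S - ln z) :: complex) \<le> (\<Sum>\<chi>\<in>dchars l. C \<chi>)"
    proof (simp only:, intro order_trans[OF norm_sum sum_mono])
      fix \<chi> assume \<chi>: "\<chi> \<in> dchars l"
      let ?D = "(\<Sum>n\<in>pos_le z. \<chi> n / of_nat n * of_real (mangoldt n)) - (if \<chi> = principal_dchar l then of_real (ln z) else 0)"
      have "norm (\<chi> i) * norm ?D \<le> 1 * C \<chi>"
        using \<chi> C[OF \<chi> z] norm_dcharacter_le[of l \<chi> i] l0 by (intro mult_mono) (auto simp: dchars_def)
      then show "norm (\<chi> i * ?D) \<le> C \<chi>" by (simp only: norm_mult mult_1)
    qed
    then have 1: "\<bar>real (totient l) * S - ln z\<bar> \<le> (\<Sum>\<chi>\<in>dchars l. C \<chi>)" by (simp only: norm_of_real)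
    have t: "real (totient l) > 0" using l0 by simp
    have "S - ln z / real (totient l) = (real (totient l) * S - ln z) / real (totient l)" using t by (simp add: field_simps)
    then have "\<bar>S - ln z / real (totient l)\<bar> = \<bar>real (totient l) * S - ln z\<bar> / real (totient l)" using t by simp
    also have "\<dots> \<le> (\<Sum>\<chi>\<in>dchars l. C \<chi>) / real (totient l)" using 1 t by (intro divide_right_mono) auto
    finally show "\<bar>(\<Sum>n\<in>pos_le z. if [n = j] (mod l) then mangoldt n / real n else 0) - ln z / real (totient l)\<bar> \<le> (\<Sum>\<chi>\<in>dchars l. C \<chi>) / real (totient l)"
      unfolding S_def .
  qed
qed

text \<open>The 17 is 2 for the proper prime powers plus 15 for Mertens' theorem over all primes,
  whose share \<open>1 / totient l\<close> is subtracted.\<close>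

lemma mertens_arithmetic_progression:
  assumes l: "l \<ge> 2" and j: "coprime j l"
  shows "\<exists>M\<ge>1. \<forall>n. \<bar>\<Sum>p\<in>primes_in 1 n. ((if [p = j] (mod l) then 1 else 0) - 1 / real (totient l)) * ln (real p) / real p\<bar> \<le> M"
proof -
  obtain C where C: "\<And>z. z \<ge> 1 \<Longrightarrow> \<bar>(\<Sum>n\<in>pos_le z. if [n = j] (mod l) then mangoldt n / real n else 0) - ln z / real (totient l)\<bar> \<le> C"
    using mertens_arithmetic_progression_mangoldt[OF assms] by blast
  have t: "real (totient l) \<ge> 1" using l by (simp add: Suc_le_eq)
  show ?thesis
  proof (intro exI[of _ "\<bar>C\<bar> + 17"] conjI allI)
    fix n
    show "\<bar>\<Sum>p\<in>primes_in 1 n. ((if [p = j] (mod l) then 1 else 0) - 1 / real (totient l)) * ln (real p) / real p\<bar> \<le> \<bar>C\<bar> + 17"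
    proof (cases "n = 0")
      case False
      then have n: "real n \<ge> 1" by simp
      let ?P = "{p. p \<in> pos_le (real n) \<and> prime p}"
      have P: "primes_in 1 n = ?P" unfolding pos_le_of_nat by (auto simp: primes_in_def)
      define A where "A = (\<Sum>p\<in>?P. if [p = j] (mod l) then ln (real p) / real p else 0)"
      define B where "B = (\<Sum>p\<in>?P. ln (real p) / real p)"
      define R where "R = (\<Sum>(q, a)\<in>ppow_le (real n). if a = 1 then 0 else if [q ^ a = j] (mod l) then ln (real q) / real q ^ a else 0)"
      have eq: "(\<Sum>p\<in>primes_in 1 n. ((if [p = j] (mod l) then 1 else 0) - 1 / real (totient l)) * ln (real p) / real p) = A - B / real (totient l)"
        unfolding A_def B_def P sum_divide_distrib sum_subtractf[symmetric]
        by (intro sum.cong refl) (simp add: algebra_simps diff_divide_distrib)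
      have "(\<Sum>m\<in>pos_le (real n). if [m = j] (mod l) then mangoldt m / real m else 0) =
          (\<Sum>m\<in>pos_le (real n). mangoldt m * (if [m = j] (mod l) then 1 / real m else 0))"
        by (intro sum.cong) auto
      also have "\<dots> = (\<Sum>(q, a)\<in>ppow_le (real n). ln (real q) * (if [q ^ a = j] (mod l) then 1 / real (q ^ a) else 0))"
        by (rule sum_mangoldt_eq_ppow)
      also have "\<dots> = (\<Sum>(q, a)\<in>ppow_le (real n). if [q ^ a = j] (mod l) then ln (real q) / real q ^ a else 0)"
        by (intro sum.cong refl) auto
      also have "\<dots> = A + R"
        unfolding A_def R_def by (subst sum_ppow_split_primes) (simp cong: if_cong)
      finally have AR: "\<bar>A + R - ln (real n) / real (totient l)\<bar> \<le> C" using C[OF n] by simp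
      have "R \<ge> 0" unfolding R_def by (intro sum_nonneg) auto
      moreover have "R \<le> (\<Sum>(q, a)\<in>ppow_le (real n). if a = 1 then 0 else ln (real q) / real q ^ a)"
        unfolding R_def by (intro sum_mono) auto
      ultimately have R: "\<bar>R\<bar> \<le> 2" using sum_ppow_higher_ln_le[of "real n"] by linarith
      have "\<bar>B - ln (real n)\<bar> \<le> 15" unfolding B_def by (rule sum_primes_ln_div_bound[OF n])
      then have "\<bar>B - ln (real n)\<bar> / real (totient l) \<le> 15 / 1" using t by (intro frac_le) auto
      then have B: "\<bar>B / real (totient l) - ln (real n) / real (totient l)\<bar> \<le> 15"
        using t by (simp add: diff_divide_distrib[symmetric])
      show ?thesis unfolding eq using AR R B by linarith
    qed (auto simp: primes_in_def)
  qed auto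
qed

section \<open>The asymptotic formula\<close>

lemma mertens_weight_residue_class:
  assumes l: "l \<ge> 2" and j: "coprime j l"
  shows "\<exists>M. mertens_weight (\<lambda>n. (if [n = j] (mod l) then 1 else 0) - 1 / real (totient l)) M"
proof -
  obtain M where M: "M \<ge> 1"
    "\<And>n. \<bar>\<Sum>p\<in>primes_in 1 n. ((if [p = j] (mod l) then 1 else 0) - 1 / real (totient l)) * ln (real p) / real p\<bar> \<le> M"
    using mertens_arithmetic_progression[OF assms] by blast
  have t: "real (totient l) \<ge> 1" using l by (simp add: Suc_le_eq)
  then have "1 / real (totient l) \<le> 1 / 1" by (intro frac_le) auto
  then have "mertens_weight (\<lambda>n. (if [n = j] (mod l) then 1 else 0) - 1 / real (totient l)) M"
    using M by unfold_locales auto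
  then show ?thesis by blast
qed

text \<open>K exceeds the binary double logarithm of x by at most 1; each factor 2 converts a binary
  into a natural logarithm by \<open>ln 2 \<ge> 1 / 2\<close>.\<close>

lemma ex_double_power_two_ge:
  assumes "x \<ge> (4::real)"
  shows "\<exists>K\<ge>1. x < 2 ^ 2 ^ K \<and> real K \<le> 2 * ln (2 * ln x) + 1"
proof -
  define K where "K = nat \<lfloor>log 2 (log 2 x)\<rfloor> + 1"
  have l1: "log 2 x \<ge> 2" using assms by (simp add: le_log_iff powr_numeral)
  then have l2: "log 2 (log 2 x) \<ge> 1" by (simp add: le_log_iff)
  have K: "log 2 (log 2 x) < real K" "real K \<le> log 2 (log 2 x) + 1" unfolding K_def using l2 by linarith+
  have "log 2 x < 2 powr real K" using K(1) l1 by (simp add: log_less_iff)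
  then have "log 2 x < real (2 ^ K)" by (simp add: powr_realpow)
  then have "x < 2 powr real (2 ^ K)" using assms by (subst (asm) log_less_iff) auto
  also have "\<dots> = 2 ^ 2 ^ K" by (rule powr_realpow) simp
  finally have "x < 2 ^ 2 ^ K" .
  moreover have "log 2 (log 2 x) \<le> 2 * ln (2 * ln x)"
  proof -
    have le: "log 2 y \<le> 2 * ln y" if "y \<ge> 1" for y :: real
    proof -
      have "ln y * 1 \<le> ln y * (2 * ln 2)" using ln_ge_half[of 2] that by (intro mult_left_mono) auto
      then show ?thesis unfolding log_def by (simp add: field_simps)
    qed
    have "log 2 (log 2 x) \<le> 2 * ln (log 2 x)" using l1 by (intro le) simp
    also have "ln (log 2 x) \<le> ln (2 * ln x)" using l1 le[of x] assms by simp
    finally show ?thesis by simp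
  qed
  moreover have "K \<ge> 1" by (simp add: K_def)
  ultimately show ?thesis using K by (intro exI[of _ K]) linarith
qed

lemma N3_eq: "real (N3 x l j) - real (card (pos_le x)) / real (totient l) =
    (\<Sum>n\<in>pos_le x. (if [P3 n = j] (mod l) then 1 else 0) - 1 / real (totient l))"
proof -
  have "N3 x l j = card {n \<in> pos_le x. [P3 n = j] (mod l)}"
    unfolding N3_def res_count_def by (rule arg_cong[where f = card]) auto
  also have "real \<dots> = (\<Sum>n\<in>{n \<in> pos_le x. [P3 n = j] (mod l)}. 1)" by simp
  also have "\<dots> = (\<Sum>n\<in>pos_le x. if [P3 n = j] (mod l) then 1 else 0)"
    by (rule sum.inter_filter) auto
  finally show ?thesis by (simp add: sum_subtractf)
qed

text \<open>The factor 27 is the cube of 3, since eventually \<open>K \<le> 3 * ln (ln x)\<close>;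
  the additional 1 pays for replacing the number of integers up to x by x.\<close>

lemma N3_asymptotic:
  assumes l: "l \<ge> 2" and j: "coprime j l"
  shows "(\<lambda>x. real (N3 x l j) - x / real (totient l)) \<in> O[at_top](\<lambda>x. x * (ln (ln x)) ^ 3 / ln x)"
proof -
  obtain M where "mertens_weight (\<lambda>n. (if [n = j] (mod l) then 1 else 0) - 1 / real (totient l)) M"
    using mertens_weight_residue_class[OF assms] by blast
  then interpret mertens_weight "\<lambda>n. (if [n = j] (mod l) then 1 else 0) - 1 / real (totient l)" M .
  obtain C where C: "C \<ge> 0" "\<And>K x. 1 \<le> K \<Longrightarrow> 1 \<le> x \<Longrightarrow> x < 2 ^ 2 ^ K \<Longrightarrow>
      \<bar>\<Sum>n\<in>pos_le x. (if [P3 n = j] (mod l) then 1 else 0) - 1 / real (totient l)\<bar> * ln x \<le> C * real K ^ 3 * x"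
    using sum_c_P3_bound by blast
  have t: "real (totient l) \<ge> 1" using l by (simp add: Suc_le_eq)
  have ev1: "\<forall>\<^sub>F x::real in at_top. 2 * ln (2 * ln x) + 1 \<le> 3 * ln (ln x)" by real_asymp
  have ev2: "\<forall>\<^sub>F x::real in at_top. 1 \<le> x * (ln (ln x)) ^ 3 / ln x" by real_asymp
  have ev3: "\<forall>\<^sub>F x::real in at_top. x \<ge> 4" by (rule eventually_ge_at_top)
  have ev4: "\<forall>\<^sub>F x::real in at_top. ln x > 0" by real_asymp
  show ?thesis
  proof (rule bigoI[of _ "27 * C + 1"])
    show "\<forall>\<^sub>F x in at_top. norm (real (N3 x l j) - x / real (totient l)) \<le> (27 * C + 1) * norm (x * (ln (ln x)) ^ 3 / ln x)"
      using ev1 ev2 ev3 ev4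
    proof eventually_elim
      case (elim x)
      let ?g = "x * (ln (ln x)) ^ 3 / ln x"
      obtain K where K: "K \<ge> 1" "x < 2 ^ 2 ^ K" "real K \<le> 2 * ln (2 * ln x) + 1"
        using ex_double_power_two_ge[OF elim(3)] by blast
      have "real K ^ 3 \<le> (3 * ln (ln x)) ^ 3" using K(3) elim(1) by (intro power_mono) auto
      then have K3: "real K ^ 3 \<le> 27 * (ln (ln x)) ^ 3" by (simp add: power_mult_distrib)
      define S where "S = real (N3 x l j) - real (card (pos_le x)) / real (totient l)"
      have "\<bar>S\<bar> * ln x \<le> C * real K ^ 3 * x"
        unfolding S_def N3_eq using C(2)[OF K(1) _ K(2)] elim(3) by simp
      also have "\<dots> \<le> C * (27 * (ln (ln x)) ^ 3) * x"
        using K3 C(1) elim(3) by (intro mult_right_mono mult_left_mono) auto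
      finally have S: "\<bar>S\<bar> \<le> 27 * C * ?g" using elim(4) by (simp add: field_simps)
      have "\<bar>real (card (pos_le x)) - x\<bar> \<le> 1"
        using card_pos_le_le[of x] card_pos_le_ge[of x] elim(3) by (simp add: abs_le_iff)
      then have "\<bar>real (card (pos_le x)) - x\<bar> / real (totient l) \<le> 1 / 1" using t by (intro frac_le) auto
      then have d: "\<bar>real (card (pos_le x)) / real (totient l) - x / real (totient l)\<bar> \<le> 1"
        using t by (simp add: diff_divide_distrib[symmetric])
      have "\<bar>real (N3 x l j) - x / real (totient l)\<bar> \<le> \<bar>S\<bar> + 1" using d unfolding S_def by linarith
      also have "\<dots> \<le> 27 * C * ?g + ?g" using S elim(2) by linarith
      also have "\<dots> = (27 * C + 1) * ?g" by (simp only: distrib_right mult_1)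
      also have "?g = norm ?g"
        unfolding real_norm_def using elim(2) by (intro abs_of_nonneg[symmetric]) linarith
      finally show ?case by simp
    qed
  qed
qed

lemma unif_dist_reduced_P3:
  assumes l: "l \<ge> 2"
  shows "unif_dist_reduced P3 l"
  unfolding unif_dist_reduced_def
proof (intro ballI impI)
  fix j assume "coprime j l"
  then have "(\<lambda>x. real (N3 x l j) - x / real (totient l)) \<in> O[at_top](\<lambda>x. x * (ln (ln x)) ^ 3 / ln x)"
    by (intro N3_asymptotic l)
  also have "(\<lambda>x::real. x * (ln (ln x)) ^ 3 / ln x) \<in> o[at_top](\<lambda>x. x)" by real_asymp
  finally have "((\<lambda>x. (real (N3 x l j) - x / real (totient l)) / x) \<longlongrightarrow> 0) at_top"
    by (rule smalloD_tendsto)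
  then have "((\<lambda>x. (real (N3 x l j) - x / real (totient l)) / x + 1 / real (totient l)) \<longlongrightarrow> 0 + 1 / real (totient l)) at_top"
    by (intro tendsto_intros)
  moreover have "\<forall>\<^sub>F x in at_top. (real (N3 x l j) - x / real (totient l)) / x + 1 / real (totient l) = real (res_count P3 l j x) / x"
    using eventually_gt_at_top[of 0]
    by eventually_elim (simp add: N3_def diff_divide_distrib)
  ultimately show "((\<lambda>x. real (res_count P3 l j x) / x) \<longlongrightarrow> 1 / real (totient l)) at_top"
    by (simp add: tendsto_cong)
qed

theorem theorem3p4:
  fixes l :: nat
  assumes "l \<ge> 2"
  shows "(\<forall>j\<in>{1..l}. coprime j l \<longrightarrow>
            (\<lambda>x::real. real (N3 x l j) - x / real (totient l))
              \<in> O[at_top](\<lambda>x. x * (ln (ln x)) ^ 3 / ln x))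
         \<and> unif_dist_reduced P3 l"
proof (intro conjI ballI impI)
  fix j assume "coprime j l"
  then show "(\<lambda>x::real. real (N3 x l j) - x / real (totient l)) \<in> O[at_top](\<lambda>x. x * (ln (ln x)) ^ 3 / ln x)"
    by (intro N3_asymptotic assms)
qed (intro unif_dist_reduced_P3 assms)


end
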